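(* Let $X$ be a super-Brownian motion on $\mathbb{R}^d$ ($d\ge1$) with a spatially dependent (sub)critical branching mechanism $\Psi$ satisfying $$\Psi(x,u)\ge\beta(x)\Phi(u),\qquad x\in\mathbb{R}^d,\ u\ge0,$$ where $\beta$ is a positive bounded continuous function on $\mathbb{R}^d$ and $\Phi$ is a spatially constant (sub)critical branching mechanism that is regularly varying at infinity with index $1+p$ for some $p\in(0,1]$, that is, $\Phi(u)=u^{1+p}L(u)$ as $u\to\infty$ for a function $L$ slowly varying at infinity. Set $\beta_R:=\inf_{x\in\overline{B(0,R)}}\beta(x)$. If $$\limsup_{R\to\infty}\frac{\ln\beta_R}{R^2}>-\infty,$$ then $X$ has the finite-time compact support property: for every $t>0$ and $\mu\in M_c$, $$\mathbb{P}_\mu\left\{\overline{\bigcup_{s\le t}S(X_s)}\text{ is compact}\right\}=1 .$$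
   Context: $B(x,R)$ is the open Euclidean ball in $\mathbb{R}^d$, $\overline{B(x,R)}$ the closed ball. $P_x$ denotes the law of, and expectation for, a standard $d$-dimensional Brownian motion $W$ started at $x$. Branching mechanisms. A (general) branching mechanism is a function $\Psi:\mathbb{R}^d\times[0,\infty)\to\mathbb{R}$, $$\Psi(x,u)=\alpha(x)u+\gamma(x)u^2+\int_0^\infty(e^{-\lambda u}-1+\lambda u)\,\pi(x,\mathrm{d}\lambda),$$ with $\alpha,\gamma$ bounded continuous on $\mathbb{R}^d$, $\gamma\ge 0$, and $(\lambda\wedge\lambda^2)\pi(x,\mathrm{d}\lambda)$ a bounded kernel from $\mathbb{R}^d$ to $(0,\infty)$. It is spatially constant, written $\Phi(u)$, if $\alpha,\gamma,\pi$ do not depend on $x$. It is subcritical if $\alpha(x)>0$ for all $x$, critical if $\alpha\equiv0$; (sub)critical means critical or subcritical. Standing assumptions: every branching mechanism is (sub)critical and non-degenerate, i.e. $\alpha(x)+\gamma(x)+\pi(x,(0,\infty))>0$ for all $x$ (for spatially constant ones, $\alpha+\gamma+\pi((0,\infty))>0$). Measures. $M_F$ is the space of finite measures on $\mathbb{R}^d$ with the weak topology; $S(\mu)$ is the topological support of $\mu$; $M_c\subset M_F$ is the set of measures with compact support; $\langle f,\mu\rangle=\int f\,\mathrm{d}\mu$. $\overline{A}$ denotes the closure of a set $A$. Super-Brownian motion with branching mechanism $\Psi$: the càdlàg $M_F$-valued Markov process $X=(X_t)_{t\ge0}$ (canonical Borel right realization on Skorokhod space), with law $\mathbb{P}_\mu$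 when $X_0=\mu$, such that for bounded measurable $f\ge0$, $\mathbb{P}_\mu[\exp(-\langle f,X_t\rangle)]=\exp(-\langle v(\cdot,t),\mu\rangle)$, where $v$ is the unique non-negative solution of $v(x,t)=P_x[f(W_t)]-P_x\big[\int_0^t\Psi(W_s,v(W_s,t-s))\,\mathrm{d}s\big]$. *)

theory Defs
  imports "HOL-Probability.Probability"
begin

section \<open>Branching mechanisms\<close>

text \<open>
  The jump part \<open>\<pi> x\<close> is a measure on the Borel sets of the open half-line \<open>{0<..}\<close>,
  possibly of infinite mass. Only the weighted measure \<open>(\<lambda> \<and> \<lambda>\<^sup>2) \<pi>(x, d\<lambda>)\<close> is a finite kernel.
\<close>

definition jump_weighted :: "real measure \<Rightarrow> real measure" where
  "jump_weighted m = density m (\<lambda>l. ennreal (min l (l\<^sup>2)))"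

definition branching_coefficients ::
  "('a::euclidean_space \<Rightarrow> real) \<Rightarrow> ('a \<Rightarrow> real) \<Rightarrow> ('a \<Rightarrow> real measure) \<Rightarrow> bool" where
  "branching_coefficients \<alpha> \<gamma> \<pi> \<longleftrightarrow>
     continuous_on UNIV \<alpha> \<and> bounded (range \<alpha>) \<and>
     continuous_on UNIV \<gamma> \<and> bounded (range \<gamma>) \<and> (\<forall>x. 0 \<le> \<gamma> x) \<and>
     (\<forall>x. sets (\<pi> x) = sets (restrict_space borel {0<..})) \<and>
     (\<forall>B \<in> sets (restrict_space borel {0<..}).
        (\<lambda>x. emeasure (jump_weighted (\<pi> x)) B) \<in> borel_measurable borel) \<and>
     (\<exists>C::real. \<forall>x. emeasure (jump_weighted (\<pi> x)) {0<..} \<le> ennreal C)"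

definition branching_function :: "real \<Rightarrow> real \<Rightarrow> real measure \<Rightarrow> real \<Rightarrow> real" where
  "branching_function a g m u = a * u + g * u\<^sup>2 + (\<integral>l. (exp (- (l * u)) - 1 + l * u) \<partial>m)"

definition subcritical :: "('a \<Rightarrow> real) \<Rightarrow> bool" where
  "subcritical \<alpha> \<longleftrightarrow> (\<forall>x. 0 < \<alpha> x)"

definition critical :: "('a \<Rightarrow> real) \<Rightarrow> bool" where
  "critical \<alpha> \<longleftrightarrow> (\<forall>x. \<alpha> x = 0)"

definition nondegenerate ::
  "('a \<Rightarrow> real) \<Rightarrow> ('a \<Rightarrow> real) \<Rightarrow> ('a \<Rightarrow> real measure) \<Rightarrow> bool" where
  "nondegenerate \<alpha> \<gamma> \<pi> \<longleftrightarrow>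
     (\<forall>x. 0 < ennreal (\<alpha> x) + ennreal (\<gamma> x) + emeasure (\<pi> x) {0<..})"

text \<open>
  The standing assumptions ((sub)criticality and non-degeneracy) are part of the notion.
  A branching mechanism is a function on \<open>[0,\<infinity>)\<close> in its second argument, so its values at
  negative \<open>u\<close> are unconstrained.
\<close>

definition has_branching_coefficients ::
  "('a::euclidean_space \<Rightarrow> real \<Rightarrow> real) \<Rightarrow>
   ('a \<Rightarrow> real) \<Rightarrow> ('a \<Rightarrow> real) \<Rightarrow> ('a \<Rightarrow> real measure) \<Rightarrow> bool" where
  "has_branching_coefficients \<Psi> \<alpha> \<gamma> \<pi> \<longleftrightarrow>
     branching_coefficients \<alpha> \<gamma> \<pi> \<and>
     (subcritical \<alpha> \<or> critical \<alpha>) \<and>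
     nondegenerate \<alpha> \<gamma> \<pi> \<and>
     (\<forall>x. \<forall>u\<ge>0. \<Psi> x u = branching_function (\<alpha> x) (\<gamma> x) (\<pi> x) u)"

definition branching_mechanism :: "('a::euclidean_space \<Rightarrow> real \<Rightarrow> real) \<Rightarrow> bool" where
  "branching_mechanism \<Psi> \<longleftrightarrow> (\<exists>\<alpha> \<gamma> \<pi>. has_branching_coefficients \<Psi> \<alpha> \<gamma> \<pi>)"

definition spatially_constant_branching_mechanism ::
  "('a::euclidean_space \<Rightarrow> real \<Rightarrow> real) \<Rightarrow> bool" where
  "spatially_constant_branching_mechanism \<Psi> \<longleftrightarrow>
     (\<exists>a g m. has_branching_coefficients \<Psi> (\<lambda>_. a) (\<lambda>_. g) (\<lambda>_. m))"


section \<open>Regular variation at infinity\<close>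

definition slowly_varying :: "(real \<Rightarrow> real) \<Rightarrow> bool" where
  "slowly_varying L \<longleftrightarrow>
     (\<exists>u0. (\<forall>u\<ge>u0. 0 < L u) \<and> L \<in> borel_measurable (restrict_space borel {u0..})) \<and>
     (\<forall>c>0. ((\<lambda>u. L (c * u) / L u) \<longlongrightarrow> 1) at_top)"

definition regularly_varying :: "real \<Rightarrow> (real \<Rightarrow> real) \<Rightarrow> bool" where
  "regularly_varying \<rho> F \<longleftrightarrow>
     (\<exists>L. slowly_varying L \<and> (\<forall>\<^sub>F u in at_top. F u = u powr \<rho> * L u))"


section \<open>Finite measures with the weak topology\<close>

definition finite_measures :: "'a::euclidean_space measure set" where
  "finite_measures = {\<mu>. sets \<mu> = sets borel \<and> finite_measure \<mu>}"

definition weak_measure_topology :: "'a::euclidean_space measure topology" where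
  "weak_measure_topology = topology_generated_by
     {{\<mu> \<in> finite_measures. (\<integral>x. f x \<partial>\<mu>) \<in> U} | (f :: 'a \<Rightarrow> real) U.
        continuous_on UNIV f \<and> bounded (range f) \<and> open U}"

definition finite_measures_borel :: "'a::euclidean_space measure measure" where
  "finite_measures_borel = sigma finite_measures {U. openin weak_measure_topology U}"

definition measure_support :: "'a::euclidean_space measure \<Rightarrow> 'a set" where
  "measure_support \<mu> = {x. \<forall>U. open U \<and> x \<in> U \<longrightarrow> 0 < emeasure \<mu> U}"

definition compactly_supported_measures :: "'a::euclidean_space measure set" where
  "compactly_supported_measures = {\<mu> \<in> finite_measures. compact (measure_support \<mu>)}"

lemma topspace_weak_measure_topology [simp]:
  "topspace weak_measure_topology = (finite_measures :: 'a::euclidean_space measure set)"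
proof -
  have "finite_measures \<in> {{\<mu> \<in> finite_measures. (\<integral>x. f x \<partial>\<mu>) \<in> U} | (f :: 'a \<Rightarrow> real) U.
        continuous_on UNIV f \<and> bounded (range f) \<and> open U}"
    by (rule CollectI, rule exI[of _ "\<lambda>_. 0"], rule exI[of _ UNIV]) auto
  then show ?thesis
    unfolding weak_measure_topology_def topology_generated_by_topspace by auto
qed


section \<open>Path spaces\<close>

text \<open>
  Paths are indexed by \<open>{0..}\<close> and, following \<^const>\<open>PiM\<close>, equal \<^const>\<open>undefined\<close> at negative
  times. Both path spaces carry the \<open>\<sigma>\<close>-algebra generated by the coordinate maps; on the
  continuous paths it is the Borel \<open>\<sigma>\<close>-algebra of locally uniform convergence, on the cadlag
  paths it is the Borel \<open>\<sigma>\<close>-algebra of the Skorokhod topology.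
\<close>

definition wiener_space :: "(real \<Rightarrow> 'a::euclidean_space) measure" where
  "wiener_space = restrict_space (PiM {0..} (\<lambda>_. borel)) {w. continuous_on {0..} w}"

definition cadlag :: "(real \<Rightarrow> 'a::euclidean_space measure) \<Rightarrow> bool" where
  "cadlag \<omega> \<longleftrightarrow>
     (\<forall>t\<ge>0. limitin weak_measure_topology \<omega> (\<omega> t) (at_right t)) \<and>
     (\<forall>t>0. \<exists>\<nu>. limitin weak_measure_topology \<omega> \<nu> (at_left t))"

definition skorokhod_space :: "(real \<Rightarrow> 'a::euclidean_space measure) measure" where
  "skorokhod_space = restrict_space (PiM {0..} (\<lambda>_. finite_measures_borel)) {\<omega>. cadlag \<omega>}"

definition past :: "real \<Rightarrow> (real \<Rightarrow> 'a::euclidean_space measure) measure" where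
  "past s = vimage_algebra (space skorokhod_space) (\<lambda>\<omega>. restrict \<omega> {0..s})
              (PiM {0..s} (\<lambda>_. finite_measures_borel))"

definition time_shift :: "real \<Rightarrow> (real \<Rightarrow> 'b) \<Rightarrow> (real \<Rightarrow> 'b)" where
  "time_shift s \<omega> = (\<lambda>t\<in>{0..}. \<omega> (s + t))"


section \<open>Brownian motion\<close>

definition brownian_law :: "'a::euclidean_space \<Rightarrow> (real \<Rightarrow> 'a) measure \<Rightarrow> bool" where
  "brownian_law x M \<longleftrightarrow>
     prob_space M \<and> sets M = sets wiener_space \<and>
     (AE w in M. w 0 = x) \<and>
     (\<forall>s t. 0 \<le> s \<and> s < t \<longrightarrow>
        distributed M lborel (\<lambda>w. w t - w s)
          (\<lambda>y. ennreal (\<Prod>b\<in>Basis. normal_density 0 (sqrt (t - s)) (y \<bullet> b)))) \<and>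
     (\<forall>(n::nat) \<tau>. 0 \<le> \<tau> 0 \<and> (\<forall>i<n. \<tau> i < \<tau> (Suc i)) \<longrightarrow>
        prob_space.indep_vars M (\<lambda>_. borel) (\<lambda>i w. w (\<tau> (Suc i)) - w (\<tau> i)) {..<n})"


section \<open>Super-Brownian motion\<close>

text \<open>
  In the following, \<open>W x\<close> is the law of Brownian motion started at \<open>x\<close>, and \<open>v\<close> is a function of
  \<open>x\<close> and of a time \<open>t \<ge> 0\<close>. Integrability need not be demanded separately: since
  \<open>\<Psi> \<ge> 0\<close>, every measurable \<open>v \<ge> 0\<close> satisfying the equation is at most \<open>sup f\<close>, hence
  \<open>\<Psi>(y, v(y, r))\<close> is bounded and measurable in \<open>(y, r)\<close>.
\<close>

definition mild_solution ::
  "('a::euclidean_space \<Rightarrow> (real \<Rightarrow> 'a) measure) \<Rightarrow> ('a \<Rightarrow> real \<Rightarrow> real) \<Rightarrow>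
   ('a \<Rightarrow> real) \<Rightarrow> ('a \<Rightarrow> real \<Rightarrow> real) \<Rightarrow> bool" where
  "mild_solution W \<Psi> f v \<longleftrightarrow>
     (\<lambda>(x, t). v x t) \<in> borel_measurable (borel \<Otimes>\<^sub>M restrict_space borel {0..}) \<and>
     (\<forall>x. \<forall>t\<ge>0. 0 \<le> v x t) \<and>
     (\<forall>x. \<forall>t\<ge>0. v x t = (\<integral>w. f (w t) \<partial>W x)
        - (\<integral>w. (\<integral>s\<in>{0..t}. \<Psi> (w s) (v (w s) (t - s)) \<partial>lborel) \<partial>W x))"

definition unique_mild_solution ::
  "('a::euclidean_space \<Rightarrow> (real \<Rightarrow> 'a) measure) \<Rightarrow> ('a \<Rightarrow> real \<Rightarrow> real) \<Rightarrow>
   ('a \<Rightarrow> real) \<Rightarrow> ('a \<Rightarrow> real \<Rightarrow> real) \<Rightarrow> bool" where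
  "unique_mild_solution W \<Psi> f v \<longleftrightarrow>
     mild_solution W \<Psi> f v \<and>
     (\<forall>v'. mild_solution W \<Psi> f v' \<longrightarrow> (\<forall>x. \<forall>t\<ge>0. v' x t = v x t))"

text \<open>
  The Markov property at time \<open>s\<close> is
  \<open>\<P>\<^sub>\<mu>[\<theta>\<^sub>s \<in> B | \<F>\<^sub>s] = \<P>\<^bsub>X\<^sub>s\<^esub>(B)\<close>, written out by integrating over the events
  \<open>A\<close> of the natural filtration.
\<close>

definition markov_family ::
  "('a::euclidean_space measure \<Rightarrow> (real \<Rightarrow> 'a measure) measure) \<Rightarrow> bool" where
  "markov_family P \<longleftrightarrow>
     P \<in> finite_measures_borel \<rightarrow>\<^sub>M prob_algebra skorokhod_space \<and>
     (\<forall>\<mu>\<in>finite_measures. AE \<omega> in P \<mu>. \<omega> 0 = \<mu>) \<and>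
     (\<forall>\<mu>\<in>finite_measures. \<forall>s\<ge>0. \<forall>A\<in>sets (past s). \<forall>B\<in>sets skorokhod_space.
        emeasure (P \<mu>) {\<omega>\<in>A. time_shift s \<omega> \<in> B}
          = (\<integral>\<^sup>+\<omega>\<in>A. emeasure (P (\<omega> s)) B \<partial>P \<mu>))"

text \<open>
  \<open>P \<mu>\<close> is the law, on the canonical path space, of the process with \<open>X\<^sub>0 = \<mu>\<close>; the process
  itself is \<open>X\<^sub>t(\<omega>) = \<omega> t\<close>.
\<close>

definition super_brownian_motion ::
  "('a::euclidean_space \<Rightarrow> (real \<Rightarrow> 'a) measure) \<Rightarrow> ('a \<Rightarrow> real \<Rightarrow> real) \<Rightarrow>
   ('a measure \<Rightarrow> (real \<Rightarrow> 'a measure) measure) \<Rightarrow> bool" where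
  "super_brownian_motion W \<Psi> P \<longleftrightarrow>
     markov_family P \<and>
     (\<forall>f\<in>borel_measurable borel. bounded (range f) \<and> (\<forall>x. 0 \<le> f x) \<longrightarrow>
        (\<exists>v. unique_mild_solution W \<Psi> f v \<and>
           (\<forall>\<mu>\<in>finite_measures. \<forall>t\<ge>0.
              (\<integral>\<omega>. exp (- (\<integral>x. f x \<partial>\<omega> t)) \<partial>P \<mu>) = exp (- (\<integral>x. v x t \<partial>\<mu>)))))"

definition finite_time_compact_support_property ::
  "('a::euclidean_space measure \<Rightarrow> (real \<Rightarrow> 'a measure) measure) \<Rightarrow> bool" where
  "finite_time_compact_support_property P \<longleftrightarrow>
     (\<forall>t>0. \<forall>\<mu>\<in>compactly_supported_measures.
        measure (P \<mu>)
          {\<omega> \<in> space (P \<mu>). compact (closure (\<Union>s\<in>{0..t}. measure_support (\<omega> s)))} = 1)"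

end

theory Submission
  imports Defs
begin

text \<open>
  Writing \<open>V\<close> for the log-Laplace semigroup of \<open>X\<close>, a function \<open>w\<close> on space-time with
  \<open>V\<^sub>h w(\<cdot>, r) \<le> w(\<cdot>, r + h)\<close> makes \<open>exp (-\<langle>w(\<cdot>, t - s), X\<^sub>s\<rangle>)\<close> a submartingale. If \<open>w\<close> is infinite
  outside \<open>B(0, R)\<close>, this bounds below the probability that no mass leaves the ball before time \<open>t\<close> by
  \<open>exp (-\<langle>w(\<cdot>, t), \<mu>\<rangle>)\<close>. Take \<open>w = 1 / (A exp (-c t) (1 - |x|\<^sup>2/R\<^sup>2)\<^sub>+\<^sup>n)\<close> with \<open>n\<close> and \<open>ln A\<close> of order \<open>R\<^sup>2\<close>
  (and \<open>\<eta> + \<dots>\<close> in the denominator to keep \<open>w\<close> bounded by \<open>1/\<eta>\<close>). In the outer part of the ball the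
  superlinear reaction \<open>\<beta> \<Phi>\<close> with \<open>\<beta> \<ge> exp (-C R\<^sup>2)\<close> absorbs the Laplacian because \<open>w\<close> is there at least
  \<open>exp (C' R\<^sup>2)\<close>; in the inner part the factor \<open>exp (c t)\<close> does. For a small time \<open>\<tau>\<close> that does not depend on
  \<open>R\<close>, \<open>w(\<cdot>, \<tau>)\<close> tends to \<open>0\<close> on compacts along the radii with \<open>\<beta> \<ge> exp (-C R\<^sup>2)\<close>, which gives
  compact support up to time \<open>\<tau>\<close>; the Markov property then extends this to all times.
\<close>

section \<open>Branching mechanisms\<close>

text \<open>The two regimes meet at u = 1/2, where u = 1 - |x|^2/R^2. With n = 2 m and A = 2^m, the
  quantity A u^n is 2^-m at u = 1/2, so up to \<eta> the barrier is at least 2^m further out; for u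
  near 1 it is exponentially large in m, so the barrier is tiny there. The reaction wins in the
  outer part if 2^(-m q), with q below the index p, beats the factor exp (-C R^2) lost in \<beta>:
  this forces m to be a large multiple of R^2. The Laplacian costs a rate of order n^2/R^2, hence
  R^2, and the time factor must decay at that rate. Over a time of order one it would use up a power
  of 2 comparable with A itself, so a single barrier only serves a short time, and the Markov
  property has to do the rest. The mild equation is compared with the barrier only over steps of
  length e, with an error of order e^(3/2) whose constant depends on \<eta>, A and R but not on the
  starting time. The limits are taken in the order e to 0, \<eta> to 0, dyadic grid to all times, R
  to infinity, so constants that blow up with the later parameters do no harm.\<close>

lemma jump_integrand_nonneg: "0 \<le> exp (- z) - 1 + (z::real)"
  using exp_ge_add_one_self[of "-z"] by simp

lemma jump_integrand_mono:
  fixes y z :: real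
  assumes "0 \<le> y" "y \<le> z"
  shows "exp (- y) - 1 + y \<le> exp (- z) - 1 + z"
proof -
  have "exp (y - z) \<ge> 1 + (y - z)"
    using exp_ge_add_one_self by simp
  have "exp (- y) * (1 - exp (y - z)) \<le> 1 * (z - y)"
  proof (rule mult_mono)
    show "1 - exp (y - z) \<le> z - y"
      using \<open>exp (y - z) \<ge> 1 + (y - z)\<close> by linarith
  qed (use assms in auto)
  then show ?thesis
    by (simp add: algebra_simps exp_add[symmetric])
qed

text \<open>By convexity the increment is at most the slope at the right end,
  \<open>1 - exp (- z)\<close>, times its length; that slope is small for small \<open>z\<close> and
  bounded for large \<open>z\<close>.\<close>

lemma jump_integrand_diff_le:
  fixes y z :: real
  assumes "0 \<le> y" "y \<le> z"
  shows "(exp (- z) - 1 + z) - (exp (- y) - 1 + y) \<le> (z - y) * min 1 z"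
proof -
  have "exp (z - y) \<ge> 1 + (z - y)"
    using exp_ge_add_one_self by simp
  then have "exp (- z) * (1 + (z - y)) \<le> exp (- z) * exp (z - y)"
    by (intro mult_left_mono) auto
  then have "exp (- z) * (1 + (z - y)) \<le> exp (- y)"
    by (simp add: exp_add[symmetric])
  then have "(exp (- z) - 1 + z) - (exp (- y) - 1 + y) \<le> (z - y) * (1 - exp (- z))"
    by (simp add: algebra_simps)
  also have "\<dots> \<le> (z - y) * min 1 z"
    using assms exp_ge_add_one_self[of "-z"] by (intro mult_left_mono) auto
  finally show ?thesis .
qed

text \<open>Only the weight \<open>min l (l\<^sup>2)\<close> is integrable against the jump measure,
  so the dependence on \<open>l\<close> has to be split off in this form. The factor
  \<open>min 1 (l * v)\<close> supplies the second power of \<open>l\<close> for small jumps and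
  leaves the first power for large ones.\<close>

lemma jump_increment_le:
  fixes l u v B :: real
  assumes "0 < l" "0 \<le> u" "u \<le> v" "v \<le> B"
  shows "(exp (- (l * v)) - 1 + l * v) - (exp (- (l * u)) - 1 + l * u)
    \<le> min l (l\<^sup>2) * (max 1 B * (v - u))"
proof -
  have "(exp (- (l * v)) - 1 + l * v) - (exp (- (l * u)) - 1 + l * u)
      \<le> (l * v - l * u) * min 1 (l * v)"
    using assms by (intro jump_integrand_diff_le) (auto intro: mult_left_mono)
  also have "\<dots> = (l * min 1 (l * v)) * (v - u)"
    by (simp add: algebra_simps)
  also have "l * min 1 (l * v) \<le> min l (l\<^sup>2) * max 1 B"
  proof (cases "l \<le> 1")
    case True
    have "l * min 1 (l * v) \<le> l * (l * max 1 B)"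
      using assms by (intro mult_left_mono) (auto intro!: min.coboundedI2 mult_left_mono)
    moreover have "min l (l\<^sup>2) = l\<^sup>2"
      using True assms by (simp add: min_def power2_eq_square)
    ultimately show ?thesis by (simp add: power2_eq_square)
  next
    case False
    have "l * min 1 (l * v) \<le> l * max 1 B"
      using assms by (intro mult_left_mono) auto
    moreover have "min l (l\<^sup>2) = l"
      using False assms by (simp add: min_def power2_eq_square)
    ultimately show ?thesis by simp
  qed
  finally show ?thesis
    using assms by (simp add: mult_right_mono mult.assoc)
qed

section \<open>Integrals against a single jump measure\<close>

context
  fixes m :: "real measure" and C :: real
  assumes sets_m: "sets m = sets (restrict_space borel {0<..})"
    and bound_m: "emeasure (jump_weighted m) {0<..} \<le> ennreal C"
begin

lemma space_jump: "space m = {0<..}"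
  using sets_eq_imp_space_eq[OF sets_m] by (simp add: space_restrict_space)

lemma measurable_jump: "f \<in> borel_measurable borel \<Longrightarrow> f \<in> borel_measurable m"
  using measurable_cong_sets[OF sets_m refl] measurable_restrict_space1 by blast

lemma nn_integral_jump_weight: "(\<integral>\<^sup>+l. ennreal (min l (l\<^sup>2)) \<partial>m) \<le> ennreal C"
proof -
  have "(\<lambda>l. ennreal (min l (l\<^sup>2))) \<in> borel_measurable m"
    by (rule measurable_jump) measurable
  moreover have "{0<..} \<in> sets m"
    using sets.top[of m] by (simp add: space_jump)
  ultimately have "emeasure (jump_weighted m) {0<..} =
      (\<integral>\<^sup>+l. ennreal (min l (l\<^sup>2)) * indicator {0<..} l \<partial>m)"
    unfolding jump_weighted_def by (subst emeasure_density) auto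
  also have "\<dots> = (\<integral>\<^sup>+l. ennreal (min l (l\<^sup>2)) \<partial>m)"
    by (intro nn_integral_cong) (auto simp: indicator_def space_jump)
  finally show ?thesis using bound_m by simp
qed

lemma integrable_jump_weight: "integrable m (\<lambda>l. min l (l\<^sup>2))"
proof (rule integrableI_nonneg)
  show "(\<lambda>l. min l (l\<^sup>2)) \<in> borel_measurable m" by (rule measurable_jump) measurable
  show "(\<integral>\<^sup>+l. ennreal (min l (l\<^sup>2)) \<partial>m) < \<infinity>"
    using nn_integral_jump_weight by (auto simp: order.strict_trans1 ennreal_less_top)
qed (auto intro!: AE_I2 simp: space_jump)

lemma integral_jump_weight: "(\<integral>l. min l (l\<^sup>2) \<partial>m) \<le> max 0 C"
proof -
  have "ennreal (\<integral>l. min l (l\<^sup>2) \<partial>m) = (\<integral>\<^sup>+l. ennreal (min l (l\<^sup>2)) \<partial>m)"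
    by (rule nn_integral_eq_integral[symmetric, OF integrable_jump_weight]) (auto intro!: AE_I2 simp: space_jump)
  also have "\<dots> \<le> ennreal (max 0 C)"
    using nn_integral_jump_weight by (rule order_trans) (simp add: ennreal_leI)
  finally show ?thesis by (subst (asm) ennreal_le_iff) auto
qed

lemma integrable_jump_integrand:
  assumes "0 \<le> u" shows "integrable m (\<lambda>l. exp (- (l * u)) - 1 + l * u)"
proof (rule Bochner_Integration.integrable_bound)
  show "integrable m (\<lambda>l. min l (l\<^sup>2) * (max 1 u * u))"
    using integrable_jump_weight by simp
  show "(\<lambda>l. exp (- (l * u)) - 1 + l * u) \<in> borel_measurable m"
    by (rule measurable_jump) measurable
  show "AE l in m. norm (exp (- (l * u)) - 1 + l * u) \<le> norm (min l (l\<^sup>2) * (max 1 u * u))"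
  proof (rule AE_I2)
    fix l assume "l \<in> space m"
    then have "0 < l" by (simp add: space_jump)
    from jump_increment_le[of l 0 u u, OF this _ assms]
    have "exp (- (l * u)) - 1 + l * u \<le> min l (l\<^sup>2) * (max 1 u * u)" by simp
    then show "norm (exp (- (l * u)) - 1 + l * u) \<le> norm (min l (l\<^sup>2) * (max 1 u * u))"
      using jump_integrand_nonneg[of "l*u"] by simp
  qed
qed

lemma jump_integral_mono:
  assumes "0 \<le> u" "u \<le> v"
  shows "(\<integral>l. (exp (- (l * u)) - 1 + l * u) \<partial>m) \<le> (\<integral>l. (exp (- (l * v)) - 1 + l * v) \<partial>m)"
  using assms
  by (intro integral_mono_AE integrable_jump_integrand AE_I2 jump_integrand_mono) (auto simp: space_jump intro: mult_left_mono)

lemma jump_integral_increment_le: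
  assumes "0 \<le> u" "u \<le> v" "v \<le> B"
  shows "(\<integral>l. (exp (- (l * v)) - 1 + l * v) \<partial>m) - (\<integral>l. (exp (- (l * u)) - 1 + l * u) \<partial>m)
    \<le> max 0 C * max 1 B * (v - u)"
proof -
  have "(\<integral>l. (exp (- (l * v)) - 1 + l * v) \<partial>m) - (\<integral>l. (exp (- (l * u)) - 1 + l * u) \<partial>m)
      = (\<integral>l. (exp (- (l * v)) - 1 + l * v) - (exp (- (l * u)) - 1 + l * u) \<partial>m)"
    using assms by (intro Bochner_Integration.integral_diff[symmetric] integrable_jump_integrand) auto
  also have "\<dots> \<le> (\<integral>l. min l (l\<^sup>2) * (max 1 B * (v - u)) \<partial>m)"
    using assms
    by (intro integral_mono_AE AE_I2 jump_increment_le Bochner_Integration.integrable_diff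
        integrable_jump_integrand integrable_mult_left integrable_jump_weight) (auto simp: space_jump)
  also have "\<dots> = (\<integral>l. min l (l\<^sup>2) \<partial>m) * (max 1 B * (v - u))" by simp
  also have "\<dots> \<le> max 0 C * (max 1 B * (v - u))"
    using assms integral_jump_weight by (intro mult_right_mono) auto
  finally show ?thesis by (simp add: mult.assoc)
qed

lemma branching_function_mono:
  assumes "0 \<le> a" "0 \<le> g" "0 \<le> u" "u \<le> v"
  shows "branching_function a g m u \<le> branching_function a g m v"
  unfolding branching_function_def
  using assms by (intro add_mono jump_integral_mono mult_left_mono power_mono) auto

lemma branching_function_increment_le:
  assumes "0 \<le> a" "0 \<le> g" "0 \<le> u" "u \<le> v" "v \<le> B"
  shows "branching_function a g m v - branching_function a g m u
    \<le> (a + 2 * B * g + max 0 C * max 1 B) * (v - u)"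
proof -
  have "g * v\<^sup>2 - g * u\<^sup>2 = g * (v + u) * (v - u)"
    by (simp add: power2_eq_square algebra_simps)
  also have "\<dots> \<le> g * (2 * B) * (v - u)"
    using assms by (intro mult_right_mono mult_left_mono) auto
  finally show ?thesis
    unfolding branching_function_def
    using jump_integral_increment_le[OF assms(3-5)] by (simp add: algebra_simps)
qed

end

lemma branching_function_0 [simp]: "branching_function a g m 0 = 0"
  by (simp add: branching_function_def)

lemma has_branching_coefficients_cases:
  assumes "has_branching_coefficients \<Psi> \<alpha> \<gamma> \<pi>"
  obtains K C where
    "\<And>x. 0 \<le> \<alpha> x" "\<And>x. \<alpha> x \<le> K" "\<And>x. 0 \<le> \<gamma> x" "\<And>x. \<gamma> x \<le> K"
    "\<And>x. sets (\<pi> x) = sets (restrict_space borel {0<..})"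
    "\<And>x. emeasure (jump_weighted (\<pi> x)) {0<..} \<le> ennreal C" "0 \<le> C" "0 \<le> K"
    "\<And>x u. 0 \<le> u \<Longrightarrow> \<Psi> x u = branching_function (\<alpha> x) (\<gamma> x) (\<pi> x) u"
proof -
  note h = assms[unfolded has_branching_coefficients_def branching_coefficients_def]
  obtain K1 K2 where K: "\<And>x. \<bar>\<alpha> x\<bar> \<le> K1" "\<And>x. \<bar>\<gamma> x\<bar> \<le> K2"
    using h unfolding bounded_iff by (metis rangeI real_norm_def)
  obtain C where C: "\<And>x. emeasure (jump_weighted (\<pi> x)) {0<..} \<le> ennreal C"
    using h by blast
  have a: "0 \<le> \<alpha> x" for x
  proof -
    have "subcritical \<alpha> \<or> critical \<alpha>" using h by blast
    then show ?thesis by (auto simp: subcritical_def critical_def intro: less_imp_le)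
  qed
  have ak: "\<alpha> x \<le> max K1 K2" "\<gamma> x \<le> max K1 K2" for x
    using K(1)[of x] K(2)[of x] by auto
  have K0: "0 \<le> max K1 K2"
    using K(1)[of undefined] by linarith
  show thesis
  proof (rule that[of "max K1 K2" "max 0 C"])
    show "emeasure (jump_weighted (\<pi> x)) {0<..} \<le> ennreal (max 0 C)" for x
      using C[of x] by (rule order_trans) (simp add: ennreal_leI)
    show "\<gamma> x \<ge> 0" for x using h by blast
    show "sets (\<pi> x) = sets (restrict_space borel {0<..})" for x using h by blast
    show "\<Psi> x u = branching_function (\<alpha> x) (\<gamma> x) (\<pi> x) u" if "0 \<le> u" for x u
      using h that by blast
  qed (use a ak K0 in simp_all)
qed

text \<open>Nonnegativity makes the reaction term of the mild equation absorbing; boundedness on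
  bounded ranges of \<open>u\<close> makes its effect over a time t of order t.\<close>

lemma branching_mechanism_bounds:
  assumes "branching_mechanism \<Psi>"
  shows "\<And>x u. 0 \<le> u \<Longrightarrow> 0 \<le> \<Psi> x u"
    and "\<exists>D. \<forall>x u. 0 \<le> u \<and> u \<le> B \<longrightarrow> \<Psi> x u \<le> D"
proof -
  obtain \<alpha> \<gamma> \<pi> where "has_branching_coefficients \<Psi> \<alpha> \<gamma> \<pi>"
    using assms by (auto simp: branching_mechanism_def)
  then obtain K C where h:
    "\<And>x. 0 \<le> \<alpha> x" "\<And>x. \<alpha> x \<le> K" "\<And>x. 0 \<le> \<gamma> x" "\<And>x. \<gamma> x \<le> K"
    "\<And>x. sets (\<pi> x) = sets (restrict_space borel {0<..})"
    "\<And>x. emeasure (jump_weighted (\<pi> x)) {0<..} \<le> ennreal C" "0 \<le> C" "0 \<le> K"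
    "\<And>x u. 0 \<le> u \<Longrightarrow> \<Psi> x u = branching_function (\<alpha> x) (\<gamma> x) (\<pi> x) u"
    by (rule has_branching_coefficients_cases) (rule that; simp)
  show "0 \<le> \<Psi> x u" if "0 \<le> u" for x u
    using branching_function_mono[OF h(5,6,1,3) order.refl that, of x] h(9)[OF that, of x] by simp
  show "\<exists>D. \<forall>x u. 0 \<le> u \<and> u \<le> B \<longrightarrow> \<Psi> x u \<le> D"
  proof (intro exI allI impI)
    fix x u assume u: "0 \<le> u \<and> u \<le> B"
    have "\<Psi> x u \<le> (\<alpha> x + 2 * B * \<gamma> x + max 0 C * max 1 B) * u"
      using branching_function_increment_le[OF h(5)[of x] h(6)[of x] h(1)[of x] h(3)[of x], of 0 u B] u h(9)[of u x] by simp
    also have "\<dots> \<le> (K + 2 * B * K + max 0 C * max 1 B) * B"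
      using u h(1,3,7,8) h(2,4)[of x] by (intro mult_mono add_mono) auto
    finally show "\<Psi> x u \<le> (K + 2 * B * K + max 0 C * max 1 B) * B" .
  qed
qed

text \<open>Monotonicity and the local Lipschitz bound carry a lower bound on a solution over to a
  lower bound on its reaction term.\<close>

lemma spatially_constant_branching_mechanism_mono:
  fixes \<Phi> :: "real \<Rightarrow> real"
  assumes "spatially_constant_branching_mechanism (\<lambda>_::'a::euclidean_space. \<Phi>)"
  shows "\<And>u v. 0 \<le> u \<Longrightarrow> u \<le> v \<Longrightarrow> \<Phi> u \<le> \<Phi> v"
    and "\<And>u. 0 \<le> u \<Longrightarrow> 0 \<le> \<Phi> u"
    and "\<exists>D\<ge>0. \<forall>u v. 0 \<le> u \<longrightarrow> u \<le> v \<longrightarrow> v \<le> B \<longrightarrow> \<Phi> v - \<Phi> u \<le> D * (v - u)"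
proof -
  obtain a g m where "has_branching_coefficients (\<lambda>_::'a. \<Phi>) (\<lambda>_. a) (\<lambda>_. g) (\<lambda>_. m)"
    using assms by (auto simp: spatially_constant_branching_mechanism_def)
  then obtain K C where h:
    "0 \<le> a" "a \<le> K" "0 \<le> g" "g \<le> K" "sets m = sets (restrict_space borel {0<..})"
    "emeasure (jump_weighted m) {0<..} \<le> ennreal C" "0 \<le> C"
    "\<And>u. 0 \<le> u \<Longrightarrow> \<Phi> u = branching_function a g m u"
    by (rule has_branching_coefficients_cases) (rule that; simp)
  show mono: "\<Phi> u \<le> \<Phi> v" if "0 \<le> u" "u \<le> v" for u v
    using branching_function_mono[OF h(5,6,1,3) that] h(8) that by simp
  show "0 \<le> \<Phi> u" if "0 \<le> u" for u
    using mono[OF order.refl that] h(8)[of 0] by simp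
  show "\<exists>D\<ge>0. \<forall>u v. 0 \<le> u \<longrightarrow> u \<le> v \<longrightarrow> v \<le> B \<longrightarrow> \<Phi> v - \<Phi> u \<le> D * (v - u)"
  proof (intro exI[of _ "\<bar>a + 2 * B * g + max 0 C * max 1 B\<bar>"] conjI allI impI)
    fix u v assume uv: "0 \<le> u" "u \<le> v" "v \<le> B"
    have "\<Phi> v - \<Phi> u \<le> (a + 2 * B * g + max 0 C * max 1 B) * (v - u)"
      using branching_function_increment_le[OF h(5,6,1,3) uv] h(8) uv by simp
    also have "\<dots> \<le> \<bar>a + 2 * B * g + max 0 C * max 1 B\<bar> * (v - u)"
      using uv by (intro mult_right_mono) auto
    finally show "\<Phi> v - \<Phi> u \<le> \<bar>a + 2 * B * g + max 0 C * max 1 B\<bar> * (v - u)" .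
  qed simp
qed

text \<open>Required for Fubini in the mild equation. The jump measures may be infinite, so the
  integrand is divided by the weight \<open>min l (l\<^sup>2)\<close> and integrated against the
  weighted measures, which form a finite kernel. The second argument is clipped at 0 because
  \<open>\<Psi>\<close> is arbitrary at negative values.\<close>

lemma measurable_branching_mechanism:
  fixes \<Psi> :: "'a::euclidean_space \<Rightarrow> real \<Rightarrow> real"
  assumes "branching_mechanism \<Psi>"
  shows "(\<lambda>(x, u). \<Psi> x (max 0 u)) \<in> borel_measurable (borel \<Otimes>\<^sub>M borel)"
proof -
  obtain \<alpha> \<gamma> \<pi> where bc: "has_branching_coefficients \<Psi> \<alpha> \<gamma> \<pi>"
    using assms by (auto simp: branching_mechanism_def)
  then obtain K C where h:
    "\<And>x. 0 \<le> \<alpha> x" "\<And>x. \<alpha> x \<le> K" "\<And>x. 0 \<le> \<gamma> x" "\<And>x. \<gamma> x \<le> K"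
    "\<And>x. sets (\<pi> x) = sets (restrict_space borel {0<..})"
    "\<And>x. emeasure (jump_weighted (\<pi> x)) {0<..} \<le> ennreal C" "0 \<le> C" "0 \<le> K"
    "\<And>x u. 0 \<le> u \<Longrightarrow> \<Psi> x u = branching_function (\<alpha> x) (\<gamma> x) (\<pi> x) u"
    by (rule has_branching_coefficients_cases) (rule that; simp)
  have [measurable]: "\<alpha> \<in> borel_measurable borel" "\<gamma> \<in> borel_measurable borel"
    using bc by (auto simp: has_branching_coefficients_def branching_coefficients_def
        intro: borel_measurable_continuous_onI)
  define S where "S = restrict_space (borel :: real measure) {0<..}"
  have space_S: "space S = {0<..}" by (simp add: S_def space_restrict_space)
  have S_meas: "f \<in> borel_measurable S" if "f \<in> borel_measurable borel" for f :: "real \<Rightarrow> ennreal"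
    using that unfolding S_def by (rule measurable_restrict_space1)
  have sets_\<pi>: "sets (\<pi> x) = sets S" for x using h(5) by (simp add: S_def)
  \<comment> \<open>Scales the total mass of the weighted measures, at most \<open>C\<close>, down
    to a sub-probability; the 1 in the denominator covers \<open>C = 0\<close>.\<close>
  define c where "c = 1 / (C + 1)"
  have c: "0 < c" "c * C \<le> 1" using h(7) by (auto simp: c_def field_simps)
  define L where "L x = scale_measure (ennreal c) (jump_weighted (\<pi> x))" for x
  have sets_jw: "sets (jump_weighted (\<pi> x)) = sets S" for x
    by (simp add: jump_weighted_def sets_\<pi>)
  have L: "L \<in> measurable borel (subprob_algebra S)"
  proof (rule measurable_subprob_algebra)
    fix x
    show "sets (L x) = sets S" by (simp add: L_def sets_jw)
    have sp: "space (jump_weighted (\<pi> x)) = {0<..}"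
      using sets_eq_imp_space_eq[OF sets_jw[of x]] space_S by simp
    show "subprob_space (L x)"
    proof
      have "emeasure (L x) (space (L x)) \<le> ennreal c * ennreal C"
        using h(6)[of x] by (simp add: L_def space_scale_measure sp mult_left_mono)
      also have "\<dots> \<le> 1"
        using c h(7) by (simp add: ennreal_mult[symmetric] ennreal_le_1)
      finally show "emeasure (L x) (space (L x)) \<le> 1" .
      show "space (L x) \<noteq> {}" by (simp add: L_def space_scale_measure sp)
    qed
  next
    fix A assume A: "A \<in> sets S"
    have "(\<lambda>x. emeasure (jump_weighted (\<pi> x)) A) \<in> borel_measurable borel"
      using A bc unfolding has_branching_coefficients_def branching_coefficients_def S_def by blast
    then show "(\<lambda>x. emeasure (L x) A) \<in> borel_measurable borel"
      by (simp add: L_def)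
  qed
  define q where "q = (\<lambda>(u::real) (l::real). ennreal ((exp (- (l * max 0 u)) - 1 + l * max 0 u) / min l (l\<^sup>2)))"
  have "(\<lambda>x. \<integral>\<^sup>+l. q (snd x) l \<partial>(L (fst x))) \<in> borel_measurable (borel \<Otimes>\<^sub>M borel)"
  proof (rule nn_integral_measurable_subprob_algebra2[where N = S])
    have "(\<lambda>(x, l). q (snd x) l) \<in> borel_measurable ((borel \<Otimes>\<^sub>M borel) \<Otimes>\<^sub>M (borel :: real measure))"
      unfolding q_def by measurable
    moreover have "(\<lambda>x. x) \<in> (borel \<Otimes>\<^sub>M borel) \<Otimes>\<^sub>M S \<rightarrow>\<^sub>M (borel \<Otimes>\<^sub>M borel) \<Otimes>\<^sub>M (borel :: real measure)"
    proof -
      have "(\<lambda>l. l) \<in> S \<rightarrow>\<^sub>M (borel :: real measure)"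
        unfolding S_def by (rule measurable_restrict_space1) simp
      then have "(\<lambda>x. (fst x, snd x)) \<in> (borel \<Otimes>\<^sub>M borel) \<Otimes>\<^sub>M S \<rightarrow>\<^sub>M (borel \<Otimes>\<^sub>M borel) \<Otimes>\<^sub>M (borel :: real measure)"
        by (intro measurable_Pair measurable_fst measurable_compose[OF measurable_snd])
      then show ?thesis by simp
    qed
    ultimately show "(\<lambda>(x, y). q (snd x) y) \<in> borel_measurable ((borel \<Otimes>\<^sub>M borel) \<Otimes>\<^sub>M S)"
      by (rule measurable_compose[rotated])
    show "(\<lambda>x. L (fst x)) \<in> borel \<Otimes>\<^sub>M borel \<rightarrow>\<^sub>M subprob_algebra S"
      using L by measurable
  qed
  then have meas: "(\<lambda>x. enn2real (\<integral>\<^sup>+l. q (snd x) l \<partial>(L (fst x))) / c) \<in> borel_measurable ((borel::'a measure) \<Otimes>\<^sub>M borel)"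
    by measurable
  have jump: "(\<integral>l. (exp (- (l * max 0 u)) - 1 + l * max 0 u) \<partial>\<pi> x)
      = enn2real (\<integral>\<^sup>+l. q u l \<partial>L x) / c" for x u
  proof -
    have qm: "q u \<in> borel_measurable borel" unfolding q_def by measurable
    have "(\<integral>\<^sup>+l. q u l \<partial>L x) = ennreal c * (\<integral>\<^sup>+l. q u l \<partial>jump_weighted (\<pi> x))"
      unfolding L_def
      by (rule nn_integral_scale_measure) (use S_meas[OF qm] sets_jw in \<open>simp cong: measurable_cong_sets\<close>)
    also have "(\<integral>\<^sup>+l. q u l \<partial>jump_weighted (\<pi> x)) = (\<integral>\<^sup>+l. ennreal (min l (l\<^sup>2)) * q u l \<partial>\<pi> x)"
      unfolding jump_weighted_def
      by (rule nn_integral_density) (auto intro!: measurable_jump[OF h(5,6)] qm)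
    also have "\<dots> = (\<integral>\<^sup>+l. ennreal (exp (- (l * max 0 u)) - 1 + l * max 0 u) \<partial>\<pi> x)"
    proof (rule nn_integral_cong)
      fix l assume "l \<in> space (\<pi> x)"
      then have "0 < l" using space_jump[OF h(5,6)] by simp
      then show "ennreal (min l (l\<^sup>2)) * q u l = ennreal (exp (- (l * max 0 u)) - 1 + l * max 0 u)"
        unfolding q_def using jump_integrand_nonneg[of "l * max 0 u"]
        by (subst ennreal_mult[symmetric]) (auto simp: min_def)
    qed
    also have "\<dots> = ennreal (\<integral>l. (exp (- (l * max 0 u)) - 1 + l * max 0 u) \<partial>\<pi> x)"
      by (intro nn_integral_eq_integral integrable_jump_integrand[OF h(5,6)] AE_I2 jump_integrand_nonneg) auto
    finally have "(\<integral>\<^sup>+l. q u l \<partial>L x) = ennreal (c * (\<integral>l. (exp (- (l * max 0 u)) - 1 + l * max 0 u) \<partial>\<pi> x))"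
      using c by (simp add: ennreal_mult')
    moreover have "0 \<le> (\<integral>l. (exp (- (l * max 0 u)) - 1 + l * max 0 u) \<partial>\<pi> x)"
      by (intro Bochner_Integration.integral_nonneg_AE AE_I2 jump_integrand_nonneg)
    ultimately show ?thesis using c by simp
  qed
  have "(\<lambda>(x, u). \<Psi> x (max 0 u)) = (\<lambda>z. \<alpha> (fst z) * max 0 (snd z) + \<gamma> (fst z) * (max 0 (snd z))\<^sup>2
      + enn2real (\<integral>\<^sup>+l. q (snd z) l \<partial>(L (fst z))) / c)"
    by (auto simp: fun_eq_iff h(9) branching_function_def jump)
  then show ?thesis
    using meas by simp
qed

text \<open>A doubling argument in place of Potter's bounds: \<open>L (2 * u) / L u\<close> is
  eventually above \<open>2 powr (- (p / 2))\<close>, so each doubling of \<open>u\<close>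
  multiplies \<open>\<Phi>\<close> by at least \<open>2 powr (1 + p / 2)\<close>, and monotonicity
  fills the gaps between the points \<open>2 ^ j * u1\<close>. Half of \<open>p\<close> is given up
  to absorb the slowly varying factor.\<close>

lemma regularly_varying_lower_bound:
  fixes \<Phi> :: "real \<Rightarrow> real"
  assumes rv: "regularly_varying (1 + p) \<Phi>" and p: "0 < p"
    and mono: "\<And>u v. 0 \<le> u \<Longrightarrow> u \<le> v \<Longrightarrow> \<Phi> u \<le> \<Phi> v"
  obtains c u1 where "0 < c" "1 \<le> u1" "\<And>u. u1 \<le> u \<Longrightarrow> c * u powr (1 + p / 2) \<le> \<Phi> u"
proof -
  obtain L where L: "slowly_varying L" "\<forall>\<^sub>F u in at_top. \<Phi> u = u powr (1 + p) * L u"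
    using rv by (auto simp: regularly_varying_def)
  have pos: "\<forall>\<^sub>F u in at_top. 0 < L u"
    using L(1) by (auto simp: slowly_varying_def eventually_at_top_linorder)
  have "((\<lambda>u. L (2 * u) / L u) \<longlongrightarrow> 1) at_top"
    using L(1) by (auto simp: slowly_varying_def)
  moreover have "2 powr (- (p / 2)) < (1::real)"
    using p by (simp add: powr_less_one)
  ultimately have "\<forall>\<^sub>F u in at_top. 2 powr (- (p / 2)) < L (2 * u) / L u"
    by (rule order_tendstoD)
  with pos L(2) have "\<forall>\<^sub>F u in at_top.
      0 < L u \<and> \<Phi> u = u powr (1 + p) * L u \<and> 2 powr (- (p / 2)) < L (2 * u) / L u"
    by (auto intro: eventually_conj)
  then obtain N where N: "\<And>u. N \<le> u \<Longrightarrow>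
      0 < L u \<and> \<Phi> u = u powr (1 + p) * L u \<and> 2 powr (- (p / 2)) < L (2 * u) / L u"
    unfolding eventually_at_top_linorder by blast
  define u1 where "u1 = max 1 N"
  have u1: "1 \<le> u1" "N \<le> u1" by (auto simp: u1_def)
  have pos1: "0 < \<Phi> u1" using N[OF u1(2)] u1 by simp
  have step: "2 powr (1 + p / 2) * \<Phi> u \<le> \<Phi> (2 * u)" if "u1 \<le> u" for u
  proof -
    have n: "0 < L u" "\<Phi> u = u powr (1 + p) * L u" "2 powr (- (p / 2)) < L (2 * u) / L u"
      "\<Phi> (2 * u) = (2 * u) powr (1 + p) * L (2 * u)"
      using N[of u] N[of "2*u"] that u1 by auto
    have "2 powr (1 + p / 2) * \<Phi> u = 2 powr (1 + p) * u powr (1 + p) * (2 powr (- (p / 2)) * L u)"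
    proof -
      have "2 powr (1 + p / 2) = 2 powr (1 + p) * (2 powr (- (p / 2)) :: real)"
        by (subst powr_add[symmetric]) (simp add: add.commute)
      then show ?thesis by (simp add: n(2))
    qed
    also have "\<dots> \<le> 2 powr (1 + p) * u powr (1 + p) * L (2 * u)"
      using n by (intro mult_left_mono) (auto simp: field_simps)
    also have "\<dots> = \<Phi> (2 * u)"
      using that u1 by (simp add: n(4) powr_mult)
    finally show ?thesis .
  qed
  have iter: "(2 powr (1 + p / 2)) ^ j * \<Phi> u1 \<le> \<Phi> (2 ^ j * u1)" for j
  proof (induction j)
    case (Suc j)
    have "u1 \<le> 2 ^ j * u1" using u1 by simp
    from step[OF this] have "2 powr (1 + p / 2) * \<Phi> (2 ^ j * u1) \<le> \<Phi> (2 ^ Suc j * u1)"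
      by (simp add: mult.assoc)
    moreover have "2 powr (1 + p / 2) * ((2 powr (1 + p / 2)) ^ j * \<Phi> u1) \<le> 2 powr (1 + p / 2) * \<Phi> (2 ^ j * u1)"
      using Suc by (intro mult_left_mono) auto
    ultimately show ?case by (simp only: power_Suc mult.assoc)
  qed simp
  \<comment> \<open>The 2 in the denominator pays for rounding \<open>u / u1\<close> down to a power
    of 2.\<close>
  define c where "c = \<Phi> u1 / (2 * u1) powr (1 + p / 2)"
  show thesis
  proof (rule that[of c u1])
    show "0 < c" using pos1 u1 by (simp add: c_def)
    show "1 \<le> u1" by (fact u1)
    fix u assume u: "u1 \<le> u"
    define j where "j = nat \<lfloor>log 2 (u / u1)\<rfloor>"
    have l0: "0 \<le> log 2 (u / u1)" using u u1 by simp
    have j: "real j \<le> log 2 (u / u1)" "log 2 (u / u1) < real j + 1"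
      using l0 by (auto simp: j_def)
    have "2 powr real j \<le> u / u1"
      using j(1) u u1 by (subst le_log_iff[symmetric]) auto
    then have a: "2 ^ j * u1 \<le> u" using u1 by (simp add: powr_realpow field_simps)
    have "u / u1 < 2 powr (real j + 1)"
      using j(2) u u1 by (subst log_less_iff[symmetric]) auto
    then have b: "u / (2 * u1) \<le> 2 ^ j" using u1 by (simp add: powr_add powr_realpow field_simps)
    have "c * u powr (1 + p / 2) = \<Phi> u1 * (u / (2 * u1)) powr (1 + p / 2)"
      using u u1 by (simp add: c_def powr_divide)
    also have "\<dots> \<le> \<Phi> u1 * (2 ^ j) powr (1 + p / 2)"
      using b u u1 p pos1 by (intro mult_left_mono powr_mono2) auto
    also have "\<dots> = (2 powr (1 + p / 2)) ^ j * \<Phi> u1"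
      by (simp add: powr_realpow[symmetric] powr_powr mult.commute)
    also have "\<dots> \<le> \<Phi> u"
      using iter[of j] mono[OF _ a] u1 by (intro order_trans[OF iter[of j]]) auto
    finally show "c * u powr (1 + p / 2) \<le> \<Phi> u" .
  qed
qed

section \<open>Moments of Brownian increments\<close>

lemma space_wiener: "space wiener_space = {w \<in> space (PiM {0..} (\<lambda>_. borel)). continuous_on {0..} w}"
  by (auto simp: wiener_space_def space_restrict_space)

lemma measurable_wiener_coordinate:
  assumes "0 \<le> s"
  shows "(\<lambda>w. w s) \<in> wiener_space \<rightarrow>\<^sub>M (borel :: 'a::euclidean_space measure)"
  unfolding wiener_space_def
  by (rule measurable_restrict_space1, rule measurable_component_singleton) (use assms in simp)

text \<open>Joint measurability comes from path continuity: the value at a time is the limit of the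
  values at the last preceding points of the grids of mesh \<open>1 / Suc n\<close>, and each such
  approximation takes countably many coordinates. Times are clipped at 0 because paths are
  \<open>undefined\<close> before 0.\<close>

lemma measurable_wiener_process:
  "(\<lambda>z. fst z (max 0 (snd z))) \<in> wiener_space \<Otimes>\<^sub>M (borel :: real measure) \<rightarrow>\<^sub>M (borel :: 'a::euclidean_space measure)"
proof (rule borel_measurable_LIMSEQ_metric)
  fix n :: nat
  define g where "g z = nat \<lfloor>real (Suc n) * max 0 (snd z)\<rfloor>" for z :: "(real \<Rightarrow> 'a) \<times> real"
  have g: "g \<in> wiener_space \<Otimes>\<^sub>M borel \<rightarrow>\<^sub>M count_space UNIV"
    unfolding g_def by measurable
  have "(\<lambda>z. fst z (real i / real (Suc n))) \<in> wiener_space \<Otimes>\<^sub>M (borel :: real measure) \<rightarrow>\<^sub>M (borel :: 'a measure)" for i :: nat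
    by (rule measurable_compose[OF measurable_fst measurable_wiener_coordinate]) simp
  from measurable_compose_countable[OF this g]
  show "(\<lambda>z. fst z (real (g z) / real (Suc n))) \<in> wiener_space \<Otimes>\<^sub>M (borel :: real measure) \<rightarrow>\<^sub>M (borel :: 'a measure)" .
next
  fix z :: "(real \<Rightarrow> 'a) \<times> real"
  assume "z \<in> space (wiener_space \<Otimes>\<^sub>M borel)"
  then have c: "continuous_on {0..} (fst z)"
    by (auto simp: space_pair_measure space_wiener)
  define s where "s = max 0 (snd z)"
  have s: "0 \<le> s" by (simp add: s_def)
  have lim: "(\<lambda>n. real (nat \<lfloor>real (Suc n) * s\<rfloor>) / real (Suc n)) \<longlonglongrightarrow> s"
  proof (rule tendsto_sandwich)
    show "\<forall>\<^sub>F n in sequentially. s - 1 / real (Suc n) \<le> real (nat \<lfloor>real (Suc n) * s\<rfloor>) / real (Suc n)"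
    proof (rule always_eventually, rule allI)
      fix n
      have "real (Suc n) * s - 1 \<le> real (nat \<lfloor>real (Suc n) * s\<rfloor>)" using s by linarith
      then have "(real (Suc n) * s - 1) / real (Suc n) \<le> real (nat \<lfloor>real (Suc n) * s\<rfloor>) / real (Suc n)"
        by (rule divide_right_mono) simp
      then show "s - 1 / real (Suc n) \<le> real (nat \<lfloor>real (Suc n) * s\<rfloor>) / real (Suc n)"
        by (simp only: diff_divide_distrib) simp
    qed
    show "\<forall>\<^sub>F n in sequentially. real (nat \<lfloor>real (Suc n) * s\<rfloor>) / real (Suc n) \<le> s"
    proof (rule always_eventually, rule allI)
      fix n
      have "0 \<le> real (Suc n) * s" using s by simp
      then have "real (nat \<lfloor>real (Suc n) * s\<rfloor>) \<le> real (Suc n) * s" by linarith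
      then show "real (nat \<lfloor>real (Suc n) * s\<rfloor>) / real (Suc n) \<le> s"
        by (subst pos_divide_le_eq) (auto simp: mult.commute)
    qed
    show "(\<lambda>n. s - 1 / real (Suc n)) \<longlonglongrightarrow> s"
      using tendsto_diff[OF tendsto_const LIMSEQ_inverse_real_of_nat, of s] by (simp add: inverse_eq_divide)
  qed simp
  have "(\<lambda>n. fst z (real (nat \<lfloor>real (Suc n) * s\<rfloor>) / real (Suc n))) \<longlonglongrightarrow> fst z s"
    by (rule continuous_on_tendsto_compose[OF c lim]) (use s in \<open>auto intro!: always_eventually\<close>)
  then show "(\<lambda>n. fst z (real (nat \<lfloor>real (Suc n) * max 0 (snd z)\<rfloor>) / real (Suc n))) \<longlonglongrightarrow> fst z (max 0 (snd z))"
    by (simp add: s_def)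
qed

text \<open>Lebesgue measure is the image of a product of one-dimensional Lebesgue measures under
  the coordinate expansion, so Fubini for products transfers. It is applied to the Gaussian density,
  which factorizes over the basis.\<close>

lemma lborel_integral_prod_Basis:
  fixes g :: "'a::euclidean_space \<Rightarrow> real \<Rightarrow> real"
  assumes "\<And>b. b \<in> Basis \<Longrightarrow> integrable lborel (g b)"
  shows "integrable lborel (\<lambda>y::'a. \<Prod>b\<in>Basis. g b (y \<bullet> b))"
    and "(\<integral>y. (\<Prod>b\<in>Basis. g b (y \<bullet> b)) \<partial>(lborel :: 'a measure)) = (\<Prod>b\<in>Basis. (\<integral>z. g b z \<partial>lborel))"
proof -
  interpret product_sigma_finite "\<lambda>_::'a. lborel :: real measure" ..
  have m: "(\<lambda>f. \<Sum>b\<in>Basis. f b *\<^sub>R b) \<in> (\<Pi>\<^sub>M b\<in>Basis. lborel) \<rightarrow>\<^sub>M (borel :: 'a measure)"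
    by measurable
  have gm: "g b \<in> borel_measurable borel" if "b \<in> Basis" for b
    using borel_measurable_integrable[OF assms[OF that]] by simp
  have h: "(\<lambda>y::'a. \<Prod>b\<in>Basis. g b (y \<bullet> b)) \<in> borel_measurable borel"
    using gm by (intro borel_measurable_prod measurable_compose[OF _ gm]) auto
  have eq: "(\<Prod>b\<in>Basis. g b ((\<Sum>b\<in>Basis. f b *\<^sub>R b) \<bullet> b)) = (\<Prod>b\<in>Basis. g b (f b))" for f :: "'a \<Rightarrow> real"
    by (intro prod.cong) auto
  have "integrable (distr (\<Pi>\<^sub>M b\<in>Basis. lborel) borel (\<lambda>f. \<Sum>b\<in>Basis. f b *\<^sub>R b)) (\<lambda>y::'a. \<Prod>b\<in>Basis. g b (y \<bullet> b))"
    by (subst integrable_distr_eq[OF m h], subst eq) (auto intro!: product_integrable_prod assms)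
  then show "integrable lborel (\<lambda>y::'a. \<Prod>b\<in>Basis. g b (y \<bullet> b))"
    by (simp only: lborel_eq[symmetric])
  have "(\<integral>y. (\<Prod>b\<in>Basis. g b (y \<bullet> b)) \<partial>(distr (\<Pi>\<^sub>M b\<in>Basis. lborel) borel (\<lambda>f. \<Sum>b\<in>Basis. f b *\<^sub>R b))) = (\<Prod>b\<in>Basis. (\<integral>z. g b z \<partial>lborel))"
    by (subst integral_distr[OF m h], subst eq) (auto intro!: product_integral_prod assms)
  then show "(\<integral>y. (\<Prod>b\<in>Basis. g b (y \<bullet> b)) \<partial>(lborel :: 'a measure)) = (\<Prod>b\<in>Basis. (\<integral>z. g b z \<partial>lborel))"
    by (simp only: lborel_eq[symmetric])
qed

text \<open>The norm is at most the dimension times the largest coordinate. This is crude, but only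
  the order in time of the moments matters later.\<close>

lemma norm_power_le_sum_coordinates:
  "norm (y::'a::euclidean_space) ^ k \<le> real DIM('a) ^ k * (\<Sum>b\<in>Basis. \<bar>y \<bullet> b\<bar> ^ k)"
proof -
  obtain c where c: "c \<in> Basis" "\<And>b. b \<in> Basis \<Longrightarrow> \<bar>y \<bullet> b\<bar> \<le> \<bar>y \<bullet> c\<bar>"
  proof -
    define A where "A = (\<lambda>b. \<bar>y \<bullet> b\<bar>) ` Basis"
    have A: "finite A" "A \<noteq> {}" by (simp_all add: A_def)
    obtain c where "c \<in> Basis" "Max A = \<bar>y \<bullet> c\<bar>"
      using Max_in[OF A] by (metis A_def imageE)
    moreover have "\<bar>y \<bullet> b\<bar> \<le> Max A" if "b \<in> Basis" for b
      using that by (intro Max_ge A) (simp add: A_def)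
    ultimately show ?thesis using that by auto
  qed
  have "norm y \<le> (\<Sum>b\<in>Basis. \<bar>y \<bullet> b\<bar>)" by (rule norm_le_l1)
  also have "\<dots> \<le> real DIM('a) * \<bar>y \<bullet> c\<bar>"
    using sum_bounded_above[of Basis "\<lambda>b. \<bar>y \<bullet> b\<bar>" "\<bar>y \<bullet> c\<bar>"] c by simp
  finally have "norm y ^ k \<le> (real DIM('a) * \<bar>y \<bullet> c\<bar>) ^ k"
    by (rule power_mono) simp
  also have "\<dots> = real DIM('a) ^ k * \<bar>y \<bullet> c\<bar> ^ k" by (simp add: power_mult_distrib)
  also have "\<bar>y \<bullet> c\<bar> ^ k \<le> (\<Sum>b\<in>Basis. \<bar>y \<bullet> b\<bar> ^ k)"
    by (rule member_le_sum[where f = "\<lambda>b. \<bar>y \<bullet> b\<bar> ^ k"]) (use c in auto)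
  finally show ?thesis by (simp add: mult_left_mono)
qed

context
  fixes x :: "'a::euclidean_space" and M :: "(real \<Rightarrow> 'a) measure"
  assumes bm: "brownian_law x M"
begin

lemma brownian_prob_space: "prob_space M"
  and brownian_sets: "sets M = sets wiener_space"
  and brownian_start: "AE w in M. w 0 = x"
  using bm by (auto simp: brownian_law_def)

lemma measurable_brownian_coordinate: "0 \<le> s \<Longrightarrow> (\<lambda>w. w s) \<in> M \<rightarrow>\<^sub>M borel"
  using measurable_wiener_coordinate measurable_cong_sets[OF brownian_sets refl] by blast

lemma measurable_brownian:
  "0 \<le> s \<Longrightarrow> h \<in> borel \<rightarrow>\<^sub>M N \<Longrightarrow> (\<lambda>w. h (w s)) \<in> M \<rightarrow>\<^sub>M N"
  by (rule measurable_compose[OF measurable_brownian_coordinate])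

text \<open>The source of all moments below. The law gives the density of \<open>w s - w 0\<close>;
  as \<open>w 0 = x\<close> holds only almost surely, the exchange of the two is made under the
  almost-everywhere quantifier.\<close>

lemma brownian_increment_prod:
  fixes g :: "'a \<Rightarrow> real \<Rightarrow> real"
  assumes s: "0 < s" and gm: "\<And>b. b \<in> Basis \<Longrightarrow> g b \<in> borel_measurable borel"
    and g: "\<And>b. b \<in> Basis \<Longrightarrow> integrable lborel (\<lambda>z. normal_density 0 (sqrt s) z * g b z)"
  shows "has_bochner_integral M (\<lambda>w. \<Prod>b\<in>Basis. g b ((w s - x) \<bullet> b))
      (\<Prod>b\<in>Basis. (\<integral>z. normal_density 0 (sqrt s) z * g b z \<partial>lborel))"
proof -
  interpret prob_space M by (rule brownian_prob_space)
  have D: "distributed M lborel (\<lambda>w. w s - w 0)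
      (\<lambda>y. ennreal (\<Prod>b\<in>Basis. normal_density 0 (sqrt s) (y \<bullet> b)))"
  proof -
    have "\<forall>s' t. 0 \<le> s' \<and> s' < t \<longrightarrow>
        distributed M lborel (\<lambda>w. w t - w s')
          (\<lambda>y. ennreal (\<Prod>b\<in>Basis. normal_density 0 (sqrt (t - s')) (y \<bullet> b)))"
      using bm unfolding brownian_law_def by blast
    from this[rule_format, of 0 s] s show ?thesis by simp
  qed
  have m: "(\<lambda>y::'a. \<Prod>b\<in>Basis. g b (y \<bullet> b)) \<in> borel_measurable lborel"
    unfolding measurable_lborel2 using gm by (intro borel_measurable_prod measurable_compose[OF _ gm]) auto
  have nn: "0 \<le> (\<Prod>b\<in>Basis. normal_density 0 (sqrt s) (y \<bullet> b))" for y :: 'a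
    by (intro prod_nonneg) simp
  have eq: "(\<Prod>b\<in>Basis. normal_density 0 (sqrt s) (y \<bullet> b)) * (\<Prod>b\<in>Basis. g b (y \<bullet> b))
      = (\<Prod>b\<in>Basis. normal_density 0 (sqrt s) (y \<bullet> b) * g b (y \<bullet> b))" for y :: 'a
    by (simp add: prod.distrib)
  note L = lborel_integral_prod_Basis[of "\<lambda>b z. normal_density 0 (sqrt s) z * g b z", OF g]
  have i: "integrable M (\<lambda>w. \<Prod>b\<in>Basis. g b ((w s - w 0) \<bullet> b))"
    by (rule distributed_integrable[OF D m nn, THEN iffD1]) (simp add: eq L)
  have v: "(\<integral>w. (\<Prod>b\<in>Basis. g b ((w s - w 0) \<bullet> b)) \<partial>M)
     = (\<Prod>b\<in>Basis. (\<integral>z. normal_density 0 (sqrt s) z * g b z \<partial>lborel))"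
    by (subst distributed_integral[OF D m nn, symmetric]) (simp_all add: eq L)
  have "AE w in M. (\<Prod>b\<in>Basis. g b ((w s - w 0) \<bullet> b)) = (\<Prod>b\<in>Basis. g b ((w s - x) \<bullet> b))"
    using brownian_start by eventually_elim simp
  moreover have ms: "(\<lambda>w. w s - x) \<in> M \<rightarrow>\<^sub>M borel"
    using s by (intro measurable_brownian[of s "\<lambda>y. y - x"]) auto
  have "(\<lambda>w. \<Prod>b\<in>Basis. g b ((w s - x) \<bullet> b)) \<in> borel_measurable M"
    using measurable_compose[OF ms m[unfolded measurable_lborel2]] .
  ultimately show ?thesis
    using has_bochner_integral_integrable[OF i, unfolded v]
    by (subst (asm) has_bochner_integral_cong_AE[OF borel_measurable_integrable[OF i]]) auto
qed

lemma brownian_coordinate_moment: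
  assumes s: "0 < s" and b: "b \<in> Basis"
  shows "has_bochner_integral M (\<lambda>w. ((w s - x) \<bullet> b) ^ k)
      (\<integral>z. normal_density 0 (sqrt s) z * z ^ k \<partial>lborel)"
proof -
  have "has_bochner_integral M (\<lambda>w. \<Prod>c\<in>Basis. (if c = b then (\<lambda>z. z ^ k) else (\<lambda>_. 1)) ((w s - x) \<bullet> c))
      (\<Prod>c\<in>Basis. (\<integral>z. normal_density 0 (sqrt s) z * (if c = b then (\<lambda>z. z ^ k) else (\<lambda>_. 1)) z \<partial>lborel))"
    using s integrable_normal_moment[of "sqrt s" 0 k]
    by (intro brownian_increment_prod) auto
  moreover have "(\<Prod>c\<in>Basis. (if c = b then (\<lambda>z. z ^ k) else (\<lambda>_. 1)) ((w s - x) \<bullet> c)) = ((w s - x) \<bullet> b) ^ k" for w :: "real \<Rightarrow> 'a"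
    using b by (simp add: if_distrib[of "\<lambda>f. f _"] prod.If_cases cong: if_cong)
  moreover have "(\<Prod>c\<in>Basis. (\<integral>z. normal_density 0 (sqrt s) z * (if c = b then (\<lambda>z. z ^ k) else (\<lambda>_. 1)) z \<partial>lborel))
     = (\<Prod>c\<in>Basis. if c = b then (\<integral>z. normal_density 0 (sqrt s) z * z ^ k \<partial>lborel) else 1)"
    using s by (intro prod.cong) (auto simp: integral_normal_density)
  ultimately show ?thesis using b by simp
qed

lemma brownian_coordinate_cross_moment:
  assumes s: "0 < s" and b: "b \<in> Basis" "c \<in> Basis" "b \<noteq> c"
  shows "has_bochner_integral M (\<lambda>w. ((w s - x) \<bullet> b) * ((w s - x) \<bullet> c)) 0"
proof -
  define g where "g e = (if e \<in> {b, c} then (\<lambda>z::real. z) else (\<lambda>_. 1))" for e :: 'a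
  have n1: "integrable lborel (\<lambda>z. normal_density 0 (sqrt s) z * z)"
    "(\<integral>z. normal_density 0 (sqrt s) z * z \<partial>lborel) = 0"
    using s integrable_normal_moment_nz_1[of "sqrt s" 0] integral_normal_moment_nz_1[of "sqrt s" 0] by auto
  have "has_bochner_integral M (\<lambda>w. \<Prod>e\<in>Basis. g e ((w s - x) \<bullet> e))
      (\<Prod>e\<in>Basis. (\<integral>z. normal_density 0 (sqrt s) z * g e z \<partial>lborel))"
    using s n1 by (intro brownian_increment_prod) (auto simp: g_def)
  moreover have "(\<Prod>e\<in>Basis. g e ((w s - x) \<bullet> e)) = ((w s - x) \<bullet> b) * ((w s - x) \<bullet> c)" for w :: "real \<Rightarrow> 'a"
  proof -
    have "(\<Prod>e\<in>Basis. g e ((w s - x) \<bullet> e)) = (\<Prod>e\<in>{b, c}. g e ((w s - x) \<bullet> e))"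
      using b by (intro prod.mono_neutral_right) (auto simp: g_def)
    then show ?thesis using b by (simp add: g_def)
  qed
  moreover have "(\<Prod>e\<in>Basis. (\<integral>z. normal_density 0 (sqrt s) z * g e z \<partial>lborel)) = 0"
    using b n1 by (intro prod_zero) (auto intro!: bexI[of _ b] simp: g_def)
  ultimately show ?thesis by simp
qed

lemma brownian_linear_moment:
  assumes s: "0 < s"
  shows "has_bochner_integral M (\<lambda>w. (w s - x) \<bullet> z) 0"
proof -
  have "has_bochner_integral M (\<lambda>w. \<Sum>b\<in>Basis. ((w s - x) \<bullet> b) ^ 1 * (z \<bullet> b)) (\<Sum>b\<in>Basis. 0 * (z \<bullet> b))"
    using brownian_coordinate_moment[OF s, where k=1] integral_normal_moment_nz_1[of "sqrt s" 0] s
    by (intro has_bochner_integral_sum has_bochner_integral_mult_left) auto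
  then show ?thesis by (subst euclidean_inner) simp
qed

lemma brownian_quadratic_moment:
  assumes s: "0 < s"
  shows "has_bochner_integral M (\<lambda>w. ((w s - x) \<bullet> z)\<^sup>2) (s * (norm z)\<^sup>2)"
proof -
  have c: "has_bochner_integral M (\<lambda>w. ((w s - x) \<bullet> b) * ((w s - x) \<bullet> c)) (if b = c then s else 0)"
    if "b \<in> Basis" "c \<in> Basis" for b c
  proof (cases "b = c")
    case True
    have "(\<integral>z. normal_density 0 (sqrt s) z * z ^ 2 \<partial>lborel) = s"
      using integral_normal_moment_even[of "sqrt s" 0 1] s by (simp add: fact_numeral)
    then show ?thesis
      using True brownian_coordinate_moment[OF s that(1), of 2] by (simp add: power2_eq_square)
  next
    case False
    then show ?thesis using brownian_coordinate_cross_moment[OF s that] by simp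
  qed
  have "has_bochner_integral M
      (\<lambda>w. \<Sum>b\<in>Basis. \<Sum>c\<in>Basis. (((w s - x) \<bullet> b) * ((w s - x) \<bullet> c)) * ((z \<bullet> b) * (z \<bullet> c)))
      (\<Sum>b\<in>Basis. \<Sum>c\<in>Basis. (if b = c then s else 0) * ((z \<bullet> b) * (z \<bullet> c)))"
    by (intro has_bochner_integral_sum has_bochner_integral_mult_left c)
  moreover have "(\<Sum>b\<in>Basis. \<Sum>c\<in>Basis. (((w s - x) \<bullet> b) * ((w s - x) \<bullet> c)) * ((z \<bullet> b) * (z \<bullet> c)))
     = ((w s - x) \<bullet> z)\<^sup>2" for w :: "real \<Rightarrow> 'a"
    by (subst (3) euclidean_inner) (simp add: power2_eq_square sum_product mult_ac)
  moreover have "(\<Sum>b\<in>Basis. \<Sum>c\<in>Basis. (if b = c then s else 0) * ((z \<bullet> b) * (z \<bullet> c))) = s * (norm z)\<^sup>2"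
    by (simp add: if_distrib[of "\<lambda>t. t * _"] sum.delta cong: if_cong)
      (simp add: power2_norm_eq_inner euclidean_inner[of z z] sum_distrib_left)
  ultimately show ?thesis by simp
qed

text \<open>Only even powers are treated, so that the coordinate moments involve no absolute values;
  what is used later is the order \<open>s ^ k\<close>.\<close>

lemma brownian_norm_moment:
  assumes s: "0 < s"
  shows "integrable M (\<lambda>w. norm (w s - x) ^ (2 * k))"
    and "(\<integral>w. norm (w s - x) ^ (2 * k) \<partial>M)
      \<le> real DIM('a) ^ (2 * k + 1) * (fact (2 * k) / (2 ^ k * fact k)) * s ^ k"
proof -
  define r where "r = (fact (2 * k) / (2 ^ k * fact k)) * s ^ k"
  have "(\<integral>z. normal_density 0 (sqrt s) z * z ^ (2 * k) \<partial>lborel) = r"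
    using integral_normal_moment_even[of "sqrt s" 0 k] s by (simp add: r_def power_divide)
  then have "has_bochner_integral M (\<lambda>w. real DIM('a) ^ (2 * k) * (\<Sum>b\<in>Basis. ((w s - x) \<bullet> b) ^ (2 * k)))
      (real DIM('a) ^ (2 * k) * (\<Sum>b::'a\<in>Basis. r))"
    using brownian_coordinate_moment[OF s, where k="2*k"]
    by (intro has_bochner_integral_mult_right has_bochner_integral_sum) auto
  then have i: "integrable M (\<lambda>w. real DIM('a) ^ (2 * k) * (\<Sum>b\<in>Basis. ((w s - x) \<bullet> b) ^ (2 * k)))"
    and v: "(\<integral>w. real DIM('a) ^ (2 * k) * (\<Sum>b\<in>Basis. ((w s - x) \<bullet> b) ^ (2 * k)) \<partial>M)
      = real DIM('a) ^ (2 * k + 1) * r"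
    by (auto simp: has_bochner_integral_iff)
  have le: "norm (w s - x) ^ (2 * k) \<le> real DIM('a) ^ (2 * k) * (\<Sum>b\<in>Basis. ((w s - x) \<bullet> b) ^ (2 * k))" for w :: "real \<Rightarrow> 'a"
    using norm_power_le_sum_coordinates[of "w s - x" "2 * k"] by (simp add: power_even_abs)
  have "(\<lambda>w. norm (w s - x) ^ (2 * k)) \<in> borel_measurable M"
    using s by (intro measurable_brownian[of s "\<lambda>y. norm (y - x) ^ (2 * k)"]) auto
  then show int: "integrable M (\<lambda>w. norm (w s - x) ^ (2 * k))"
    by (rule Bochner_Integration.integrable_bound[OF i]) (auto intro!: AE_I2 order_trans[OF le])
  show "(\<integral>w. norm (w s - x) ^ (2 * k) \<partial>M)
      \<le> real DIM('a) ^ (2 * k + 1) * (fact (2 * k) / (2 ^ k * fact k)) * s ^ k"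
    using integral_mono[OF int i] le v by (simp add: r_def mult.assoc)
qed

lemma brownian_norm_square_moment:
  assumes s: "0 < s"
  shows "has_bochner_integral M (\<lambda>w. (norm (w s - x))\<^sup>2) (real DIM('a) * s)"
proof -
  have "(\<integral>z. normal_density 0 (sqrt s) z * z ^ 2 \<partial>lborel) = s"
    using integral_normal_moment_even[of "sqrt s" 0 1] s by (simp add: fact_numeral)
  then have "has_bochner_integral M (\<lambda>w. \<Sum>b\<in>Basis. ((w s - x) \<bullet> b) ^ 2) (\<Sum>b::'a\<in>Basis. s)"
    using brownian_coordinate_moment[OF s, where k=2] by (intro has_bochner_integral_sum) auto
  moreover have "(norm (w s - x))\<^sup>2 = (\<Sum>b\<in>Basis. ((w s - x) \<bullet> b) ^ 2)" for w :: "real \<Rightarrow> 'a"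
    by (subst power2_norm_eq_inner, subst euclidean_inner) (simp add: power2_eq_square)
  ultimately show ?thesis by simp
qed

lemma integrable_brownian_norm:
  assumes "0 \<le> s" shows "integrable M (\<lambda>w. norm (w s - x))"
    and "(\<integral>w. norm (w s - x) \<partial>M) \<le> (1 + real DIM('a)) * sqrt s"
proof -
  interpret prob_space M by (rule brownian_prob_space)
  have m: "(\<lambda>w. norm (w s - x)) \<in> borel_measurable M"
    using assms by (intro measurable_brownian[of s "\<lambda>y. norm (y - x)"]) auto
  have "integrable M (\<lambda>w. norm (w s - x)) \<and> (\<integral>w. norm (w s - x) \<partial>M) \<le> (1 + real DIM('a)) * sqrt s"
  proof (cases "s = 0")
    case True
    have "AE w in M. norm (w s - x) = 0"
      using brownian_start by eventually_elim (simp add: True)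
    then have "has_bochner_integral M (\<lambda>w. norm (w s - x)) 0"
      using has_bochner_integral_cong_AE[OF m, of "\<lambda>_. 0" 0] has_bochner_integral_zero by fastforce
    then show ?thesis using True by (simp add: has_bochner_integral_iff)
  next
    case False
    then have s: "0 < s" using assms by simp
    \<comment> \<open>The inequality of arithmetic and geometric means with weight
      \<open>sqrt s\<close>, the typical size of the increment, reduces the first moment to the
      second.\<close>
    have le: "norm (w s - x) \<le> (sqrt s + (norm (w s - x))\<^sup>2 / sqrt s) / 2" for w :: "real \<Rightarrow> 'a"
    proof -
      have "0 \<le> (sqrt s - norm (w s - x))\<^sup>2 / sqrt s" using s by simp
      also have "\<dots> = sqrt s + (norm (w s - x))\<^sup>2 / sqrt s - 2 * norm (w s - x)"
        using s by (simp add: power2_eq_square field_simps)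
      finally show ?thesis by simp
    qed
    have "has_bochner_integral M (\<lambda>w. (sqrt s + (norm (w s - x))\<^sup>2 / sqrt s) / 2)
        ((sqrt s + (real DIM('a) * s) / sqrt s) / 2)"
      using brownian_norm_square_moment[OF s]
      by (intro has_bochner_integral_divide_zero has_bochner_integral_add)
        (simp_all add: has_bochner_integral_iff prob_space)
    then have i: "integrable M (\<lambda>w. (sqrt s + (norm (w s - x))\<^sup>2 / sqrt s) / 2)"
      and v: "(\<integral>w. (sqrt s + (norm (w s - x))\<^sup>2 / sqrt s) / 2 \<partial>M) = ((sqrt s + (real DIM('a) * s) / sqrt s) / 2)"
      by (auto simp: has_bochner_integral_iff)
    have int: "integrable M (\<lambda>w. norm (w s - x))"
      by (rule Bochner_Integration.integrable_bound[OF i m], rule AE_I2,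
          unfold real_norm_def abs_norm_cancel, rule order_trans[OF le abs_ge_self])
    have "(\<integral>w. norm (w s - x) \<partial>M) \<le> (sqrt s + (real DIM('a) * s) / sqrt s) / 2"
      using integral_mono[OF int i] le v by simp
    also have "(real DIM('a) * s) / sqrt s = real DIM('a) * sqrt s"
      using s real_div_sqrt[of s] by (metis less_imp_le times_divide_eq_right)
    also have "(sqrt s + real DIM('a) * sqrt s) / 2 \<le> (1 + real DIM('a)) * sqrt s"
      using s by (simp add: algebra_simps)
    finally show ?thesis using int by simp
  qed
  then show "integrable M (\<lambda>w. norm (w s - x))"
    "(\<integral>w. norm (w s - x) \<partial>M) \<le> (1 + real DIM('a)) * sqrt s" by auto
qed

end

section \<open>The barrier function\<close>

text \<open>
  The exponent of the profile is \<open>n = j + 3\<close> with \<open>j \<ge> 2\<close>, which makes it three times differentiable across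
  the sphere of radius \<open>R\<close>.
\<close>
definition profile :: "real \<Rightarrow> nat \<Rightarrow> real \<Rightarrow> real \<Rightarrow> real" where
  "profile \<eta> j a u = 1 / (\<eta> + a * max 0 u ^ (j + 3))"

definition profile' :: "real \<Rightarrow> nat \<Rightarrow> real \<Rightarrow> real \<Rightarrow> real" where
  "profile' \<eta> j a u =
     - (a * (real j + 3) * max 0 u ^ (j + 2)) / (\<eta> + a * max 0 u ^ (j + 3))\<^sup>2"

definition profile'' :: "real \<Rightarrow> nat \<Rightarrow> real \<Rightarrow> real \<Rightarrow> real" where
  "profile'' \<eta> j a u =
     - (a * (real j + 3) * (real j + 2) * max 0 u ^ (j + 1)) / (\<eta> + a * max 0 u ^ (j + 3))\<^sup>2
     + 2 * (a * (real j + 3) * max 0 u ^ (j + 2))\<^sup>2 / (\<eta> + a * max 0 u ^ (j + 3)) ^ 3"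

definition profile''' :: "real \<Rightarrow> nat \<Rightarrow> real \<Rightarrow> real \<Rightarrow> real" where
  "profile''' \<eta> j a u =
     - (a * (real j + 3) * (real j + 2) * (real j + 1) * max 0 u ^ j) / (\<eta> + a * max 0 u ^ (j + 3))\<^sup>2
     + 6 * (a * (real j + 3) * max 0 u ^ (j + 2)) * (a * (real j + 3) * (real j + 2) * max 0 u ^ (j + 1))
         / (\<eta> + a * max 0 u ^ (j + 3)) ^ 3
     - 6 * (a * (real j + 3) * max 0 u ^ (j + 2)) ^ 3 / (\<eta> + a * max 0 u ^ (j + 3)) ^ 4"

section \<open>Derivatives and Taylor expansion of the profile\<close>

lemma DERIV_positive_part_power:
  fixes u :: real
  shows "((\<lambda>u. max 0 u ^ (k + 2)) has_real_derivative (real k + 2) * max 0 u ^ (k + 1)) (at u)"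
proof -
  consider "u < 0" | "u = 0" | "0 < u" by linarith
  then show ?thesis
  proof cases
    case 1
    then have "((\<lambda>u::real. 0) has_real_derivative (real k + 2) * max 0 u ^ (k + 1)) (at u)"
      by (simp add: max_def)
    then show ?thesis
      by (rule has_field_derivative_transform_within_open[of _ _ _ "{..<0}"]) (use 1 in \<open>auto simp: max_def\<close>)
  next
    case 3
    then have "((\<lambda>u::real. u ^ (k + 2)) has_real_derivative (real k + 2) * max 0 u ^ (k + 1)) (at u)"
      using DERIV_pow[of "k + 2" u] by (simp add: max_def add.commute)
    then show ?thesis
      by (rule has_field_derivative_transform_within_open[of _ _ _ "{0<..}"]) (use 3 in \<open>auto simp: max_def\<close>)
  next
    \<comment> \<open>At the kink the difference quotient is a positive power of the positive part,
      which tends to 0; this is where an exponent of at least 2 enters.\<close>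
    case 2
    have "((\<lambda>h::real. max 0 h ^ (k + 1)) \<longlongrightarrow> max 0 0 ^ (k + 1)) (at 0)"
      by (intro tendsto_intros)
    then have lim: "((\<lambda>h::real. max 0 h ^ (k + 1)) \<longlongrightarrow> 0) (at 0)" by simp
    have "((\<lambda>h::real. max 0 h ^ (k + 2) / h) \<longlongrightarrow> 0) (at 0)"
    proof (rule Lim_transform_eventually[OF lim])
      show "\<forall>\<^sub>F h::real in at 0. max 0 h ^ (k + 1) = max 0 h ^ (k + 2) / h"
        by (auto simp: eventually_at_filter max_def)
    qed
    then show ?thesis by (simp add: 2 DERIV_def)
  qed
qed

lemma DERIV_positive_part_powers:
  fixes u :: real
  assumes "2 \<le> j"
  shows "((\<lambda>u. max 0 u ^ (j + 3)) has_real_derivative (real j + 3) * max 0 u ^ (j + 2)) (at u)"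
    "((\<lambda>u. max 0 u ^ (j + 2)) has_real_derivative (real j + 2) * max 0 u ^ (j + 1)) (at u)"
    "((\<lambda>u. max 0 u ^ (j + 1)) has_real_derivative (real j + 1) * max 0 u ^ j) (at u)"
proof -
  obtain i where i: "j = i + 2" using assms by (metis add.commute le_Suc_ex)
  show "((\<lambda>u. max 0 u ^ (j + 3)) has_real_derivative (real j + 3) * max 0 u ^ (j + 2)) (at u)"
    "((\<lambda>u. max 0 u ^ (j + 2)) has_real_derivative (real j + 2) * max 0 u ^ (j + 1)) (at u)"
    "((\<lambda>u. max 0 u ^ (j + 1)) has_real_derivative (real j + 1) * max 0 u ^ j) (at u)"
    using DERIV_positive_part_power[where k = "j+1" and u=u]
      DERIV_positive_part_power[where k = j and u=u]
      DERIV_positive_part_power[where k = "i+1" and u=u]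
    unfolding i by (simp_all add: numeral_eq_Suc algebra_simps)
qed

lemma barrier_denominator_pos:
  fixes \<eta> a u :: real
  assumes "0 < \<eta>" "0 \<le> a"
  shows "0 < \<eta> + a * max 0 u ^ k"
  using assms by (simp add: add_pos_nonneg)

context
  fixes \<eta> a :: real and j :: nat
  assumes \<eta>: "0 < \<eta>" and a: "0 \<le> a" and j: "2 \<le> j"
begin

lemma DERIV_profile:
  "(profile \<eta> j a has_real_derivative profile' \<eta> j a u) (at u)"
proof -
  have m: "\<eta> + a * max 0 u ^ (j + 3) \<noteq> 0"
    using barrier_denominator_pos[OF \<eta> a, of u "j + 3"] by simp
  show ?thesis
    unfolding profile_def[abs_def] profile'_def
    by (rule derivative_eq_intros DERIV_positive_part_powers[OF j] m refl)+
      (simp add: power2_eq_square mult_ac)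
qed

lemma DERIV_barrier_denominator:
  "((\<lambda>u. \<eta> + a * max 0 u ^ (j + 3)) has_real_derivative a * (real j + 3) * max 0 u ^ (j + 2)) (at u)"
  using DERIV_add[OF DERIV_const[of \<eta>] DERIV_cmult[OF DERIV_positive_part_powers(1)[OF j], of a]]
  by (simp add: mult.assoc)

lemma DERIV_profile':
  "(profile' \<eta> j a has_real_derivative profile'' \<eta> j a u) (at u)"
proof -
  define q where "q u = \<eta> + a * max 0 u ^ (j + 3)" for u
  define P where "P u = max 0 u ^ (j + 2)" for u :: real
  have Dq: "(q has_real_derivative a * (real j + 3) * P u) (at u)"
    unfolding q_def[abs_def] P_def by (rule DERIV_barrier_denominator)
  have DP: "(P has_real_derivative (real j + 2) * max 0 u ^ (j + 1)) (at u)"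
    unfolding P_def[abs_def] by (rule DERIV_positive_part_powers[OF j])
  have q: "q u \<noteq> 0" using barrier_denominator_pos[OF \<eta> a, of u "j + 3"] by (simp add: q_def)
  show ?thesis
    unfolding profile'_def[abs_def] profile''_def q_def[symmetric] P_def[symmetric]
    apply (rule derivative_eq_intros Dq DP refl)+
    using q apply simp
    using q by (simp add: divide_simps) (simp add: eval_nat_numeral algebra_simps)
qed

lemma DERIV_profile'':
  "(profile'' \<eta> j a has_real_derivative profile''' \<eta> j a u) (at u)"
proof -
  define q where "q u = \<eta> + a * max 0 u ^ (j + 3)" for u
  define P where "P u = max 0 u ^ (j + 2)" for u :: real
  define Q where "Q u = max 0 u ^ (j + 1)" for u :: real
  have Dq: "(q has_real_derivative a * (real j + 3) * P u) (at u)"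
    unfolding q_def[abs_def] P_def by (rule DERIV_barrier_denominator)
  have DP: "(P has_real_derivative (real j + 2) * Q u) (at u)"
    unfolding P_def[abs_def] Q_def by (rule DERIV_positive_part_powers[OF j])
  have DQ: "(Q has_real_derivative (real j + 1) * max 0 u ^ j) (at u)"
    unfolding Q_def[abs_def] by (rule DERIV_positive_part_powers[OF j])
  have q: "q u \<noteq> 0" using barrier_denominator_pos[OF \<eta> a, of u "j + 3"] by (simp add: q_def)
  have "((\<lambda>u. - (a * (real j + 3) * (real j + 2) * Q u) / (q u)\<^sup>2) has_real_derivative
      - (a * (real j + 3) * (real j + 2) * (real j + 1) * max 0 u ^ j) / (q u)\<^sup>2
      + 2 * (a * (real j + 3) * P u) * (a * (real j + 3) * (real j + 2) * Q u) / q u ^ 3) (at u)"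
    apply (rule derivative_eq_intros Dq DQ refl)+
    using q apply simp
    using q by (simp add: divide_simps) (simp add: eval_nat_numeral algebra_simps)
  moreover have "((\<lambda>u. 2 * (a * (real j + 3) * P u)\<^sup>2 / q u ^ 3) has_real_derivative
      4 * (a * (real j + 3) * P u) * (a * (real j + 3) * (real j + 2) * Q u) / q u ^ 3
      - 6 * (a * (real j + 3) * P u) ^ 3 / q u ^ 4) (at u)"
    apply (rule derivative_eq_intros Dq DP refl)+
    using q apply simp
    using q by (simp add: divide_simps) (simp add: eval_nat_numeral algebra_simps)
  ultimately show ?thesis
    unfolding profile''_def[abs_def] profile'''_def q_def[symmetric] P_def[symmetric] Q_def[symmetric]
    by (rule DERIV_cong[OF DERIV_add]) (simp add: add_divide_distrib[symmetric])
qed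

end

lemma profile_positive_part:
  "profile \<eta> j a (max 0 u) = profile \<eta> j a u"
  "profile' \<eta> j a (max 0 u) = profile' \<eta> j a u"
  "profile'' \<eta> j a (max 0 u) = profile'' \<eta> j a u"
  by (simp_all add: profile_def profile'_def profile''_def)

text \<open>The derivatives see \<open>u\<close> only through its positive part, so for
  \<open>u \<le> 1\<close> the arguments range over the compact rectangle
  \<open>{0..A} \<times> {0..1}\<close>, on which \<eta> keeps the denominators positive. The bound
  may depend on \<eta>, since it enters only errors that vanish with the step size.\<close>

lemma profile_derivatives_bounded:
  assumes "0 < \<eta>"
  obtains K where "0 \<le> K"
    "\<And>a u. 0 \<le> a \<Longrightarrow> a \<le> A \<Longrightarrow> u \<le> 1 \<Longrightarrow> \<bar>profile' \<eta> j a u\<bar> \<le> K"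
    "\<And>a u. 0 \<le> a \<Longrightarrow> a \<le> A \<Longrightarrow> u \<le> 1 \<Longrightarrow> \<bar>profile'' \<eta> j a u\<bar> \<le> K"
    "\<And>a u. 0 \<le> a \<Longrightarrow> a \<le> A \<Longrightarrow> u \<le> 1 \<Longrightarrow> \<bar>profile''' \<eta> j a u\<bar> \<le> K"
proof -
  define S where "S = {0..A} \<times> {0..1::real}"
  have S: "compact S" by (simp add: S_def compact_Times)
  have nz: "\<eta> + fst z * max 0 (snd z) ^ (j + 3) \<noteq> 0" if "z \<in> S" for z
  proof -
    have "0 < \<eta> + fst z * max 0 (snd z) ^ (j + 3)"
      using that assms by (intro add_pos_nonneg) (auto simp: S_def)
    then show ?thesis by simp
  qed
  have c: "continuous_on S (\<lambda>z. profile' \<eta> j (fst z) (snd z))"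
    "continuous_on S (\<lambda>z. profile'' \<eta> j (fst z) (snd z))"
    "continuous_on S (\<lambda>z. profile''' \<eta> j (fst z) (snd z))"
    unfolding profile'_def profile''_def profile'''_def
    by (intro continuous_intros; use nz in simp)+
  have "\<exists>K. \<forall>z\<in>S. \<bar>g z\<bar> \<le> K" if "continuous_on S g" for g :: "real \<times> real \<Rightarrow> real"
    using compact_imp_bounded[OF compact_continuous_image[OF that S]] by (auto simp: bounded_iff)
  from this[OF c(1)] this[OF c(2)] this[OF c(3)]
  obtain K1 K2 K3 where K: "\<And>z. z \<in> S \<Longrightarrow> \<bar>profile' \<eta> j (fst z) (snd z)\<bar> \<le> K1"
    "\<And>z. z \<in> S \<Longrightarrow> \<bar>profile'' \<eta> j (fst z) (snd z)\<bar> \<le> K2"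
    "\<And>z. z \<in> S \<Longrightarrow> \<bar>profile''' \<eta> j (fst z) (snd z)\<bar> \<le> K3"
    by blast
  have z: "(a, max 0 u) \<in> S" if "0 \<le> a" "a \<le> A" "u \<le> 1" for a u
    using that by (auto simp: S_def)
  have p: "profile' \<eta> j a (max 0 u) = profile' \<eta> j a u"
    "profile'' \<eta> j a (max 0 u) = profile'' \<eta> j a u"
    "profile''' \<eta> j a (max 0 u) = profile''' \<eta> j a u" for a u
    by (simp_all add: profile'_def profile''_def profile'''_def)
  show thesis
  proof (rule that[of "max 0 (max K1 (max K2 K3))"])
    fix a u :: real assume au: "0 \<le> a" "a \<le> A" "u \<le> 1"
    show "\<bar>profile' \<eta> j a u\<bar> \<le> max 0 (max K1 (max K2 K3))"
      "\<bar>profile'' \<eta> j a u\<bar> \<le> max 0 (max K1 (max K2 K3))"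
      "\<bar>profile''' \<eta> j a u\<bar> \<le> max 0 (max K1 (max K2 K3))"
      using K[OF z[OF au]] p by auto
  qed simp
qed

text \<open>The expansion goes to third order because the quadratic term has to be kept exactly:
  under Brownian motion it contributes to the generator, at the same order in time as the linear
  term.\<close>

lemma profile_taylor:
  assumes \<eta>: "0 < \<eta>" and a: "0 \<le> a" and j: "2 \<le> j" and u: "u \<le> 1" "v \<le> 1"
    and K: "\<And>u. u \<le> 1 \<Longrightarrow> \<bar>profile''' \<eta> j a u\<bar> \<le> K"
  shows "profile \<eta> j a v \<le> profile \<eta> j a u + profile' \<eta> j a u * (v - u)
    + profile'' \<eta> j a u / 2 * (v - u)\<^sup>2 + K * \<bar>v - u\<bar> ^ 3"
proof (cases "v = u")
  case False
  define D where "D = (\<lambda>i::nat. if i = 0 then profile \<eta> j a else if i = 1 then profile' \<eta> j a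
      else if i = 2 then profile'' \<eta> j a else profile''' \<eta> j a)"
  have "\<exists>t. (if v < u then v < t \<and> t < u else u < t \<and> t < v) \<and>
      profile \<eta> j a v = (\<Sum>i<3. D i u / fact i * (v - u) ^ i) + D 3 t / fact 3 * (v - u) ^ 3"
  proof (rule Taylor)
    show "\<forall>i t. i < 3 \<and> min u v \<le> t \<and> t \<le> max u v \<longrightarrow> DERIV (D i) t :> D (Suc i) t"
      using DERIV_profile[OF \<eta> a j] DERIV_profile'[OF \<eta> a j] DERIV_profile''[OF \<eta> a j]
      by (auto simp: D_def less_Suc_eq numeral_3_eq_3)
  qed (use False in \<open>auto simp: D_def\<close>)
  then obtain t where t0: "if v < u then v < t \<and> t < u else u < t \<and> t < v" and
    eq: "profile \<eta> j a v = (\<Sum>i<3. D i u / fact i * (v - u) ^ i) + D 3 t / fact 3 * (v - u) ^ 3"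
    by blast
  have t: "t \<le> max u v" using t0 by (auto split: if_splits)
  have "D 3 t / fact 3 * (v - u) ^ 3 \<le> \<bar>D 3 t\<bar> / fact 3 * \<bar>v - u\<bar> ^ 3"
  proof -
    have "D 3 t / fact 3 * (v - u) ^ 3 \<le> \<bar>D 3 t / fact 3 * (v - u) ^ 3\<bar>" by (rule abs_ge_self)
    then show ?thesis by (simp add: abs_mult power_abs)
  qed
  also have "\<dots> \<le> K * \<bar>v - u\<bar> ^ 3"
  proof (rule mult_right_mono)
    have "\<bar>D 3 t\<bar> \<le> K" using K[of t] t u by (simp add: D_def)
    then show "\<bar>D 3 t\<bar> / fact 3 \<le> K" by (simp add: fact_numeral)
  qed simp
  finally show ?thesis
    unfolding eq by (simp add: D_def numeral_3_eq_3 numeral_2_eq_2)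
qed simp

section \<open>The barrier in space and time, and its defect as a supersolution\<close>

definition barrier :: "real \<Rightarrow> nat \<Rightarrow> real \<Rightarrow> real \<Rightarrow> real \<Rightarrow> real \<Rightarrow> 'a::euclidean_space \<Rightarrow> real" where
  "barrier \<eta> j A c R t x = profile \<eta> j (A * exp (- (c * t))) (1 - (norm x)\<^sup>2 / R\<^sup>2)"

text \<open>Half the Laplacian, the generator of standard Brownian motion, by the chain rule: u = 1
  - |x|^2/R^2 has Laplacian -2 d/R^2 and squared gradient 4 |x|^2/R^4.\<close>

definition laplacian_barrier :: "real \<Rightarrow> nat \<Rightarrow> real \<Rightarrow> real \<Rightarrow> real \<Rightarrow> real \<Rightarrow> 'a::euclidean_space \<Rightarrow> real" where
  "laplacian_barrier \<eta> j A c R t x =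
     - (real DIM('a) / R\<^sup>2) * profile' \<eta> j (A * exp (- (c * t))) (1 - (norm x)\<^sup>2 / R\<^sup>2)
     + 2 * (norm x)\<^sup>2 / R ^ 4 * profile'' \<eta> j (A * exp (- (c * t))) (1 - (norm x)\<^sup>2 / R\<^sup>2)"

text \<open>The derivative in t. Weight and u enter the profile only through the product of the
  weight with u^n, n = j + 3, so inside the ball decreasing the weight at rate c acts like
  \<open>- (c * u / n)\<close> times the derivative in u; outside both vanish.\<close>

definition time_barrier :: "real \<Rightarrow> nat \<Rightarrow> real \<Rightarrow> real \<Rightarrow> real \<Rightarrow> real \<Rightarrow> 'a::euclidean_space \<Rightarrow> real" where
  "time_barrier \<eta> j A c R t x =
     - (c * (1 - (norm x)\<^sup>2 / R\<^sup>2) / (real j + 3))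
       * profile' \<eta> j (A * exp (- (c * t))) (1 - (norm x)\<^sup>2 / R\<^sup>2)"

text \<open>The barrier is a supersolution of the reaction-diffusion equation behind the mild
  equation exactly when this is at most the reaction term evaluated at the barrier.\<close>

definition defect_barrier :: "real \<Rightarrow> nat \<Rightarrow> real \<Rightarrow> real \<Rightarrow> real \<Rightarrow> real \<Rightarrow> 'a::euclidean_space \<Rightarrow> real" where
  "defect_barrier \<eta> j A c R t x = laplacian_barrier \<eta> j A c R t x - time_barrier \<eta> j A c R t x"

text \<open>Clipping at 0 amounts to replacing |x| by its minimum with R. A difference of squares of
  two such radii is at most 2 R times their difference.\<close>

lemma clipped_square_lipschitz:
  fixes x y :: "'a::euclidean_space"
  assumes R: "0 < R"
  shows "\<bar>max 0 (1 - (norm x)\<^sup>2 / R\<^sup>2) - max 0 (1 - (norm y)\<^sup>2 / R\<^sup>2)\<bar> \<le> 2 / R * norm (x - y)"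
proof -
  have e: "max 0 (1 - (norm z)\<^sup>2 / R\<^sup>2) = 1 - (min (norm z) R)\<^sup>2 / R\<^sup>2" for z :: 'a
  proof (cases "norm z \<le> R")
    case True
    then have "(norm z)\<^sup>2 \<le> R\<^sup>2" by (simp add: power_mono)
    then have "(norm z)\<^sup>2 / R\<^sup>2 \<le> 1" using R by simp
    then show ?thesis using True by (simp add: min_def)
  next
    case False
    then have "R\<^sup>2 \<le> (norm z)\<^sup>2" using R by (intro power_mono) auto
    then have "1 \<le> (norm z)\<^sup>2 / R\<^sup>2" using R by simp
    then show ?thesis using False R by (simp add: min_def)
  qed
  define p q where "p = min (norm x) R" and "q = min (norm y) R"
  have pq: "\<bar>q - p\<bar> \<le> norm (x - y)" "0 \<le> p" "p \<le> R" "0 \<le> q" "q \<le> R"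
    using norm_triangle_ineq3[of x y] R by (auto simp: p_def q_def min_def)
  have "\<bar>(1 - p\<^sup>2 / R\<^sup>2) - (1 - q\<^sup>2 / R\<^sup>2)\<bar> = \<bar>q - p\<bar> * ((q + p) / R\<^sup>2)"
  proof -
    have "(1 - p\<^sup>2 / R\<^sup>2) - (1 - q\<^sup>2 / R\<^sup>2) = (q - p) * ((q + p) / R\<^sup>2)"
      by (simp add: power2_eq_square diff_divide_distrib algebra_simps)
    then show ?thesis using pq R by (simp add: abs_mult)
  qed
  also have "\<dots> \<le> norm (x - y) * ((R + R) / R\<^sup>2)"
    using pq R by (intro mult_mono divide_right_mono) auto
  also have "\<dots> = 2 / R * norm (x - y)" using R by (simp add: power2_eq_square)
  finally show ?thesis by (simp add: e p_def q_def)
qed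

lemma lipschitz_of_DERIV:
  fixes f f' :: "real \<Rightarrow> real"
  assumes "\<And>u. (f has_real_derivative f' u) (at u)" "\<And>u. u \<le> 1 \<Longrightarrow> \<bar>f' u\<bar> \<le> K" "u \<le> 1" "v \<le> 1"
  shows "\<bar>f u - f v\<bar> \<le> K * \<bar>u - v\<bar>"
proof -
  have "norm (f u - f v) \<le> K * norm (u - v)"
  proof (rule field_differentiable_bound[of "{..1}"])
    show "(f has_field_derivative f' z) (at z within {..1})" if "z \<in> {..1}" for z
      using assms(1) by (rule has_field_derivative_at_within)
  qed (use assms in auto)
  then show ?thesis by simp
qed

locale barrier_parameters =
  fixes \<eta> A c R :: real and j :: nat
  assumes \<eta>: "0 < \<eta>" and A: "0 < A" and c: "0 \<le> c" and R: "0 < R" and j: "2 \<le> j"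
begin

lemma weight_bounds: "0 \<le> t \<Longrightarrow> 0 \<le> A * exp (- (c * t))" "0 \<le> t \<Longrightarrow> A * exp (- (c * t)) \<le> A"
  using A c by (auto simp: mult_le_cancel_left1)

lemma barrier_bounds: "0 \<le> t \<Longrightarrow> 0 \<le> barrier \<eta> j A c R t x" "0 \<le> t \<Longrightarrow> barrier \<eta> j A c R t x \<le> 1 / \<eta>"
proof -
  assume t: "0 \<le> t"
  have p: "0 \<le> A * exp (- (c * t)) * max 0 (1 - (norm x)\<^sup>2 / R\<^sup>2) ^ (j + 3)"
    using weight_bounds[OF t] by (intro mult_nonneg_nonneg) auto
  show "0 \<le> barrier \<eta> j A c R t x" "barrier \<eta> j A c R t x \<le> 1 / \<eta>"
    unfolding barrier_def profile_def using p \<eta> by (auto intro!: divide_left_mono add_nonneg_nonneg mult_pos_pos add_pos_nonneg)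
qed

lemma barrier_outside:
  assumes "R \<le> norm x"
  shows "barrier \<eta> j A c R t x = 1 / \<eta>" "laplacian_barrier \<eta> j A c R t x = 0"
    "time_barrier \<eta> j A c R t x = 0" "defect_barrier \<eta> j A c R t x = 0"
proof -
  have "R\<^sup>2 \<le> (norm x)\<^sup>2" using R assms by (intro power_mono) auto
  then have "1 \<le> (norm x)\<^sup>2 / R\<^sup>2" using R by simp
  then have "max 0 (1 - (norm x)\<^sup>2 / R\<^sup>2) = 0" by simp
  then show "barrier \<eta> j A c R t x = 1 / \<eta>" "laplacian_barrier \<eta> j A c R t x = 0"
    "time_barrier \<eta> j A c R t x = 0" "defect_barrier \<eta> j A c R t x = 0"
    by (simp_all add: barrier_def profile_def laplacian_barrier_def profile'_def
        profile''_def time_barrier_def defect_barrier_def)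
qed

text \<open>The constant is uniform in t because the weight \<open>A * exp (- (c * t))\<close> stays
  between 0 and \<open>A\<close>; this uniformity is what allows the errors of many short steps to
  be summed.\<close>

lemma barrier_lipschitz:
  obtains L where "0 \<le> L"
    "\<And>t x y. 0 \<le> t \<Longrightarrow> \<bar>barrier \<eta> j A c R t x - barrier \<eta> j A c R t (y::'a::euclidean_space)\<bar> \<le> L * norm (x - y)"
    "\<And>t x y. 0 \<le> t \<Longrightarrow> \<bar>defect_barrier \<eta> j A c R t x - defect_barrier \<eta> j A c R t (y::'a)\<bar> \<le> L * norm (x - y)"
proof -
  obtain K where K: "0 \<le> K"
    "\<And>a u. 0 \<le> a \<Longrightarrow> a \<le> A \<Longrightarrow> u \<le> 1 \<Longrightarrow> \<bar>profile' \<eta> j a u\<bar> \<le> K"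
    "\<And>a u. 0 \<le> a \<Longrightarrow> a \<le> A \<Longrightarrow> u \<le> 1 \<Longrightarrow> \<bar>profile'' \<eta> j a u\<bar> \<le> K"
    "\<And>a u. 0 \<le> a \<Longrightarrow> a \<le> A \<Longrightarrow> u \<le> 1 \<Longrightarrow> \<bar>profile''' \<eta> j a u\<bar> \<le> K"
    using profile_derivatives_bounded[OF \<eta>] by blast
  define n where "n = real j + 3"
  have n: "0 < n" by (simp add: n_def)
  define d where "d = real DIM('a)"
  have d: "0 \<le> d" by (simp add: d_def)
  \<comment> \<open>The defect as a function of the clipped u alone: inside the ball |x|^2 is R^2 (1
    - u), and outside both profile derivatives vanish, so the clipped value 0 gives the right
    answer.\<close>
  define g where "g a u = (c * u / n - d / R\<^sup>2) * profile' \<eta> j a u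
     + (2 * (1 - u) / R\<^sup>2) * profile'' \<eta> j a u" for a u
  define g' where "g' a u = (c / n) * profile' \<eta> j a u
     + (c * u / n - d / R\<^sup>2) * profile'' \<eta> j a u
     - (2 / R\<^sup>2) * profile'' \<eta> j a u + (2 * (1 - u) / R\<^sup>2) * profile''' \<eta> j a u" for a u
  have Dg: "(g a has_real_derivative g' a u) (at u)" if "0 \<le> a" for a u
  proof -
    have gen: "((\<lambda>u. (p * u - s) * f u + k * (1 - u) * h u) has_real_derivative
        p * f u + (p * u - s) * f' - k * h u + k * (1 - u) * h') (at u)"
      if "(f has_real_derivative f') (at u)" "(h has_real_derivative h') (at u)" for f h f' h' p s k
      by (auto intro!: derivative_eq_intros that simp: algebra_simps)
    show ?thesis
      using gen[OF DERIV_profile'[OF \<eta> that j] DERIV_profile''[OF \<eta> that j],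
          of "c / n" "d / R\<^sup>2" "2 / R\<^sup>2"]
      unfolding g_def[abs_def] g'_def by simp
  qed
  define L1 where "L1 = (c / n + (c / n + d / R\<^sup>2) + 2 / R\<^sup>2 + 2 / R\<^sup>2) * K"
  have g'_le: "\<bar>g' a u\<bar> \<le> L1" if a: "0 \<le> a" "a \<le> A" and u: "0 \<le> u" "u \<le> 1" for a u
  proof -
    have cu: "c * u / n \<le> c / n" "0 \<le> c * u / n" "0 \<le> d / R\<^sup>2"
      using u c n mult_left_mono[of u 1 c] by (auto simp: divide_right_mono d_def)
    then have "\<bar>c * u / n - d / R\<^sup>2\<bar> \<le> c / n + d / R\<^sup>2" by linarith
    moreover have "\<bar>2 * (1 - u) / R\<^sup>2\<bar> \<le> 2 / R\<^sup>2"
      using u R by (simp add: divide_right_mono)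
    moreover have abs4: "\<bar>p + q - r + s\<bar> \<le> B1 + B2 + B3 + B4"
      if "\<bar>p\<bar> \<le> B1" "\<bar>q\<bar> \<le> B2" "\<bar>r\<bar> \<le> B3" "\<bar>s\<bar> \<le> B4" for p q r s B1 B2 B3 B4 :: real
      using that by linarith
    moreover have mm: "\<bar>p * r\<bar> \<le> B * K" if "\<bar>p\<bar> \<le> B" "\<bar>r\<bar> \<le> K" for p r B :: real
      unfolding abs_mult using that by (intro mult_mono) linarith+
    ultimately have "\<bar>(c / n) * profile' \<eta> j a u\<bar> \<le> c / n * K"
      "\<bar>(c * u / n - d / R\<^sup>2) * profile'' \<eta> j a u\<bar> \<le> (c / n + d / R\<^sup>2) * K"
      "\<bar>(2 / R\<^sup>2) * profile'' \<eta> j a u\<bar> \<le> 2 / R\<^sup>2 * K"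
      "\<bar>(2 * (1 - u) / R\<^sup>2) * profile''' \<eta> j a u\<bar> \<le> 2 / R\<^sup>2 * K"
      using K(2-4)[OF a u(2)] c n by (auto intro!: mm simp del: abs_mult times_divide_eq_left)
    then have "\<bar>g' a u\<bar> \<le> c / n * K + (c / n + d / R\<^sup>2) * K + 2 / R\<^sup>2 * K + 2 / R\<^sup>2 * K"
      unfolding g'_def by (intro abs4)
    then show ?thesis
      unfolding L1_def by (simp only: distrib_right)
  qed
  have lip_g: "\<bar>g a u - g a v\<bar> \<le> L1 * \<bar>u - v\<bar>" if a: "0 \<le> a" "a \<le> A" and u: "0 \<le> u" "u \<le> 1" "0 \<le> v" "v \<le> 1" for a u v
  proof -
    have "norm (g a u - g a v) \<le> L1 * norm (u - v)"
    proof (rule field_differentiable_bound[of "{0..1}"])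
      show "(g a has_field_derivative g' a z) (at z within {0..1})" if "z \<in> {0..1}" for z
        using Dg[OF a(1)] by (rule has_field_derivative_at_within)
    qed (use g'_le[OF a] u in auto)
    then show ?thesis by simp
  qed
  have U: "0 \<le> max 0 (1 - (norm x)\<^sup>2 / R\<^sup>2)" "max 0 (1 - (norm x)\<^sup>2 / R\<^sup>2) \<le> 1" for x :: 'a by auto
  have defect: "defect_barrier \<eta> j A c R t x = g (A * exp (- (c * t))) (max 0 (1 - (norm x)\<^sup>2 / R\<^sup>2))" for t and x :: 'a
  proof (cases "norm x \<le> R")
    case True
    then have "(norm x)\<^sup>2 \<le> R\<^sup>2" by (simp add: power_mono)
    then have u: "max 0 (1 - (norm x)\<^sup>2 / R\<^sup>2) = 1 - (norm x)\<^sup>2 / R\<^sup>2" using R by simp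
    have "2 * (norm x)\<^sup>2 / R ^ 4 = 2 * (1 - (1 - (norm x)\<^sup>2 / R\<^sup>2)) / R\<^sup>2"
      using R by (simp add: power4_eq_xxxx power2_eq_square)
    then show ?thesis
      unfolding u defect_barrier_def laplacian_barrier_def time_barrier_def g_def d_def n_def
      by (simp add: algebra_simps)
  next
    case False
    then have "R\<^sup>2 \<le> (norm x)\<^sup>2" using R by (intro power_mono) auto
    then have u: "max 0 (1 - (norm x)\<^sup>2 / R\<^sup>2) = 0" using R by simp
    show ?thesis unfolding u
      using barrier_outside[of x] False by (simp add: g_def profile'_def profile''_def)
  qed
  have L1: "0 \<le> L1" unfolding L1_def using K(1) c n by (auto simp: d_def)
  show thesis
  proof (rule that[of "(K + L1) * (2 / R)"])
    show "0 \<le> (K + L1) * (2 / R)" using K(1) L1 R by simp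
    fix t :: real and x y :: 'a assume t: "0 \<le> t"
    define u v where "u = max 0 (1 - (norm x)\<^sup>2 / R\<^sup>2)" and "v = max 0 (1 - (norm y)\<^sup>2 / R\<^sup>2)"
    have uv: "\<bar>u - v\<bar> \<le> 2 / R * norm (x - y)"
      unfolding u_def v_def by (rule clipped_square_lipschitz[OF R])
    have u01: "0 \<le> u" "u \<le> 1" "0 \<le> v" "v \<le> 1" by (auto simp: u_def v_def)
    have "\<bar>barrier \<eta> j A c R t x - barrier \<eta> j A c R t y\<bar> \<le> K * \<bar>u - v\<bar>"
      unfolding barrier_def u_def v_def
      by (subst (1 2) profile_positive_part(1)[symmetric])
        (rule lipschitz_of_DERIV[OF DERIV_profile[OF \<eta> weight_bounds(1)[OF t] j]],
          use K(2) weight_bounds[OF t] U in auto)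
    also have "\<dots> \<le> (K + L1) * (2 / R * norm (x - y))"
      using uv K(1) L1 by (intro mult_mono) auto
    finally show "\<bar>barrier \<eta> j A c R t x - barrier \<eta> j A c R t y\<bar> \<le> (K + L1) * (2 / R) * norm (x - y)"
      by (simp only: mult.assoc)
    have "\<bar>defect_barrier \<eta> j A c R t x - defect_barrier \<eta> j A c R t y\<bar> \<le> L1 * \<bar>u - v\<bar>"
      unfolding defect u_def[symmetric] v_def[symmetric]
      by (rule lip_g) (use weight_bounds[OF t] u01 in auto)
    also have "\<dots> \<le> (K + L1) * (2 / R * norm (x - y))"
      using uv K(1) L1 by (intro mult_mono) auto
    finally show "\<bar>defect_barrier \<eta> j A c R t x - defect_barrier \<eta> j A c R t y\<bar> \<le> (K + L1) * (2 / R) * norm (x - y)"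
      by (simp only: mult.assoc)
  qed
qed

lemma barrier_time_taylor:
  assumes t: "0 \<le> t" and e: "0 \<le> e"
  shows "barrier \<eta> j A c R t x + e * time_barrier \<eta> j A c R t x - 3 * c\<^sup>2 / \<eta> * e\<^sup>2
    \<le> barrier \<eta> j A c R (t + e) x"
proof (cases "e = 0")
  case False
  define z where "z = max 0 (1 - (norm x)\<^sup>2 / R\<^sup>2) ^ (j + 3)"
  have z: "0 \<le> z" by (simp add: z_def)
  define q where "q s = \<eta> + A * exp (- (c * s)) * z" for s
  have q: "0 < q s" "\<eta> \<le> q s" "A * exp (- (c * s)) * z \<le> q s" "0 \<le> A * exp (- (c * s)) * z" for s
    using \<eta> A z by (auto simp: q_def intro!: add_pos_nonneg)
  define D where "D = (\<lambda>i::nat. if i = 0 then (\<lambda>s. 1 / q s)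
     else if i = 1 then (\<lambda>s. c * (A * exp (- (c * s)) * z) / (q s)\<^sup>2)
     else (\<lambda>s. - c\<^sup>2 * (A * exp (- (c * s)) * z) / (q s)\<^sup>2 + 2 * c\<^sup>2 * (A * exp (- (c * s)) * z)\<^sup>2 / (q s) ^ 3))"
  have Dq: "(q has_real_derivative - (c * (A * exp (- (c * s)) * z))) (at s)" for s
    unfolding q_def by (auto intro!: derivative_eq_intros)
  have D0: "((\<lambda>s. 1 / q s) has_real_derivative c * (A * exp (- (c * s)) * z) / (q s)\<^sup>2) (at s)" for s
    using q(1)[of s] by (auto intro!: derivative_eq_intros Dq simp: power2_eq_square)
  have D1: "((\<lambda>s. c * (A * exp (- (c * s)) * z) / (q s)\<^sup>2) has_real_derivative
      - c\<^sup>2 * (A * exp (- (c * s)) * z) / (q s)\<^sup>2 + 2 * c\<^sup>2 * (A * exp (- (c * s)) * z)\<^sup>2 / (q s) ^ 3) (at s)" for s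
    apply (rule derivative_eq_intros Dq refl)+
    using q(1)[of s] apply simp
    using q(1)[of s] by (simp add: divide_simps) (simp add: eval_nat_numeral algebra_simps)
  have "\<exists>s. (if t + e < t then t + e < s \<and> s < t else t < s \<and> s < t + e) \<and>
      1 / q (t + e) = (\<Sum>i<2. D i t / fact i * (t + e - t) ^ i) + D 2 s / fact 2 * (t + e - t) ^ 2"
  proof (rule Taylor)
    show "\<forall>i s. i < 2 \<and> t \<le> s \<and> s \<le> t + e \<longrightarrow> DERIV (D i) s :> D (Suc i) s"
      using D0 D1 by (auto simp: D_def less_Suc_eq numeral_2_eq_2)
  qed (use False e in \<open>auto simp: D_def\<close>)
  then obtain s where s: "1 / q (t + e) = 1 / q t + c * (A * exp (- (c * t)) * z) / (q t)\<^sup>2 * e + D 2 s / 2 * e\<^sup>2"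
    by (auto simp: D_def numeral_2_eq_2)
  have "\<bar>D 2 s\<bar> \<le> 3 * c\<^sup>2 / \<eta>"
  proof -
    define y where "y = A * exp (- (c * s)) * z"
    have y: "0 \<le> y" "y \<le> q s" using q[of s] by (auto simp: y_def)
    \<comment> \<open>In terms of this ratio in [0, 1] the second time derivative is
      \<open>c\<^sup>2 / q s * (2 * p\<^sup>2 - p)\<close>, which is bounded independently of
      \<open>A\<close>, \<open>R\<close> and \<open>x\<close>.\<close>
    define p where "p = y / q s"
    have p: "0 \<le> p" "p \<le> 1" using y q(1)[of s] by (auto simp: p_def)
    have p2: "p\<^sup>2 \<le> 1" using p by (simp add: power_le_one)
    have "D 2 s = c\<^sup>2 / q s * (2 * p\<^sup>2 - p)"
    proof -
      have D2: "D 2 s = - c\<^sup>2 * y / (q s)\<^sup>2 + 2 * c\<^sup>2 * y\<^sup>2 / (q s) ^ 3"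
        by (simp add: D_def y_def)
      then show ?thesis
        unfolding p_def D2 using q(1)[of s]
        by (simp add: divide_simps) (simp add: eval_nat_numeral algebra_simps)
    qed
    moreover have "\<bar>2 * p\<^sup>2 - p\<bar> \<le> 3" using p p2 zero_le_power2[of p] by linarith
    moreover have "c\<^sup>2 / q s \<le> c\<^sup>2 / \<eta>"
      using q[of s] \<eta> by (intro divide_left_mono) auto
    ultimately have "\<bar>D 2 s\<bar> \<le> c\<^sup>2 / \<eta> * 3"
      using q(1)[of s] \<eta> by (simp only: abs_mult, intro mult_mono) auto
    then show ?thesis by (simp add: mult.commute)
  qed
  then have "- (3 * c\<^sup>2 / \<eta>) * e\<^sup>2 \<le> D 2 s / 2 * e\<^sup>2"
    by (intro mult_right_mono) (auto simp: abs_le_iff)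
  moreover have "time_barrier \<eta> j A c R t x = c * (A * exp (- (c * t)) * z) / (q t)\<^sup>2"
  proof (cases "norm x \<le> R")
    case True
    then have "(norm x)\<^sup>2 \<le> R\<^sup>2" by (simp add: power_mono)
    then have u: "max 0 (1 - (norm x)\<^sup>2 / R\<^sup>2) = 1 - (norm x)\<^sup>2 / R\<^sup>2" using R by simp
    show ?thesis
      unfolding time_barrier_def profile'_def q_def z_def u
      by (simp add: numeral_3_eq_3)
  next
    case False
    then show ?thesis
      using barrier_outside[of x] R by (simp add: z_def power_mono)
  qed
  moreover have "barrier \<eta> j A c R s x = 1 / q s" for s
    by (simp add: barrier_def profile_def q_def z_def)
  ultimately show ?thesis using s by (simp add: mult.commute)
qed simp

text \<open>With m for the denominator \<eta> + a u^n, diffusion is of order a u^(n-2) n^2 / (m^2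
  R^2) and the time derivative is c a u^n / m^2, so after pulling out a u^(n-2) a constant competes
  with c R^2 u^2. In the second derivative of the profile the negative term is dropped, and the
  positive one loses a factor by a u^n \<le> m.\<close>

lemma defect_barrier_le:
  fixes x :: "'a::euclidean_space"
  assumes t: "0 \<le> t" and x: "norm x \<le> R"
  defines "u \<equiv> 1 - (norm x)\<^sup>2 / R\<^sup>2" and "a \<equiv> A * exp (- (c * t))"
  defines "n \<equiv> real j + 3"
  shows "defect_barrier \<eta> j A c R t x
    \<le> a * u ^ (j + 1) / ((\<eta> + a * u ^ (j + 3))\<^sup>2 * R\<^sup>2) * (n * (real DIM('a) + 4 * n) - c * R\<^sup>2 * u\<^sup>2)"
proof -
  have "(norm x)\<^sup>2 \<le> R\<^sup>2" using x by (simp add: power_mono)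
  then have u: "0 \<le> u" "u \<le> 1" "max 0 u = u" using R by (auto simp: u_def)
  have a: "0 \<le> a" using weight_bounds[OF t] by (simp add: a_def)
  define m where "m = \<eta> + a * u ^ (j + 3)"
  have au: "0 \<le> a * u ^ k" for k using a u by simp
  have m: "0 < m" "a * u ^ (j + 3) \<le> m" using \<eta> au[of "j+3"] by (auto simp: m_def)
  have n: "0 < n" by (simp add: n_def)
  define y where "y = a * u ^ (j + 1)"
  have y: "0 \<le> y" unfolding y_def by (rule au)
  have y2: "a * u ^ (j + 2) = y * u" "a * u ^ (j + 3) = y * u\<^sup>2"
    by (simp_all add: y_def power2_eq_square power3_eq_cube power_add algebra_simps)
  have x2: "2 * (norm x)\<^sup>2 / R ^ 4 = 2 * (1 - u) / R\<^sup>2"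
    using R by (simp add: u_def power4_eq_xxxx power2_eq_square)
  have p1: "profile' \<eta> j a u = - (n * (y * u)) / m\<^sup>2"
    unfolding profile'_def u(3) m_def n_def y2(1)[symmetric] by (simp add: mult_ac)
  have p2: "profile'' \<eta> j a u = - (n * (n - 1) * y) / m\<^sup>2 + 2 * (n * (y * u))\<^sup>2 / m ^ 3"
    unfolding profile''_def u(3) m_def[symmetric] n_def y2(1)[symmetric] y_def
    by (simp add: mult_ac)
  have le1: "2 * (1 - u) * profile'' \<eta> j a u \<le> 4 * n\<^sup>2 * y / m\<^sup>2"
  proof -
    have "2 * (n * (y * u))\<^sup>2 / m ^ 3 = (2 * n\<^sup>2 * y / m\<^sup>2) * (y * u\<^sup>2 / m)"
      by (simp add: power2_eq_square power3_eq_cube)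
    also have "\<dots> \<le> (2 * n\<^sup>2 * y / m\<^sup>2) * 1"
      using m y y2 by (intro mult_left_mono) auto
    finally have a1: "2 * (n * (y * u))\<^sup>2 / m ^ 3 \<le> 2 * n\<^sup>2 * y / m\<^sup>2" by simp
    have "0 \<le> n * (n - 1) * y / m\<^sup>2" using n y by (simp add: n_def)
    then have "profile'' \<eta> j a u \<le> 2 * n\<^sup>2 * y / m\<^sup>2"
      unfolding p2 using a1 by simp
    then have "2 * (1 - u) * profile'' \<eta> j a u \<le> 2 * (1 - u) * (2 * n\<^sup>2 * y / m\<^sup>2)"
      using u by (intro mult_left_mono) auto
    also have "\<dots> \<le> 2 * 1 * (2 * n\<^sup>2 * y / m\<^sup>2)"
      using u y by (intro mult_right_mono mult_left_mono) auto
    finally show ?thesis by simp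
  qed
  have "defect_barrier \<eta> j A c R t x = real DIM('a) / R\<^sup>2 * (n * (y * u) / m\<^sup>2)
      + (2 * (1 - u) * profile'' \<eta> j a u) / R\<^sup>2 - c * (y * u\<^sup>2) / m\<^sup>2"
    unfolding defect_barrier_def laplacian_barrier_def time_barrier_def
      a_def[symmetric] u_def[symmetric] x2 p1 n_def[symmetric]
    using n by (simp add: power2_eq_square)
  also have "\<dots> \<le> real DIM('a) / R\<^sup>2 * (n * (y * 1) / m\<^sup>2)
      + (4 * n\<^sup>2 * y / m\<^sup>2) / R\<^sup>2 - c * (y * u\<^sup>2) / m\<^sup>2"
    using le1 R n y u by (intro diff_mono[OF _ order.refl] add_mono mult_left_mono divide_right_mono) auto
  also have "\<dots> = y / (m\<^sup>2 * R\<^sup>2) * (n * (real DIM('a) + 4 * n) - c * R\<^sup>2 * u\<^sup>2)"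
    using m R by (simp add: field_simps power2_eq_square)
  finally show ?thesis by (simp add: y_def m_def)
qed

text \<open>The choice of \<open>c\<close> makes the bracket of the previous estimate nonpositive
  for u at least 1/2. For u below 1/2, write a u^(n-2) as (a u^n)^(1-q) times a^q u^(n q - 2). The
  first factor is at most the power 1 - q of the denominator, which turns the squared denominator
  into the power 1 + q of the barrier, as in the growth bound on \<open>\<Phi>\<close>. The second
  factor is at most its value at a = A and u = 1/2 because n q is at least 2; \<open>main\<close> is
  this worst case.\<close>

lemma defect_barrier_le_reaction:
  fixes x :: "'a::euclidean_space" and \<Phi> :: "real \<Rightarrow> real"
  assumes t: "0 \<le> t" and x: "norm x \<le> R"
    and c_eq: "c = 4 * (real j + 3) * (real DIM('a) + 4 * (real j + 3)) / R\<^sup>2"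
    and b: "0 < b" and \<kappa>: "0 < \<kappa>" and q: "0 < q" "q < 1"
    and \<Phi>0: "\<And>u. 0 \<le> u \<Longrightarrow> 0 \<le> \<Phi> u" and \<Phi>: "\<And>u. u1 \<le> u \<Longrightarrow> \<kappa> * u powr (1 + q) \<le> \<Phi> u"
    and u1: "0 < u1" "\<eta> + A * (1/2) ^ (j + 3) \<le> 1 / u1"
    and nq: "2 \<le> (real j + 3) * q"
    and main: "(real j + 3) * (real DIM('a) + 4 * (real j + 3)) * (A powr q * (1/2) powr ((real j + 3) * q - 2)) \<le> b * \<kappa> * R\<^sup>2"
  shows "defect_barrier \<eta> j A c R t x \<le> b * \<Phi> (barrier \<eta> j A c R t x)"
proof -
  define u where "u = 1 - (norm x)\<^sup>2 / R\<^sup>2"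
  define a where "a = A * exp (- (c * t))"
  define n where "n = real j + 3"
  define C where "C = n * (real DIM('a) + 4 * n)"
  have "(norm x)\<^sup>2 \<le> R\<^sup>2" using x by (simp add: power_mono)
  then have u: "0 \<le> u" "u \<le> 1" "max 0 u = u" using R by (auto simp: u_def)
  have a: "0 < a" "a \<le> A" using weight_bounds[OF t] A by (auto simp: a_def)
  define m where "m = \<eta> + a * u ^ (j + 3)"
  have au: "0 \<le> a * u ^ k" for k using a u by simp
  have m: "0 < m" "a * u ^ (j + 3) \<le> m" using \<eta> au[of "j+3"] by (auto simp: m_def)
  have n: "0 < n" by (simp add: n_def)
  have C: "0 < C" using n by (simp add: C_def)
  have cR: "c * R\<^sup>2 = 4 * C" using R by (simp add: c_eq C_def n_def)
  have bar: "barrier \<eta> j A c R t x = 1 / m"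
    by (simp add: barrier_def profile_def a_def[symmetric] u_def[symmetric] u(3) m_def)
  have main_le: "defect_barrier \<eta> j A c R t x \<le> a * u ^ (j + 1) / (m\<^sup>2 * R\<^sup>2) * (C - 4 * C * u\<^sup>2)"
    using defect_barrier_le[OF t x] unfolding cR
    by (simp add: a_def u_def m_def C_def n_def)
  have nonneg: "0 \<le> b * \<Phi> (barrier \<eta> j A c R t x)"
    using \<Phi>0[OF barrier_bounds(1)[OF t], of x] b by simp
  show ?thesis
  proof (cases "1 / 2 \<le> u")
    case True
    then have "(1/2)\<^sup>2 \<le> u\<^sup>2" by (intro power_mono) auto
    then have "4 * C * (1/2)\<^sup>2 \<le> 4 * C * u\<^sup>2" using C by (intro mult_left_mono) auto
    then have "C - 4 * C * u\<^sup>2 \<le> 0" by (simp add: power2_eq_square)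
    then have "a * u ^ (j + 1) / (m\<^sup>2 * R\<^sup>2) * (C - 4 * C * u\<^sup>2) \<le> 0"
      using au[of "j+1"] by (intro mult_nonneg_nonpos divide_nonneg_nonneg) auto
    then show ?thesis using main_le nonneg by linarith
  next
    case False
    have "defect_barrier \<eta> j A c R t x \<le> a * u ^ (j + 1) / (m\<^sup>2 * R\<^sup>2) * C"
    proof (rule order_trans[OF main_le mult_left_mono])
      show "C - 4 * C * u\<^sup>2 \<le> C" using C by simp
      show "0 \<le> a * u ^ (j + 1) / (m\<^sup>2 * R\<^sup>2)"
        using au[of "j+1"] by (intro divide_nonneg_nonneg) auto
    qed
    also have "\<dots> \<le> b * (\<kappa> * (1 / m) powr (1 + q))"
    proof (cases "u = 0")
      case True
      then show ?thesis using b \<kappa> by simp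
    next
      case False
      then have u0: "0 < u" using u by simp
      have e1: "a * u ^ (j + 1) = (a * u ^ (j + 3)) powr (1 - q) * (a powr q * u powr (n * q - 2))"
      proof -
        have "(a * u ^ (j + 3)) powr (1 - q) = a powr (1 - q) * u powr (n * (1 - q))"
          using u0 a by (simp add: powr_mult powr_powr n_def flip: powr_realpow)
        moreover have "a powr (1 - q) * a powr q = a"
          using a by (simp add: powr_add[symmetric])
        moreover have "u powr (n * (1 - q)) * u powr (n * q - 2) = u ^ (j + 1)"
        proof -
          have "n * (1 - q) + (n * q - 2) = real (j + 1)" by (simp add: n_def algebra_simps)
          then have "u powr (n * (1 - q)) * u powr (n * q - 2) = u powr real (j + 1)"
            by (simp only: powr_add[symmetric])
          then show ?thesis using u0 by (simp only: powr_realpow)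
        qed
        ultimately have "(a * u ^ (j + 3)) powr (1 - q) * (a powr q * u powr (n * q - 2))
            = (a powr (1 - q) * a powr q) * (u powr (n * (1 - q)) * u powr (n * q - 2))"
          by (simp add: mult_ac)
        then show ?thesis
          by (simp only: \<open>a powr (1 - q) * a powr q = a\<close> \<open>u powr (n * (1 - q)) * u powr (n * q - 2) = u ^ (j + 1)\<close>)
      qed
      have "a powr q * u powr (n * q - 2) \<le> A powr q * (1/2) powr (n * q - 2)"
        using a u0 q nq \<open>\<not> 1/2 \<le> u\<close> by (intro mult_mono powr_mono2) (auto simp: n_def)
      then have "C * (a powr q * u powr (n * q - 2)) \<le> C * (A powr q * (1/2) powr (n * q - 2))"
        using C by (intro mult_left_mono) auto
      also have "\<dots> \<le> b * \<kappa> * R\<^sup>2"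
        using main by (simp add: C_def n_def)
      finally have e2: "C * (a powr q * u powr (n * q - 2)) \<le> b * \<kappa> * R\<^sup>2" .
      have "C * (a * u ^ (j + 1)) = (a * u ^ (j + 3)) powr (1 - q) * (C * (a powr q * u powr (n * q - 2)))"
        unfolding e1 by (simp only: mult.left_commute)
      also have "\<dots> \<le> m powr (1 - q) * (b * \<kappa> * R\<^sup>2)"
      proof (rule mult_mono[OF _ e2])
        show "(a * u ^ (j + 3)) powr (1 - q) \<le> m powr (1 - q)"
          using q m au[of "j+3"] by (intro powr_mono2) auto
      qed (use C in auto)
      finally have "C * (a * u ^ (j + 1)) \<le> m powr (1 - q) * (b * \<kappa> * R\<^sup>2)" .
      then have "a * u ^ (j + 1) / (m\<^sup>2 * R\<^sup>2) * C \<le> m powr (1 - q) * (b * \<kappa> * R\<^sup>2) / (m\<^sup>2 * R\<^sup>2)"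
      proof -
        have "a * u ^ (j + 1) / (m\<^sup>2 * R\<^sup>2) * C = C * (a * u ^ (j + 1)) / (m\<^sup>2 * R\<^sup>2)" by simp
        also have "\<dots> \<le> m powr (1 - q) * (b * \<kappa> * R\<^sup>2) / (m\<^sup>2 * R\<^sup>2)"
          by (rule divide_right_mono) (fact, simp)
        finally show ?thesis .
      qed
      also have "\<dots> = b * (\<kappa> * (m powr (1 - q) / m\<^sup>2))"
        using m R by (simp add: field_simps)
      also have "m powr (1 - q) / m\<^sup>2 = (1 / m) powr (1 + q)"
      proof -
        have "m powr (1 - q) / m\<^sup>2 = m powr (1 - q) / m powr 2"
          using m by (simp add: powr_numeral)
        also have "\<dots> = m powr (- (1 + q))"
          by (simp add: powr_diff[symmetric])
        also have "\<dots> = (1 / m) powr (1 + q)"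
          using m by (simp only: powr_minus_divide powr_divide) simp
        finally show ?thesis .
      qed
      finally show ?thesis .
    qed
    also have "\<dots> \<le> b * \<Phi> (1 / m)"
    proof -
      \<comment> \<open>In the outer part the barrier is at least \<open>u1\<close>, so the growth
        bound on \<open>\<Phi>\<close> is available there.\<close>
      have "u ^ (j + 3) \<le> (1/2) ^ (j + 3)" using False u by (intro power_mono) auto
      then have "m \<le> \<eta> + A * (1/2) ^ (j + 3)"
        unfolding m_def using a u by (intro add_left_mono mult_mono) auto
      then have "m \<le> 1 / u1" using u1 by simp
      then have "u1 \<le> 1 / m" using m u1 by (simp add: field_simps)
      from \<Phi>[OF this] show ?thesis using b by (intro mult_left_mono) auto
    qed
    finally show ?thesis by (simp add: bar)
  qed
qed

end

section \<open>Short-time expansions along Brownian motion\<close>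

lemma brownian_lipschitz_lower_bound:
  fixes x :: "'a::euclidean_space" and g :: "'a \<Rightarrow> real"
  assumes bm: "brownian_law x M" and s: "0 \<le> s"
    and g: "g \<in> borel_measurable borel" "\<And>y. \<bar>g y\<bar> \<le> B"
    and L: "0 \<le> L" "\<And>y. \<bar>g x - g y\<bar> \<le> L * norm (x - y)"
  shows "integrable M (\<lambda>w. g (w s))"
    and "g x - L * (1 + real DIM('a)) * sqrt s \<le> (\<integral>w. g (w s) \<partial>M)"
proof -
  interpret prob_space M by (rule brownian_prob_space[OF bm])
  note n = integrable_brownian_norm[OF bm s]
  show int: "integrable M (\<lambda>w. g (w s))"
    by (rule integrable_const_bound[of _ B]) (use g measurable_brownian[OF bm s g(1)] in auto)
  have "g x - L * (1 + real DIM('a)) * sqrt s \<le> g x - L * (\<integral>w. norm (w s - x) \<partial>M)"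
    using mult_left_mono[OF n(2) L(1)] by (simp add: mult.assoc)
  also have "\<dots> = (\<integral>w. g x - L * norm (w s - x) \<partial>M)"
    using n(1) by (simp add: prob_space)
  also have "\<dots> \<le> (\<integral>w. g (w s) \<partial>M)"
  proof (rule integral_mono[OF _ int])
    show "integrable M (\<lambda>w. g x - L * norm (w s - x))" using n(1) by simp
    show "g x - L * norm (w s - x) \<le> g (w s)" for w
      using L(2)[of "w s"] by (simp add: norm_minus_commute)
  qed
  finally show "g x - L * (1 + real DIM('a)) * sqrt s \<le> (\<integral>w. g (w s) \<partial>M)" .
qed

context barrier_parameters
begin

lemma measurable_barrier: "barrier \<eta> j A c R t \<in> borel_measurable borel"
  unfolding barrier_def[abs_def] profile_def by measurable

lemma measurable_defect_barrier: "defect_barrier \<eta> j A c R t \<in> borel_measurable borel"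
  unfolding defect_barrier_def[abs_def] laplacian_barrier_def time_barrier_def
    profile'_def profile''_def by measurable

lemma continuous_on_barrier:
  assumes "0 \<le> t" shows "continuous_on UNIV (barrier \<eta> j A c R t :: 'a::euclidean_space \<Rightarrow> real)"
proof -
  have "\<eta> + A * exp (- (c * t)) * max 0 (1 - (norm x)\<^sup>2 / R\<^sup>2) ^ (j + 3) \<noteq> 0" for x :: 'a
    using barrier_denominator_pos[OF \<eta> weight_bounds(1)[OF assms]] by (metis less_irrefl)
  then show ?thesis
    unfolding barrier_def[abs_def] profile_def
    by (intro continuous_intros) (use R in auto)
qed

text \<open>The expansion is made in the scalar u and not in x: the increment of u is a quadratic
  polynomial in the Brownian increment, so a one-variable Taylor formula and moments up to order six
  suffice. From a point outside the ball the claim is immediate, the barrier being maximal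
  there.\<close>

lemma barrier_heat_upper_bound:
  obtains C where "0 \<le> C"
    "\<And>(x :: 'a::euclidean_space) M r e. brownian_law x M \<Longrightarrow> 0 \<le> r \<Longrightarrow> 0 < e \<Longrightarrow> e \<le> 1 \<Longrightarrow>
      (\<integral>w. barrier \<eta> j A c R r (w e) \<partial>M)
        \<le> barrier \<eta> j A c R r x + e * laplacian_barrier \<eta> j A c R r x + C * (e * sqrt e)"
proof -
  obtain K where K: "0 \<le> K"
    "\<And>a u. 0 \<le> a \<Longrightarrow> a \<le> A \<Longrightarrow> u \<le> 1 \<Longrightarrow> \<bar>profile' \<eta> j a u\<bar> \<le> K"
    "\<And>a u. 0 \<le> a \<Longrightarrow> a \<le> A \<Longrightarrow> u \<le> 1 \<Longrightarrow> \<bar>profile'' \<eta> j a u\<bar> \<le> K"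
    "\<And>a u. 0 \<le> a \<Longrightarrow> a \<le> A \<Longrightarrow> u \<le> 1 \<Longrightarrow> \<bar>profile''' \<eta> j a u\<bar> \<le> K"
    using profile_derivatives_bounded[OF \<eta>] by blast
  define d where "d = real DIM('a)"
  have d: "0 \<le> d" by (simp add: d_def)
  define M2 M3 where "M2 = d ^ (2 * 2 + 1) * (fact (2 * 2) / (2 ^ 2 * fact 2))"
    and "M3 = d ^ (2 * 3 + 1) * (fact (2 * 3) / (2 ^ 3 * fact 3))"
  have M23: "0 \<le> M2" "0 \<le> M3" using d by (auto simp: M2_def M3_def)
  \<comment> \<open>Coefficients of the third, fourth and sixth powers of the norm of the increment
    in the Taylor error.\<close>
  define \<alpha> \<beta> \<gamma> where "\<alpha> = 2 * K * R / R ^ 4 + 32 * K * R ^ 3 / R ^ 6"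
    and "\<beta> = K / (2 * R ^ 4)" and "\<gamma> = 4 * K / R ^ 6"
  have abc: "0 \<le> \<alpha>" "0 \<le> \<beta>" "0 \<le> \<gamma>" using K(1) R by (auto simp: \<alpha>_def \<beta>_def \<gamma>_def)
  define C where "C = \<alpha> * ((d + M2) / 2) + \<beta> * M2 + \<gamma> * M3"
  have C: "0 \<le> C" using abc M23 d by (simp add: C_def)
  show thesis
  proof (rule that[OF C])
    fix x :: 'a and M and r e :: real
    assume bm: "brownian_law x M" and r: "0 \<le> r" and e: "0 < e" "e \<le> 1"
    interpret prob_space M by (rule brownian_prob_space[OF bm])
    let ?b = "barrier \<eta> j A c R r"
    have int: "integrable M (\<lambda>w. ?b (w e))"
      by (rule integrable_const_bound[of _ "1 / \<eta>"])
        (use e measurable_brownian[OF bm _ measurable_barrier[of r], of e] in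
          \<open>auto intro!: AE_I2 simp: abs_of_nonneg barrier_bounds[OF r] simp del: divide_le_eq_1\<close>)
    show "(\<integral>w. ?b (w e) \<partial>M) \<le> ?b x + e * laplacian_barrier \<eta> j A c R r x + C * (e * sqrt e)"
    proof (cases "norm x \<le> R")
      case False
      have "(\<integral>w. ?b (w e) \<partial>M) \<le> (\<integral>w. 1 / \<eta> \<partial>M)"
        by (rule integral_mono[OF int]) (use barrier_bounds[OF r] in auto)
      also have "\<dots> = ?b x" using barrier_outside(1)[of x r] False by (simp add: prob_space)
      finally have "(\<integral>w. ?b (w e) \<partial>M) \<le> ?b x" .
      moreover have "0 \<le> C * (e * sqrt e)" using C e by simp
      ultimately show ?thesis using barrier_outside(2)[of x r] False by simp
    next
      case x: True
      define a where "a = A * exp (- (c * r))"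
      have a: "0 \<le> a" "a \<le> A" using weight_bounds[OF r] by (auto simp: a_def)
      define U where "U = 1 - (norm x)\<^sup>2 / R\<^sup>2"
      have U: "U \<le> 1" by (simp add: U_def)
      define f1 f2 where "f1 = profile' \<eta> j a U" and "f2 = profile'' \<eta> j a U"
      have f2: "\<bar>f2\<bar> \<le> K" using K(3)[OF a U] by (simp add: f2_def)
      \<comment> \<open>A dominating function with a computable expectation: its terms up to the one
        with \<open>f2\<close> average exactly to the barrier plus \<open>e\<close> times half its
        Laplacian, and the remaining ones are of order e^(3/2) or smaller.\<close>
      define B where "B w = ?b x - f1 / R\<^sup>2 * (2 * ((w e - x) \<bullet> x) + (norm (w e - x))\<^sup>2)
          + 2 * f2 / R ^ 4 * ((w e - x) \<bullet> x)\<^sup>2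
          + \<alpha> * ((sqrt e * (norm (w e - x))\<^sup>2 + norm (w e - x) ^ (2 * 2) / sqrt e) / 2)
          + \<beta> * norm (w e - x) ^ (2 * 2) + \<gamma> * norm (w e - x) ^ (2 * 3)" for w :: "real \<Rightarrow> 'a"
      have le: "?b (w e) \<le> B w" for w
      proof -
        define Y where "Y = w e - x"
        define y where "y = norm Y"
        define p where "p = Y \<bullet> x"
        define V where "V = 1 - (norm (w e))\<^sup>2 / R\<^sup>2"
        have y: "0 \<le> y" by (simp add: y_def)
        have p: "\<bar>p\<bar> \<le> R * y"
        proof -
          have "\<bar>p\<bar> \<le> norm Y * norm x" unfolding p_def by (rule Cauchy_Schwarz_ineq2)
          also have "\<dots> \<le> norm Y * R" using x by (intro mult_left_mono) auto
          finally show ?thesis by (simp add: y_def mult.commute)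
        qed
        have "(norm (w e))\<^sup>2 = (norm x)\<^sup>2 + 2 * p + y\<^sup>2"
          unfolding p_def y_def Y_def power2_norm_eq_inner by (simp add: inner_diff_left inner_diff_right inner_commute)
        then have VU: "V - U = - (2 * p + y\<^sup>2) / R\<^sup>2"
          by (simp add: V_def U_def diff_divide_distrib add_divide_distrib)
        have bw: "?b (w e) = profile \<eta> j a V" and bx: "?b x = profile \<eta> j a U"
          by (simp_all add: barrier_def a_def V_def U_def)
        have V: "V \<le> 1" by (simp add: V_def)
        have taylor: "?b (w e) \<le> ?b x + f1 * (V - U) + f2 / 2 * (V - U)\<^sup>2 + K * \<bar>V - U\<bar> ^ 3"
          unfolding bw bx f1_def f2_def
          by (rule profile_taylor[OF \<eta> a(1) j U V]) (rule K(4)[OF a])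
        have sq: "f2 / 2 * (V - U)\<^sup>2 \<le> 2 * f2 / R ^ 4 * p\<^sup>2 + K / 2 * (4 * R * y ^ 3 + y ^ 4) / R ^ 4"
        proof -
          \<comment> \<open>Of the squared increment of u only the square of the linear part
            \<open>2 * p\<close> is of order \<open>e\<close>; the other terms go into the
            error.\<close>
          have eq: "f2 / 2 * (V - U)\<^sup>2 = 2 * f2 / R ^ 4 * p\<^sup>2 + (f2 * (4 * p * y\<^sup>2 + y ^ 4)) / (2 * R ^ 4)"
            unfolding VU using R by (simp add: field_simps eval_nat_numeral)
          have "f2 * (4 * p * y\<^sup>2 + y ^ 4) \<le> K * (4 * R * y ^ 3 + y ^ 4)"
          proof -
            have "f2 * (4 * p * y\<^sup>2 + y ^ 4) \<le> \<bar>f2\<bar> * \<bar>4 * p * y\<^sup>2 + y ^ 4\<bar>"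
              by (metis abs_ge_self abs_mult)
            also have "\<dots> \<le> K * (4 * R * y ^ 3 + y ^ 4)"
            proof (rule mult_mono[OF f2])
              have "\<bar>4 * p * y\<^sup>2 + y ^ 4\<bar> \<le> 4 * \<bar>p\<bar> * y\<^sup>2 + y ^ 4"
                using abs_triangle_ineq[of "4 * p * y\<^sup>2" "y ^ 4"] y by (simp add: abs_mult)
              also have "\<dots> \<le> 4 * (R * y) * y\<^sup>2 + y ^ 4"
                using p by (intro add_right_mono mult_right_mono mult_left_mono) auto
              finally show "\<bar>4 * p * y\<^sup>2 + y ^ 4\<bar> \<le> 4 * R * y ^ 3 + y ^ 4"
                by (simp add: eval_nat_numeral mult.assoc)
            qed (use K(1) in auto)
            finally show ?thesis .
          qed
          then have "(f2 * (4 * p * y\<^sup>2 + y ^ 4)) / (2 * R ^ 4) \<le> K * (4 * R * y ^ 3 + y ^ 4) / (2 * R ^ 4)"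
            using R by (intro divide_right_mono) auto
          moreover have "K / 2 * (4 * R * y ^ 3 + y ^ 4) / R ^ 4 = K * (4 * R * y ^ 3 + y ^ 4) / (2 * R ^ 4)" by simp
          ultimately show ?thesis unfolding eq by (metis add_left_mono)
        qed
        have cube: "K * \<bar>V - U\<bar> ^ 3 \<le> K * (4 * (8 * R ^ 3 * y ^ 3 + y ^ 6)) / R ^ 6"
        proof -
          have "\<bar>V - U\<bar> \<le> (2 * (R * y) + y\<^sup>2) / R\<^sup>2"
          proof -
            have "\<bar>2 * p + y\<^sup>2\<bar> \<le> 2 * (R * y) + y\<^sup>2" using p zero_le_power2[of y] by linarith
            then show ?thesis unfolding VU using R by (simp add: divide_right_mono)
          qed
          then have "\<bar>V - U\<bar> ^ 3 \<le> ((2 * (R * y) + y\<^sup>2) / R\<^sup>2) ^ 3"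
            by (rule power_mono) simp
          also have "\<dots> = (2 * (R * y) + y\<^sup>2) ^ 3 / R ^ 6"
            by (simp add: power_divide flip: power_mult)
          also have "\<dots> \<le> 4 * (8 * R ^ 3 * y ^ 3 + y ^ 6) / R ^ 6"
          proof (rule divide_right_mono)
            have cube_le: "(s + t) ^ 3 \<le> 4 * (s ^ 3 + t ^ 3)" if "0 \<le> s" "0 \<le> t" for s t :: real
            proof -
              have "4 * (s ^ 3 + t ^ 3) - (s + t) ^ 3 = 3 * (s + t) * (s - t)\<^sup>2"
                by (simp add: eval_nat_numeral algebra_simps)
              also have "\<dots> \<ge> 0" using that by simp
              finally show ?thesis by simp
            qed
            have "(2 * (R * y) + y\<^sup>2) ^ 3 \<le> 4 * ((2 * (R * y)) ^ 3 + (y\<^sup>2) ^ 3)"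
              using R y by (intro cube_le) auto
            then show "(2 * (R * y) + y\<^sup>2) ^ 3 \<le> 4 * (8 * R ^ 3 * y ^ 3 + y ^ 6)"
              by (simp add: power_mult_distrib flip: power_mult)
          qed simp
          finally show ?thesis using K(1) mult_left_mono by fastforce
        qed
        \<comment> \<open>The weight \<open>sqrt e\<close> matches the size of a Brownian increment
          over time \<open>e\<close>: the odd third moment is exchanged for even ones without losing
          the order e^(3/2).\<close>
        have y3: "y ^ 3 \<le> (sqrt e * y\<^sup>2 + y ^ (2 * 2) / sqrt e) / 2"
        proof -
          have "0 \<le> y\<^sup>2 * (sqrt e - y)\<^sup>2 / sqrt e" using e by simp
          also have "\<dots> = sqrt e * y\<^sup>2 + y ^ (2 * 2) / sqrt e - 2 * y ^ 3"
            using e by (simp add: field_simps eval_nat_numeral)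
          finally show ?thesis by simp
        qed
        have "?b (w e) \<le> ?b x + f1 * (V - U) + (2 * f2 / R ^ 4 * p\<^sup>2 + K / 2 * (4 * R * y ^ 3 + y ^ 4) / R ^ 4)
            + K * (4 * (8 * R ^ 3 * y ^ 3 + y ^ 6)) / R ^ 6"
          using taylor sq cube by linarith
        also have "\<dots> = ?b x - f1 / R\<^sup>2 * (2 * p + y\<^sup>2) + 2 * f2 / R ^ 4 * p\<^sup>2
            + \<alpha> * y ^ 3 + \<beta> * y ^ 4 + \<gamma> * y ^ 6"
        proof -
          have 1: "f1 * (V - U) = - (f1 / R\<^sup>2 * (2 * p + y\<^sup>2))"
            unfolding VU minus_divide_left[symmetric] by simp
          have 2: "K / 2 * (4 * R * y ^ 3 + y ^ 4) / R ^ 4 = 2 * K * R / R ^ 4 * y ^ 3 + \<beta> * y ^ 4"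
            by (simp add: \<beta>_def add_divide_distrib distrib_left)
          have 3: "K * (4 * (8 * R ^ 3 * y ^ 3 + y ^ 6)) / R ^ 6 = 32 * K * R ^ 3 / R ^ 6 * y ^ 3 + \<gamma> * y ^ 6"
            by (simp add: \<gamma>_def add_divide_distrib distrib_left mult_ac)
          have 4: "\<alpha> * y ^ 3 = 2 * K * R / R ^ 4 * y ^ 3 + 32 * K * R ^ 3 / R ^ 6 * y ^ 3"
            unfolding \<alpha>_def by (rule distrib_right)
          show ?thesis unfolding 1 2 3 4 by simp
        qed
        also have "\<dots> \<le> ?b x - f1 / R\<^sup>2 * (2 * p + y\<^sup>2) + 2 * f2 / R ^ 4 * p\<^sup>2
            + \<alpha> * ((sqrt e * y\<^sup>2 + y ^ (2 * 2) / sqrt e) / 2) + \<beta> * y ^ (2 * 2) + \<gamma> * y ^ (2 * 3)"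
          using mult_left_mono[OF y3 abc(1)] by simp
        finally show ?thesis by (simp add: B_def Y_def y_def p_def)
      qed
      have lin: "has_bochner_integral M (\<lambda>w. (w e - x) \<bullet> x) 0"
        by (rule brownian_linear_moment[OF bm e(1)])
      have quad: "has_bochner_integral M (\<lambda>w. ((w e - x) \<bullet> x)\<^sup>2) (e * (norm x)\<^sup>2)"
        by (rule brownian_quadratic_moment[OF bm e(1)])
      have sq: "has_bochner_integral M (\<lambda>w. (norm (w e - x))\<^sup>2) (d * e)"
        unfolding d_def by (rule brownian_norm_square_moment[OF bm e(1)])
      define m2 m3 where "m2 = (\<integral>w. norm (w e - x) ^ (2 * 2) \<partial>M)" and "m3 = (\<integral>w. norm (w e - x) ^ (2 * 3) \<partial>M)"
      have four: "has_bochner_integral M (\<lambda>w. norm (w e - x) ^ (2 * 2)) m2"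
        and six: "has_bochner_integral M (\<lambda>w. norm (w e - x) ^ (2 * 3)) m3"
        unfolding m2_def m3_def by (rule has_bochner_integral_integrable, rule brownian_norm_moment(1)[OF bm e(1)])+
      have m: "m2 \<le> M2 * e ^ 2" "m3 \<le> M3 * e ^ 3"
        using brownian_norm_moment(2)[OF bm e(1), of 2] brownian_norm_moment(2)[OF bm e(1), of 3]
        unfolding m2_def m3_def M2_def M3_def d_def by auto
      have const: "has_bochner_integral M (\<lambda>w. ?b x) (?b x)"
        by (simp add: has_bochner_integral_iff prob_space)
      have Bint: "has_bochner_integral M B
          (?b x - f1 / R\<^sup>2 * (2 * 0 + d * e) + 2 * f2 / R ^ 4 * (e * (norm x)\<^sup>2)
          + \<alpha> * ((sqrt e * (d * e) + m2 / sqrt e) / 2) + \<beta> * m2 + \<gamma> * m3)"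
        unfolding B_def[abs_def]
        by (intro has_bochner_integral_add has_bochner_integral_diff has_bochner_integral_mult_right
            has_bochner_integral_divide_zero const lin quad sq four six)
      have "(\<integral>w. ?b (w e) \<partial>M) \<le> (\<integral>w. B w \<partial>M)"
        using Bint le by (intro integral_mono[OF int]) (auto simp: has_bochner_integral_iff)
      also have "\<dots> = ?b x - f1 / R\<^sup>2 * (2 * 0 + d * e) + 2 * f2 / R ^ 4 * (e * (norm x)\<^sup>2)
          + \<alpha> * ((sqrt e * (d * e) + m2 / sqrt e) / 2) + \<beta> * m2 + \<gamma> * m3"
        using Bint by (simp add: has_bochner_integral_iff)
      also have "\<dots> \<le> ?b x - f1 / R\<^sup>2 * (d * e) + 2 * f2 / R ^ 4 * (e * (norm x)\<^sup>2)
          + \<alpha> * ((d + M2) / 2 * (e * sqrt e)) + \<beta> * (M2 * (e * sqrt e)) + \<gamma> * (M3 * (e * sqrt e))"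
      proof -
        have se: "e \<le> sqrt e" using e by (simp add: real_le_rsqrt power2_eq_square mult_left_le)
        have e2: "e ^ 2 \<le> e * sqrt e" using se e by (simp add: power2_eq_square)
        have e3: "e ^ 3 \<le> e * sqrt e"
          using e2 e by (intro order_trans[OF _ e2]) (simp add: power_decreasing)
        have "m2 / sqrt e \<le> M2 * e ^ 2 / sqrt e" using m(1) e by (intro divide_right_mono) auto
        also have "\<dots> = M2 * (e * sqrt e)"
        proof -
          have "e ^ 2 / sqrt e = e * (e / sqrt e)" by (simp add: power2_eq_square)
          also have "e / sqrt e = sqrt e" using e by (simp add: real_div_sqrt)
          finally show ?thesis by (metis times_divide_eq_right)
        qed
        finally have "d * (e * sqrt e) + m2 / sqrt e \<le> d * (e * sqrt e) + M2 * (e * sqrt e)"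
          by (rule add_left_mono)
        then have "sqrt e * (d * e) + m2 / sqrt e \<le> (d + M2) * (e * sqrt e)"
          by (simp only: distrib_left distrib_right mult_ac)
        then have 1: "(sqrt e * (d * e) + m2 / sqrt e) / 2 \<le> (d + M2) / 2 * (e * sqrt e)"
          unfolding times_divide_eq_left by (rule divide_right_mono) simp
        have 2: "m2 \<le> M2 * (e * sqrt e)" using m(1) mult_left_mono[OF e2 M23(1)] by linarith
        have 3: "m3 \<le> M3 * (e * sqrt e)" using m(2) mult_left_mono[OF e3 M23(2)] by linarith
        have "2 * 0 + d * e = d * e" by simp
        then show ?thesis
          by (simp only:) (intro add_mono order.refl mult_left_mono 1 2 3 abc)
      qed
      also have "\<dots> = ?b x + e * laplacian_barrier \<eta> j A c R r x + C * (e * sqrt e)"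
        unfolding laplacian_barrier_def C_def a_def[symmetric] U_def[symmetric] f1_def[symmetric] f2_def[symmetric] d_def[symmetric]
        by (simp add: algebra_simps)
      finally show ?thesis .
    qed
  qed
qed

end

context barrier_parameters
begin

text \<open>
  A first-order expansion of the mild equation over one short time step, uniform in the starting time; the
  errors are of order \<open>e powr (3/2)\<close>, hence negligible after summing over the \<open>1/e\<close> steps. The additive
  constant \<open>a\<close> carries the errors of the earlier steps. This replaces a comparison principle.
\<close>
lemma barrier_one_step:
  fixes W :: "'a::euclidean_space \<Rightarrow> (real \<Rightarrow> 'a) measure" and \<Psi> :: "'a \<Rightarrow> real \<Rightarrow> real" and \<Phi> :: "real \<Rightarrow> real"
  assumes W: "\<And>x. brownian_law x (W x)"
    and \<Psi>_nonneg: "\<And>x u. 0 \<le> u \<Longrightarrow> 0 \<le> \<Psi> x u"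
    and \<Psi>_bound: "\<And>B. \<exists>D. \<forall>x u. 0 \<le> u \<and> u \<le> B \<longrightarrow> \<Psi> x u \<le> D"
    and \<Psi>_meas: "(\<lambda>(x, u). \<Psi> x (max 0 u)) \<in> borel_measurable (borel \<Otimes>\<^sub>M borel)"
    and \<Phi>_mono: "\<And>u v. 0 \<le> u \<Longrightarrow> u \<le> v \<Longrightarrow> \<Phi> u \<le> \<Phi> v"
    and \<Phi>_lip: "\<And>B. \<exists>D\<ge>0. \<forall>u v. 0 \<le> u \<longrightarrow> u \<le> v \<longrightarrow> v \<le> B \<longrightarrow> \<Phi> v - \<Phi> u \<le> D * (v - u)"
    and b: "0 \<le> b" and lower: "\<And>x u. norm x \<le> R \<Longrightarrow> 0 \<le> u \<Longrightarrow> b * \<Phi> u \<le> \<Psi> x u"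
    and super: "\<And>t x. 0 \<le> t \<Longrightarrow> norm x \<le> R \<Longrightarrow>
      defect_barrier \<eta> j A c R t (x :: 'a) \<le> b * \<Phi> (barrier \<eta> j A c R t x)"
  obtains C where "0 \<le> C"
    "\<And>r a e v x. 0 \<le> r \<Longrightarrow> 0 \<le> a \<Longrightarrow> a \<le> 1 \<Longrightarrow> 0 < e \<Longrightarrow> e \<le> 1 \<Longrightarrow>
      mild_solution W \<Psi> (\<lambda>x. barrier \<eta> j A c R r x + a) v \<Longrightarrow>
      v x e \<le> barrier \<eta> j A c R (r + e) x + a + C * (e * sqrt e)"
proof -
  let ?b = "barrier \<eta> j A c R" and ?N = "defect_barrier \<eta> j A c R"
  obtain C1 where C1: "0 \<le> C1"
    "\<And>(x :: 'a) M r e. brownian_law x M \<Longrightarrow> 0 \<le> r \<Longrightarrow> 0 < e \<Longrightarrow> e \<le> 1 \<Longrightarrow>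
      (\<integral>w. ?b r (w e) \<partial>M) \<le> ?b r x + e * laplacian_barrier \<eta> j A c R r x + C1 * (e * sqrt e)"
    using barrier_heat_upper_bound by blast
  obtain L where L: "0 \<le> L"
    "\<And>t x y. 0 \<le> t \<Longrightarrow> \<bar>?b t x - ?b t (y::'a)\<bar> \<le> L * norm (x - y)"
    "\<And>t x y. 0 \<le> t \<Longrightarrow> \<bar>?N t x - ?N t (y::'a)\<bar> \<le> L * norm (x - y)"
    using barrier_lipschitz by blast
  \<comment> \<open>An upper bound on the initial value, the barrier plus \<open>a\<close> with
    \<open>a \<le> 1\<close>, and hence on \<open>v\<close>.\<close>
  define B where "B = 1 / \<eta> + 1"
  obtain D0 where D0: "\<And>x u. 0 \<le> u \<Longrightarrow> u \<le> B \<Longrightarrow> \<Psi> x u \<le> D0"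
    using \<Psi>_bound[of B] by blast
  define D where "D = max 0 D0"
  have D: "0 \<le> D" "\<And>x u. 0 \<le> u \<Longrightarrow> u \<le> B \<Longrightarrow> \<Psi> x u \<le> D"
    using D0 by (auto simp: D_def intro: max.coboundedI2)
  obtain E where E: "0 \<le> E" "\<And>u v. 0 \<le> u \<Longrightarrow> u \<le> v \<Longrightarrow> v \<le> B \<Longrightarrow> \<Phi> v - \<Phi> u \<le> E * (v - u)"
    using \<Phi>_lip[of B] by blast
  define d where "d = 1 + real DIM('a)"
  have d: "0 \<le> d" by (simp add: d_def)
  define C2 where "C2 = L * d + D"
  have C2: "0 \<le> C2" using L D d by (simp add: C2_def)
  define C where "C = C1 + 3 * c\<^sup>2 / \<eta> + (b * E * C2 + L * d)"
  have C: "0 \<le> C" unfolding C_def using C1(1) \<eta> b E(1) C2 L(1) d by (intro add_nonneg_nonneg) auto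
  show thesis
  proof (rule that[OF C])
    fix r a e :: real and v and x :: 'a
    assume r: "0 \<le> r" and a: "0 \<le> a" "a \<le> 1" and e: "0 < e" "e \<le> 1"
      and mild: "mild_solution W \<Psi> (\<lambda>x. ?b r x + a) v"
    note v = mild[unfolded mild_solution_def]
    have v_meas: "(\<lambda>(x, t). v x t) \<in> borel_measurable (borel \<Otimes>\<^sub>M restrict_space borel {0..})"
      using v by blast
    have v_nonneg: "0 \<le> v y t" if "0 \<le> t" for y t using v that by blast
    have v_eq: "v y t = (\<integral>w. ?b r (w t) + a \<partial>W y)
        - (\<integral>w. (\<integral>s\<in>{0..t}. \<Psi> (w s) (v (w s) (t - s)) \<partial>lborel) \<partial>W y)" if "0 \<le> t" for y t
      using v that by blast
    have prob: "prob_space (W y)" for y by (rule brownian_prob_space[OF W])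
    have b_abs: "\<bar>?b r y\<bar> \<le> 1 / \<eta>" for y :: 'a using barrier_bounds[OF r, of y] by simp
    have b_int: "integrable (W y) (\<lambda>w. ?b r (w t))" and
      b_low: "?b r y - L * d * sqrt t \<le> (\<integral>w. ?b r (w t) \<partial>W y)" if "0 \<le> t" for y t
      using brownian_lipschitz_lower_bound[OF W that measurable_barrier b_abs L(1) L(2)[OF r], of y]
      by (auto simp: d_def)
    have b_shift: "(\<integral>w. ?b r (w t) + a \<partial>W y) = (\<integral>w. ?b r (w t) \<partial>W y) + a" if "0 \<le> t" for y t
    proof -
      interpret prob_space "W y" by (rule prob)
      show ?thesis using b_int[OF that, of y] by (simp add: prob_space)
    qed
    have v_le: "v y t \<le> B" if t: "0 \<le> t" for y t
    proof -
      interpret prob_space "W y" by (rule prob)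
      have "0 \<le> (\<integral>w. (\<integral>s\<in>{0..t}. \<Psi> (w s) (v (w s) (t - s)) \<partial>lborel) \<partial>W y)"
        unfolding set_lebesgue_integral_def
        by (intro Bochner_Integration.integral_nonneg) (auto simp: indicator_def intro!: \<Psi>_nonneg v_nonneg)
      moreover have "(\<integral>w. ?b r (w t) \<partial>W y) \<le> (\<integral>w. 1 / \<eta> \<partial>W y)"
        by (rule integral_mono[OF b_int[OF t]]) (use barrier_bounds[OF r] in auto)
      ultimately show ?thesis
        unfolding v_eq[OF t] b_shift[OF t] B_def using a by (simp add: prob_space)
    qed
    have \<Psi>v: "0 \<le> \<Psi> y (v z t)" "\<Psi> y (v z t) \<le> D" if "0 \<le> t" for y z t
      using \<Psi>_nonneg v_nonneg[OF that] v_le[OF that] D(2) by auto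
    have inner_le: "(\<integral>s\<in>{0..t}. \<Psi> (w s) (v (w s) (t - s)) \<partial>lborel) \<le> D * t" if t: "0 \<le> t" for w :: "real \<Rightarrow> 'a" and t
    proof -
      have "(\<integral>s\<in>{0..t}. \<Psi> (w s) (v (w s) (t - s)) \<partial>lborel) \<le> (\<integral>s. indicator {0..t} s * D \<partial>lborel)"
        unfolding set_lebesgue_integral_def
      proof (rule integral_mono')
        show "integrable lborel (\<lambda>s. indicator {0..t} s * D)"
          using t by (intro integrable_mult_left integrable_real_indicator) auto
      qed (auto simp: indicator_def intro!: \<Psi>v D(1))
      also have "\<dots> = D * t" using t by simp
      finally show ?thesis .
    qed
    \<comment> \<open>A crude lower bound, off by order \<open>sqrt t\<close>. Put back into the
      reaction term and integrated over the step, it costs only order e^(3/2). The constant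
      \<open>a\<close> only raises \<open>v\<close> and is dropped.\<close>
    have v_low: "?b r y - C2 * sqrt t \<le> v y t" if t: "0 \<le> t" "t \<le> 1" for y t
    proof -
      interpret prob_space "W y" by (rule prob)
      have "(\<integral>w. (\<integral>s\<in>{0..t}. \<Psi> (w s) (v (w s) (t - s)) \<partial>lborel) \<partial>W y) \<le> (\<integral>w. D * t \<partial>W y)"
        by (rule integral_mono') (use inner_le[OF t(1)] D(1) t(1) in auto)
      also have "\<dots> = D * t" by (simp add: prob_space)
      also have "\<dots> \<le> D * sqrt t"
        using t D(1) by (intro mult_left_mono real_le_rsqrt) (auto simp: power2_eq_square mult_left_le)
      finally show ?thesis
        unfolding v_eq[OF t(1)] b_shift[OF t(1)] C2_def using b_low[OF t(1), of y] a
        by (simp add: algebra_simps)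
    qed
    \<comment> \<open>Outside the ball the defect is 0 and nonnegativity of \<open>\<Psi>\<close>
      suffices; inside, the supersolution inequality replaces the reaction at the barrier by the
      defect.\<close>
    have \<Psi>_low: "?N r y - b * E * C2 * sqrt e \<le> \<Psi> y (v y t)" if t: "0 \<le> t" "t \<le> e" for y t
    proof (cases "norm y \<le> R")
      case False
      have "0 \<le> b * E * C2 * sqrt e" using b E(1) C2 e by simp
      then show ?thesis
        using barrier_outside(4)[of y r] False \<Psi>v(1)[OF t(1), of y y] by simp
    next
      case True
      have "\<Phi> (?b r y) - E * (C2 * sqrt e) \<le> \<Phi> (v y t)"
      proof (cases "?b r y \<le> v y t")
        case True
        then have "\<Phi> (?b r y) \<le> \<Phi> (v y t)" using barrier_bounds(1)[OF r] by (intro \<Phi>_mono)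
        moreover have "0 \<le> E * (C2 * sqrt e)" using E(1) C2 e by simp
        ultimately show ?thesis by linarith
      next
        case False
        have bB: "?b r y \<le> B" using barrier_bounds(2)[OF r, of y] by (simp add: B_def)
        have "\<Phi> (?b r y) - \<Phi> (v y t) \<le> E * (?b r y - v y t)"
          by (rule E(2)) (use False v_nonneg[OF t(1)] bB in auto)
        also have "\<dots> \<le> E * (C2 * sqrt e)"
        proof (rule mult_left_mono[OF _ E(1)])
          have "C2 * sqrt t \<le> C2 * sqrt e" using t C2 by (intro mult_left_mono) auto
          then show "?b r y - v y t \<le> C2 * sqrt e" using v_low[OF t(1), of y] t e by linarith
        qed
        finally show ?thesis by simp
      qed
      then have "b * (\<Phi> (?b r y) - E * (C2 * sqrt e)) \<le> b * \<Phi> (v y t)" using b by (rule mult_left_mono)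
      also have "\<dots> \<le> \<Psi> y (v y t)" by (rule lower[OF True v_nonneg[OF t(1)]])
      finally show ?thesis using super[OF r True] by (simp add: algebra_simps)
    qed
    define M where "M = W x"
    interpret prob_space M unfolding M_def by (rule prob)
    define h where "h = (\<lambda>w s. indicator {0..e} s * \<Psi> (w s) (v (w s) (e - s)))"
    define N where "N = (\<lambda>w s. indicator {0..e} s * (?N r (w s) - b * E * C2 * sqrt e))"
    have proc: "(\<lambda>z. fst z (max 0 (snd z))) \<in> M \<Otimes>\<^sub>M (borel :: real measure) \<rightarrow>\<^sub>M (borel :: 'a measure)"
      using measurable_wiener_process brownian_sets[OF W, of x]
      by (simp add: M_def cong: measurable_cong_sets sets_pair_measure_cong)
    have h_meas: "case_prod h \<in> borel_measurable (M \<Otimes>\<^sub>M lborel)"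
    proof -
      \<comment> \<open>Times and values are clipped at 0 so that the measurability of
        \<open>v\<close> and \<open>\<Psi>\<close>, known only on half-lines, composes on the whole
        product space; for times in \<open>{0..e}\<close> the clipping changes nothing.\<close>
      have m1: "(\<lambda>z. max 0 (e - snd z)) \<in> M \<Otimes>\<^sub>M (borel :: real measure) \<rightarrow>\<^sub>M restrict_space borel {0..}"
        by (rule measurable_restrict_space2) auto
      have m2: "(\<lambda>z. v (fst z (max 0 (snd z))) (max 0 (e - snd z))) \<in> M \<Otimes>\<^sub>M (borel :: real measure) \<rightarrow>\<^sub>M borel"
        using measurable_compose[OF measurable_Pair[OF proc m1] v_meas] by simp
      have m3: "(\<lambda>z. \<Psi> (fst z (max 0 (snd z))) (max 0 (v (fst z (max 0 (snd z))) (max 0 (e - snd z)))))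
          \<in> M \<Otimes>\<^sub>M (borel :: real measure) \<rightarrow>\<^sub>M borel"
        using measurable_compose[OF measurable_Pair[OF proc m2] \<Psi>_meas] by simp
      have "(\<lambda>z. indicator {0..e} (snd z) * \<Psi> (fst z (max 0 (snd z))) (max 0 (v (fst z (max 0 (snd z))) (max 0 (e - snd z)))))
          \<in> M \<Otimes>\<^sub>M (borel :: real measure) \<rightarrow>\<^sub>M (borel :: real measure)"
        using m3 by (intro borel_measurable_times) auto
      moreover have "case_prod h = (\<lambda>z. indicator {0..e} (snd z) * \<Psi> (fst z (max 0 (snd z))) (max 0 (v (fst z (max 0 (snd z))) (max 0 (e - snd z)))))"
        unfolding h_def by (auto simp: fun_eq_iff indicator_def max_def v_nonneg antisym)
      ultimately show ?thesis
        by (simp cong: measurable_cong_sets sets_pair_measure_cong)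
    qed
    interpret P: pair_sigma_finite M lborel ..
    have h_int: "integrable (M \<Otimes>\<^sub>M lborel) (case_prod h)"
    proof (rule Bochner_Integration.integrable_bound[OF _ h_meas])
      have "emeasure (M \<Otimes>\<^sub>M lborel) (space M \<times> {0..e}) = ennreal e"
        using e by (subst lborel.emeasure_pair_measure_Times) (auto simp: emeasure_space_1)
      then show "integrable (M \<Otimes>\<^sub>M lborel) (\<lambda>z. D * indicator (space M \<times> {0..e}) z)"
        by (intro integrable_mult_right integrable_real_indicator) (auto intro!: pair_measureI)
      show "AE z in M \<Otimes>\<^sub>M lborel. norm (case_prod h z) \<le> norm (D * indicator (space M \<times> {0..e}) z)"
        using D(1) by (intro AE_I2) (auto simp: h_def indicator_def space_pair_measure \<Psi>v)
    qed
    have "(\<integral>w. (\<integral>s\<in>{0..e}. \<Psi> (w s) (v (w s) (e - s)) \<partial>lborel) \<partial>W x) = (\<integral>w. (\<integral>s. h w s \<partial>lborel) \<partial>M)"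
      by (simp add: M_def h_def set_lebesgue_integral_def)
    \<comment> \<open>After the exchange, the Lipschitz lower bound for Brownian expectations can be
      applied at each fixed time \<open>s \<le> e\<close>.\<close>
    also have "\<dots> = (\<integral>s. (\<integral>w. h w s \<partial>M) \<partial>lborel)"
      by (rule P.Fubini_integral[OF h_int, symmetric])
    also have "\<dots> \<ge> (\<integral>s. indicator {0..e} s * (?N r x - (b * E * C2 + L * d) * sqrt e) \<partial>lborel)"
    proof (rule integral_mono)
      show "integrable lborel (\<lambda>s. \<integral>w. h w s \<partial>M)"
        using P.integrable_snd[OF h_int] .
      show "integrable lborel (\<lambda>s. indicator {0..e} s * (?N r x - (b * E * C2 + L * d) * sqrt e))"
        using e by (intro integrable_mult_left integrable_real_indicator) auto
      fix s :: real
      show "indicator {0..e} s * (?N r x - (b * E * C2 + L * d) * sqrt e) \<le> (\<integral>w. h w s \<partial>M)"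
      proof (cases "s \<in> {0..e}")
        case False
        then show ?thesis by (simp add: h_def)
      next
        case True
        then have s: "0 \<le> s" "s \<le> e" by auto
        have BN: "\<bar>?N r y\<bar> \<le> L * (R + R)" for y :: 'a
        proof (cases "norm y \<le> R")
          case True
          \<comment> \<open>The defect vanishes on the sphere of radius \<open>R\<close>, which is
            within distance \<open>R + R\<close> of every point of the ball; so its Lipschitz
            constant also bounds its size.\<close>
          obtain z :: 'a where z: "norm z = R" using R vector_choose_size[of R] by auto
          have "\<bar>?N r y - ?N r z\<bar> \<le> L * norm (y - z)" by (rule L(3)[OF r])
          also have "\<dots> \<le> L * (R + R)"
            using norm_triangle_ineq4[of y z] True z L(1) by (intro mult_left_mono) auto
          finally show ?thesis using barrier_outside(4)[of z r] z by simp
        qed (use barrier_outside(4)[of y r] L(1) R in auto)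
        have N_int: "integrable M (\<lambda>w. ?N r (w s))"
          and N_low: "?N r x - L * d * sqrt s \<le> (\<integral>w. ?N r (w s) \<partial>M)"
          using brownian_lipschitz_lower_bound[OF W s(1) measurable_defect_barrier BN L(1) L(3)[OF r], of x]
          by (auto simp: M_def d_def)
        have h_s_meas: "(\<lambda>w. h w s) \<in> borel_measurable M"
          using measurable_compose[OF measurable_Pair2' h_meas, of s] by simp
        have hD: "\<bar>h w s\<bar> \<le> D" for w using \<Psi>v[of "e - s" "w s" "w s"] s D(1) by (simp add: h_def)
        have h_s: "integrable M (\<lambda>w. h w s)"
          by (rule integrable_const_bound[of _ D]) (use hD h_s_meas in auto)
        have "?N r x - L * d * sqrt e \<le> ?N r x - L * d * sqrt s"
          using s L(1) d by (intro diff_left_mono mult_left_mono) auto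
        also note N_low
        also have "(\<integral>w. ?N r (w s) \<partial>M) - b * E * C2 * sqrt e = (\<integral>w. ?N r (w s) - b * E * C2 * sqrt e \<partial>M)"
          using N_int by (simp add: prob_space)
        also have "\<dots> \<le> (\<integral>w. h w s \<partial>M)"
        proof (rule integral_mono[OF _ h_s])
          show "integrable M (\<lambda>w. ?N r (w s) - b * E * C2 * sqrt e)" using N_int by simp
          show "?N r (w s) - b * E * C2 * sqrt e \<le> h w s" for w
            using \<Psi>_low[of "e - s" "w s"] s by (simp add: h_def)
        qed
        finally show ?thesis using True by (simp add: algebra_simps)
      qed
    qed
    also have "(\<integral>s. indicator {0..e} s * (?N r x - (b * E * C2 + L * d) * sqrt e) \<partial>lborel)
        = e * (?N r x - (b * E * C2 + L * d) * sqrt e)"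
      using e by simp
    finally have reaction: "e * (?N r x - (b * E * C2 + L * d) * sqrt e)
        \<le> (\<integral>w. (\<integral>s\<in>{0..e}. \<Psi> (w s) (v (w s) (e - s)) \<partial>lborel) \<partial>W x)" .
    have time: "?b r x + e * time_barrier \<eta> j A c R r x - 3 * c\<^sup>2 / \<eta> * e\<^sup>2 \<le> ?b (r + e) x"
      using e by (intro barrier_time_taylor[OF r]) simp
    have "e\<^sup>2 \<le> e * sqrt e"
    proof -
      have "e \<le> sqrt e" using e by (simp add: real_le_rsqrt power2_eq_square mult_left_le)
      then show ?thesis using e by (simp add: power2_eq_square)
    qed
    then have e2: "3 * c\<^sup>2 / \<eta> * e\<^sup>2 \<le> 3 * c\<^sup>2 / \<eta> * (e * sqrt e)"
      using \<eta> by (intro mult_left_mono) auto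
    have "v x e = (\<integral>w. ?b r (w e) \<partial>W x) + a - (\<integral>w. (\<integral>s\<in>{0..e}. \<Psi> (w s) (v (w s) (e - s)) \<partial>lborel) \<partial>W x)"
      using e by (simp add: v_eq b_shift)
    also have "\<dots> \<le> (?b r x + e * laplacian_barrier \<eta> j A c R r x + C1 * (e * sqrt e)) + a
        - e * (?N r x - (b * E * C2 + L * d) * sqrt e)"
      using C1(2)[OF W r e, of x] reaction by linarith
    \<comment> \<open>Half the Laplacian minus the defect is the time derivative, which the
      expansion in time then absorbs into the barrier at \<open>r + e\<close>.\<close>
    also have "\<dots> = ?b r x + e * time_barrier \<eta> j A c R r x + a
        + (C1 + (b * E * C2 + L * d)) * (e * sqrt e)"
      by (simp add: defect_barrier_def algebra_simps)
    also have "\<dots> \<le> ?b (r + e) x + a + C * (e * sqrt e)"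
      using time e2 unfolding C_def by (simp add: algebra_simps)
    finally show "v x e \<le> ?b (r + e) x + a + C * (e * sqrt e)" .
  qed
qed

end

section \<open>The Markov property on path space\<close>

lemma space_finite_measures_borel [simp]: "space finite_measures_borel = finite_measures"
  unfolding finite_measures_borel_def by (simp add: space_measure_of_conv)

lemma measurable_integral_finite_measures:
  fixes f :: "'a::euclidean_space \<Rightarrow> real"
  assumes "continuous_on UNIV f" "bounded (range f)"
  shows "(\<lambda>\<mu>. \<integral>x. f x \<partial>\<mu>) \<in> borel_measurable finite_measures_borel"
proof (rule borel_measurableI)
  fix U :: "real set" assume "open U"
  have "openin weak_measure_topology {\<mu> \<in> finite_measures. (\<integral>x. f x \<partial>\<mu>) \<in> U}"
    unfolding weak_measure_topology_def
    by (rule topology_generated_by_Basis) (use assms \<open>open U\<close> in blast)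
  moreover have "{U. openin weak_measure_topology U} \<subseteq> Pow (finite_measures :: 'a measure set)"
    using openin_subset[of weak_measure_topology] by auto
  ultimately have "{\<mu> \<in> finite_measures. (\<integral>x. f x \<partial>\<mu>) \<in> U} \<in> sets finite_measures_borel"
    unfolding finite_measures_borel_def by (subst sets_measure_of) (auto intro: sigma_sets.Basic)
  also have "{\<mu> \<in> finite_measures. (\<integral>x. f x \<partial>\<mu>) \<in> U} = (\<lambda>\<mu>. \<integral>x. f x \<partial>\<mu>) -` U \<inter> space finite_measures_borel"
    by auto
  finally show "(\<lambda>\<mu>. \<integral>x. f x \<partial>\<mu>) -` U \<inter> space finite_measures_borel \<in> sets finite_measures_borel" .
qed

lemma skorokhod_paths:
  assumes "\<omega> \<in> space skorokhod_space"
  shows "cadlag \<omega>" and "0 \<le> s \<Longrightarrow> \<omega> s \<in> finite_measures"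
  using assms by (auto simp: skorokhod_space_def space_restrict_space space_PiM PiE_def Pi_def)

lemma measurable_skorokhod_coordinate:
  assumes "0 \<le> s"
  shows "(\<lambda>\<omega>. \<omega> s) \<in> skorokhod_space \<rightarrow>\<^sub>M finite_measures_borel"
  unfolding skorokhod_space_def
  by (rule measurable_restrict_space1, rule measurable_component_singleton) (use assms in simp)

lemma measurable_skorokhod_integral:
  fixes f :: "'a::euclidean_space \<Rightarrow> real"
  assumes "continuous_on UNIV f" "bounded (range f)" "0 \<le> s"
  shows "(\<lambda>\<omega>. \<integral>x. f x \<partial>\<omega> s) \<in> borel_measurable skorokhod_space"
  using measurable_compose[OF measurable_skorokhod_coordinate measurable_integral_finite_measures] assms by blast

lemma skorokhod_right_continuous:
  fixes f :: "'a::euclidean_space \<Rightarrow> real"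
  assumes \<omega>: "\<omega> \<in> space skorokhod_space" and t: "0 \<le> t"
    and f: "continuous_on UNIV f" "bounded (range f)"
  shows "((\<lambda>s. \<integral>x. f x \<partial>\<omega> s) \<longlongrightarrow> (\<integral>x. f x \<partial>\<omega> t)) (at_right t)"
proof (rule topological_tendstoI)
  fix U :: "real set" assume U: "open U" "(\<integral>x. f x \<partial>\<omega> t) \<in> U"
  have lim: "limitin weak_measure_topology \<omega> (\<omega> t) (at_right t)"
    using skorokhod_paths(1)[OF \<omega>] t by (auto simp: cadlag_def)
  have "openin weak_measure_topology {\<mu> \<in> finite_measures. (\<integral>x. f x \<partial>\<mu>) \<in> U}"
    unfolding weak_measure_topology_def
    by (rule topology_generated_by_Basis) (use f U in blast)
  moreover have "\<omega> t \<in> {\<mu> \<in> finite_measures. (\<integral>x. f x \<partial>\<mu>) \<in> U}"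
    using skorokhod_paths(2)[OF \<omega> t] U by simp
  ultimately have "\<forall>\<^sub>F s in at_right t. \<omega> s \<in> {\<mu> \<in> finite_measures. (\<integral>x. f x \<partial>\<mu>) \<in> U}"
    using lim unfolding limitin_def by blast
  then show "\<forall>\<^sub>F s in at_right t. (\<integral>x. f x \<partial>\<omega> s) \<in> U"
    by eventually_elim simp
qed

lemma cadlag_time_shift:
  assumes "cadlag \<omega>" "0 \<le> s"
  shows "cadlag (time_shift s \<omega>)"
  unfolding cadlag_def
proof (intro conjI allI impI)
  fix t :: real assume t: "0 \<le> t"
  have "limitin weak_measure_topology \<omega> (\<omega> (s + t)) (at_right (s + t))"
    using assms t by (auto simp: cadlag_def)
  moreover have "\<forall>\<^sub>F u in at_right t. time_shift s \<omega> u \<in> U"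
    if ev: "\<forall>\<^sub>F u in at_right (s + t). \<omega> u \<in> U" for U
  proof -
    obtain b where b: "s + t < b" "\<And>u. s + t < u \<Longrightarrow> u < b \<Longrightarrow> \<omega> u \<in> U"
      using ev unfolding eventually_at_right_field by blast
    show ?thesis unfolding eventually_at_right_field
    proof (intro exI[of _ "b - s"] conjI allI impI)
      show "t < b - s" using b(1) by simp
      fix u assume "t < u" "u < b - s"
      then show "time_shift s \<omega> u \<in> U" using b(2)[of "s + u"] t by (simp add: time_shift_def)
    qed
  qed
  ultimately show "limitin weak_measure_topology (time_shift s \<omega>) (time_shift s \<omega> t) (at_right t)"
    using t by (auto simp: limitin_def time_shift_def)
next
  fix t :: real assume t: "0 < t"
  then have "0 < s + t" using assms by simp
  then obtain \<nu> where "limitin weak_measure_topology \<omega> \<nu> (at_left (s + t))"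
    using assms unfolding cadlag_def by blast
  moreover have "\<forall>\<^sub>F u in at_left t. time_shift s \<omega> u \<in> U"
    if ev: "\<forall>\<^sub>F u in at_left (s + t). \<omega> u \<in> U" for U
  proof -
    obtain b where b: "b < s + t" "\<And>u. b < u \<Longrightarrow> u < s + t \<Longrightarrow> \<omega> u \<in> U"
      using ev unfolding eventually_at_left_field by blast
    show ?thesis unfolding eventually_at_left_field
    proof (intro exI[of _ "max 0 (b - s)"] conjI allI impI)
      show "max 0 (b - s) < t" using b(1) t by simp
      fix u assume "max 0 (b - s) < u" "u < t"
      then show "time_shift s \<omega> u \<in> U" using b(2)[of "s + u"] by (simp add: time_shift_def)
    qed
  qed
  ultimately show "\<exists>\<nu>. limitin weak_measure_topology (time_shift s \<omega>) \<nu> (at_left t)"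
    unfolding limitin_def by blast
qed

lemma measurable_time_shift:
  assumes s: "0 \<le> s"
  shows "time_shift s \<in> skorokhod_space \<rightarrow>\<^sub>M (skorokhod_space :: (real \<Rightarrow> 'a::euclidean_space measure) measure)"
proof -
  have "time_shift s \<in> (skorokhod_space :: (real \<Rightarrow> 'a measure) measure) \<rightarrow>\<^sub>M PiM {0..} (\<lambda>_. finite_measures_borel)"
    unfolding time_shift_def[abs_def]
    by (rule measurable_restrict) (use s in \<open>auto intro: measurable_skorokhod_coordinate\<close>)
  moreover have "cadlag (time_shift s \<omega>)" if "\<omega> \<in> space skorokhod_space" for \<omega> :: "real \<Rightarrow> 'a measure"
    by (rule cadlag_time_shift[OF skorokhod_paths(1)[OF that] s])
  ultimately show ?thesis
    by (subst (2) skorokhod_space_def) (rule measurable_restrict_space2, auto)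
qed

lemma finite_measure_of_finite_measures:
  assumes "\<mu> \<in> finite_measures" shows "finite_measure \<mu>" "sets \<mu> = sets borel"
  using assms by (auto simp: finite_measures_def)

lemma integrable_finite_measures:
  fixes f :: "'a::euclidean_space \<Rightarrow> real"
  assumes "\<mu> \<in> finite_measures" "f \<in> borel_measurable borel" "\<And>x. \<bar>f x\<bar> \<le> B"
  shows "integrable \<mu> f"
proof -
  interpret finite_measure \<mu> using assms(1) by (rule finite_measure_of_finite_measures)
  show ?thesis
    by (rule integrable_const_bound[of _ B])
      (use assms finite_measure_of_finite_measures(2)[OF assms(1)] in \<open>auto cong: measurable_cong_sets\<close>)
qed

section \<open>Laplace functionals of barriers under a Markov family\<close>

context
  fixes P :: "'a::euclidean_space measure \<Rightarrow> (real \<Rightarrow> 'a measure) measure"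
  assumes markov: "markov_family P"
begin

lemma markov_kernel: "P \<in> finite_measures_borel \<rightarrow>\<^sub>M prob_algebra skorokhod_space"
  using markov by (simp add: markov_family_def)

lemma markov_law:
  assumes "\<mu> \<in> finite_measures"
  shows "prob_space (P \<mu>)" "sets (P \<mu>) = sets skorokhod_space" "space (P \<mu>) = space skorokhod_space"
proof -
  have "P \<mu> \<in> space (prob_algebra skorokhod_space)"
    using measurable_space[OF markov_kernel] assms by simp
  then show "prob_space (P \<mu>)" and s: "sets (P \<mu>) = sets skorokhod_space"
    by (auto simp: space_prob_algebra)
  show "space (P \<mu>) = space skorokhod_space" using sets_eq_imp_space_eq[OF s] .
qed

lemma markov_start:
  assumes "\<mu> \<in> finite_measures" shows "AE \<omega> in P \<mu>. \<omega> 0 = \<mu>"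
  using markov assms by (simp add: markov_family_def)

lemma emeasure_time_shift:
  assumes \<mu>: "\<mu> \<in> finite_measures" and s: "0 \<le> s" and B: "B \<in> sets skorokhod_space"
  shows "emeasure (P \<mu>) {\<omega> \<in> space skorokhod_space. time_shift s \<omega> \<in> B} = (\<integral>\<^sup>+\<omega>. emeasure (P (\<omega> s)) B \<partial>P \<mu>)"
proof -
  have past: "space skorokhod_space \<in> sets (past s)"
    using sets.top[of "past s"] by (simp add: past_def)
  have "emeasure (P \<mu>) {\<omega> \<in> space skorokhod_space. time_shift s \<omega> \<in> B}
      = (\<integral>\<^sup>+\<omega>\<in>space skorokhod_space. emeasure (P (\<omega> s)) B \<partial>P \<mu>)"
    using markov \<mu> s past B unfolding markov_family_def by blast
  also have "\<dots> = (\<integral>\<^sup>+\<omega>. emeasure (P (\<omega> s)) B \<partial>P \<mu>)"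
    by (intro nn_integral_cong) (simp add: markov_law(3)[OF \<mu>])
  finally show ?thesis .
qed

text \<open>The Markov property is given for events; identifying the law of the shifted path with
  the mixture of the laws started from the state at time \<open>s\<close> extends it to
  integrals.\<close>

lemma nn_integral_time_shift:
  assumes \<mu>: "\<mu> \<in> finite_measures" and s: "0 \<le> s" and g: "g \<in> borel_measurable skorokhod_space"
  shows "(\<integral>\<^sup>+\<omega>. g (time_shift s \<omega>) \<partial>P \<mu>) = (\<integral>\<^sup>+\<omega>. (\<integral>\<^sup>+\<omega>'. g \<omega>' \<partial>P (\<omega> s)) \<partial>P \<mu>)"
proof -
  interpret prob_space "P \<mu>" by (rule markov_law[OF \<mu>])
  have shift: "time_shift s \<in> P \<mu> \<rightarrow>\<^sub>M skorokhod_space"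
    using measurable_time_shift[OF s] measurable_cong_sets[OF markov_law(2)[OF \<mu>] refl] by blast
  have "(\<lambda>\<omega>. P (\<omega> s)) \<in> skorokhod_space \<rightarrow>\<^sub>M subprob_algebra skorokhod_space"
    using measurable_compose[OF measurable_skorokhod_coordinate[OF s] markov_kernel]
    by (rule measurable_prob_algebraD)
  then have K: "(\<lambda>\<omega>. P (\<omega> s)) \<in> P \<mu> \<rightarrow>\<^sub>M subprob_algebra skorokhod_space"
    using measurable_cong_sets[OF markov_law(2)[OF \<mu>] refl] by blast
  have "distr (P \<mu>) skorokhod_space (time_shift s) = P \<mu> \<bind> (\<lambda>\<omega>. P (\<omega> s))"
  proof (rule measure_eqI)
    show "sets (distr (P \<mu>) skorokhod_space (time_shift s)) = sets (P \<mu> \<bind> (\<lambda>\<omega>. P (\<omega> s)))"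
      unfolding sets_distr by (rule sets_bind[OF sets_kernel[OF K] not_empty, symmetric])
    fix B assume "B \<in> sets (distr (P \<mu>) skorokhod_space (time_shift s))"
    then have B: "B \<in> sets skorokhod_space" by simp
    have "emeasure (distr (P \<mu>) skorokhod_space (time_shift s)) B
        = emeasure (P \<mu>) {\<omega> \<in> space skorokhod_space. time_shift s \<omega> \<in> B}"
      by (subst emeasure_distr[OF shift B]) (auto intro!: arg_cong[where f="emeasure (P \<mu>)"] simp: markov_law(3)[OF \<mu>])
    also have "\<dots> = (\<integral>\<^sup>+\<omega>. emeasure (P (\<omega> s)) B \<partial>P \<mu>)"
      by (rule emeasure_time_shift[OF \<mu> s B])
    also have "\<dots> = emeasure (P \<mu> \<bind> (\<lambda>\<omega>. P (\<omega> s))) B"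
      by (rule emeasure_bind[OF not_empty K B, symmetric])
    finally show "emeasure (distr (P \<mu>) skorokhod_space (time_shift s)) B = emeasure (P \<mu> \<bind> (\<lambda>\<omega>. P (\<omega> s))) B" .
  qed
  then have "(\<integral>\<^sup>+\<omega>. g \<omega> \<partial>distr (P \<mu>) skorokhod_space (time_shift s)) = (\<integral>\<^sup>+\<omega>. g \<omega> \<partial>(P \<mu> \<bind> (\<lambda>\<omega>. P (\<omega> s))))"
    by simp
  then show ?thesis
    using g by (simp add: nn_integral_distr[OF shift] nn_integral_bind[OF g K])
qed

lemma measurable_markov_law: "\<mu> \<in> finite_measures \<Longrightarrow> measurable (P \<mu>) N = measurable skorokhod_space N"
  by (rule measurable_cong_sets[OF markov_law(2) refl])

context
  fixes b :: "real \<Rightarrow> 'a \<Rightarrow> real" and C B :: real and \<Psi> W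
  assumes sbm: "super_brownian_motion W \<Psi> P"
    and b_cont: "\<And>r. 0 \<le> r \<Longrightarrow> continuous_on UNIV (b r)"
    and b_bounds: "\<And>r x. 0 \<le> r \<Longrightarrow> 0 \<le> b r x" "\<And>r x. 0 \<le> r \<Longrightarrow> b r x \<le> B"
    and C: "0 \<le> C"
    and one_step: "\<And>r a e v x. 0 \<le> r \<Longrightarrow> 0 \<le> a \<Longrightarrow> a \<le> 1 \<Longrightarrow> 0 < e \<Longrightarrow> e \<le> 1 \<Longrightarrow>
      mild_solution W \<Psi> (\<lambda>x. b r x + a) v \<Longrightarrow> v x e \<le> b (r + e) x + a + C * (e * sqrt e)"
begin

lemma supersolution_bounded: "0 \<le> r \<Longrightarrow> bounded (range (\<lambda>x. b r x + a))"
  unfolding bounded_iff using b_bounds by (intro exI[of _ "B + \<bar>a\<bar>"]) (auto intro!: abs_leI add_mono; smt (verit) b_bounds)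

lemma supersolution_integrable:
  assumes "\<mu> \<in> finite_measures" "0 \<le> r" shows "integrable \<mu> (\<lambda>x. b r x + a)"
proof -
  interpret finite_measure \<mu> using assms(1) by (rule finite_measure_of_finite_measures)
  have "integrable \<mu> (b r)"
    by (rule integrable_finite_measures[OF assms(1) borel_measurable_continuous_onI[OF b_cont[OF assms(2)]], of B])
      (use b_bounds[OF assms(2)] in auto)
  then show ?thesis by simp
qed

text \<open>The Laplace functional turns an upper bound on the solution \<open>v\<close> into a
  lower bound on an expectation.\<close>

lemma supersolution_laplace_one_step:
  assumes \<mu>: "\<mu> \<in> finite_measures" and r: "0 \<le> r" and a: "0 \<le> a" "a \<le> 1" and e: "0 < e" "e \<le> 1"
  shows "ennreal (exp (- (\<integral>x. b (r + e) x + (a + C * (e * sqrt e)) \<partial>\<mu>)))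
    \<le> (\<integral>\<^sup>+\<omega>. ennreal (exp (- (\<integral>x. b r x + a \<partial>\<omega> e))) \<partial>P \<mu>)"
proof -
  interpret prob_space "P \<mu>" by (rule markov_law[OF \<mu>])
  have cont: "continuous_on UNIV (\<lambda>x. b r x + a)" using b_cont[OF r] by (intro continuous_intros)
  have "(\<lambda>x. b r x + a) \<in> borel_measurable borel" by (rule borel_measurable_continuous_onI[OF cont])
  moreover have "bounded (range (\<lambda>x. b r x + a)) \<and> (\<forall>x. 0 \<le> b r x + a)"
    using supersolution_bounded[OF r] b_bounds[OF r] a by simp
  ultimately obtain v where v: "unique_mild_solution W \<Psi> (\<lambda>x. b r x + a) v"
    and lap: "\<forall>\<mu>\<in>finite_measures. \<forall>t\<ge>0.
      (\<integral>\<omega>. exp (- (\<integral>x. b r x + a \<partial>\<omega> t)) \<partial>P \<mu>) = exp (- (\<integral>x. v x t \<partial>\<mu>))"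
    using sbm unfolding super_brownian_motion_def by blast
  have mild: "mild_solution W \<Psi> (\<lambda>x. b r x + a) v" using v by (simp add: unique_mild_solution_def)
  have "(\<integral>x. v x e \<partial>\<mu>) \<le> (\<integral>x. b (r + e) x + (a + C * (e * sqrt e)) \<partial>\<mu>)"
  \<comment> \<open>This rule asks for integrability of the larger function only, so the
    integrability of \<open>v\<close> does not have to be settled.\<close>
  proof (rule integral_mono')
    show "integrable \<mu> (\<lambda>x. b (r + e) x + (a + C * (e * sqrt e)))"
      using r e by (intro supersolution_integrable[OF \<mu>]) auto
    show "v x e \<le> b (r + e) x + (a + C * (e * sqrt e))" for x
      using one_step[OF r a e mild, of x] by simp
    show "0 \<le> b (r + e) x + (a + C * (e * sqrt e))" for x
      using b_bounds(1)[of "r + e" x] r e a C by simp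
  qed
  then have "exp (- (\<integral>x. b (r + e) x + (a + C * (e * sqrt e)) \<partial>\<mu>)) \<le> (\<integral>\<omega>. exp (- (\<integral>x. b r x + a \<partial>\<omega> e)) \<partial>P \<mu>)"
    using lap \<mu> e by simp
  also have "ennreal (\<integral>\<omega>. exp (- (\<integral>x. b r x + a \<partial>\<omega> e)) \<partial>P \<mu>) = (\<integral>\<^sup>+\<omega>. ennreal (exp (- (\<integral>x. b r x + a \<partial>\<omega> e))) \<partial>P \<mu>)"
  proof (rule nn_integral_eq_integral[symmetric])
    have "(\<lambda>\<omega>. exp (- (\<integral>x. b r x + a \<partial>\<omega> e))) \<in> borel_measurable (P \<mu>)"
      unfolding measurable_markov_law[OF \<mu>]
      using e by (intro measurable_compose[OF measurable_skorokhod_integral[OF cont supersolution_bounded[OF r], of e],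
          of "\<lambda>y. exp (- y)"]) auto
    moreover have "0 \<le> (\<integral>x. b r x + a \<partial>\<omega> e)" for \<omega>
      using b_bounds(1)[OF r] a by (intro Bochner_Integration.integral_nonneg) simp
    ultimately show "integrable (P \<mu>) (\<lambda>\<omega>. exp (- (\<integral>x. b r x + a \<partial>\<omega> e)))"
      by (intro integrable_const_bound[of _ 1]) auto
  qed simp
  finally show ?thesis by (simp add: ennreal_leI)
qed

text \<open>The induction peels off the first step: it is taken with the barrier already advanced by
  \<open>real i * e\<close> and with the error of the other steps as additive constant, and the
  state at time \<open>e\<close> is then handed to the induction hypothesis. The bound 1 keeps that
  constant in the range of the one-step estimate.\<close>

lemma supersolution_laplace_steps:
  assumes r: "0 \<le> r" and e: "0 < e" "e \<le> 1"
  shows "\<mu> \<in> finite_measures \<Longrightarrow> real i * (C * (e * sqrt e)) \<le> 1 \<Longrightarrow>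
    ennreal (exp (- (\<integral>x. b (r + real i * e) x + real i * (C * (e * sqrt e)) \<partial>\<mu>)))
      \<le> (\<integral>\<^sup>+\<omega>. ennreal (exp (- (\<integral>x. b r x \<partial>\<omega> (real i * e)))) \<partial>P \<mu>)"
proof (induction i arbitrary: \<mu>)
  case 0
  interpret prob_space "P \<mu>" by (rule markov_law) fact
  have "(\<integral>\<^sup>+\<omega>. ennreal (exp (- (\<integral>x. b r x \<partial>\<omega> 0))) \<partial>P \<mu>) = (\<integral>\<^sup>+\<omega>. ennreal (exp (- (\<integral>x. b r x \<partial>\<mu>))) \<partial>P \<mu>)"
    by (rule nn_integral_cong_AE) (use markov_start[OF 0(1)] in auto)
  then show ?case by (simp add: emeasure_space_1)
next
  case (Suc i)
  let ?c = "C * (e * sqrt e)" let ?a = "real i * ?c"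
  have c: "0 \<le> ?c" using C e by simp
  have "?a \<le> real (Suc i) * ?c" using c by (intro mult_right_mono) auto
  then have a: "0 \<le> ?a" "?a \<le> 1" using c Suc.prems(2) by auto
  have ri: "0 \<le> r + real i * e" using r e by simp
  have g: "(\<lambda>\<omega>. ennreal (exp (- (\<integral>x. b r x \<partial>\<omega> (real i * e))))) \<in> borel_measurable skorokhod_space"
    using measurable_skorokhod_integral[OF b_cont[OF r], of "real i * e"] supersolution_bounded[OF r, of 0] e by simp
  have "ennreal (exp (- (\<integral>x. b (r + real (Suc i) * e) x + real (Suc i) * ?c \<partial>\<mu>)))
      = ennreal (exp (- (\<integral>x. b ((r + real i * e) + e) x + (?a + ?c) \<partial>\<mu>)))"
    by (simp add: algebra_simps)
  also have "\<dots> \<le> (\<integral>\<^sup>+\<omega>. ennreal (exp (- (\<integral>x. b (r + real i * e) x + ?a \<partial>\<omega> e))) \<partial>P \<mu>)"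
    by (rule supersolution_laplace_one_step[OF Suc.prems(1) ri a e])
  also have "\<dots> \<le> (\<integral>\<^sup>+\<omega>. (\<integral>\<^sup>+\<omega>'. ennreal (exp (- (\<integral>x. b r x \<partial>\<omega>' (real i * e)))) \<partial>P (\<omega> e)) \<partial>P \<mu>)"
  proof (rule nn_integral_mono)
    fix \<omega> assume "\<omega> \<in> space (P \<mu>)"
    then have "\<omega> e \<in> finite_measures"
      using skorokhod_paths(2)[of \<omega> e] e markov_law(3)[OF Suc.prems(1)] by simp
    then show "ennreal (exp (- (\<integral>x. b (r + real i * e) x + ?a \<partial>\<omega> e)))
        \<le> (\<integral>\<^sup>+\<omega>'. ennreal (exp (- (\<integral>x. b r x \<partial>\<omega>' (real i * e)))) \<partial>P (\<omega> e))"
      using a(2) by (rule Suc.IH)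
  qed
  also have "\<dots> = (\<integral>\<^sup>+\<omega>. ennreal (exp (- (\<integral>x. b r x \<partial>time_shift e \<omega> (real i * e)))) \<partial>P \<mu>)"
    using e by (intro nn_integral_time_shift[OF Suc.prems(1) _ g, symmetric]) simp
  also have "\<dots> = (\<integral>\<^sup>+\<omega>. ennreal (exp (- (\<integral>x. b r x \<partial>\<omega> (real (Suc i) * e)))) \<partial>P \<mu>)"
    using e by (simp add: time_shift_def algebra_simps)
  finally show ?case .
qed

text \<open>With \<open>n\<close> steps of length \<open>h / n\<close> the errors add up to
  \<open>C * h * sqrt (h / n)\<close> times the mass of \<open>\<mu>\<close>, which vanishes as
  \<open>n\<close> grows. This is the submartingale inequality between two times.\<close>

lemma supersolution_laplace:
  assumes \<mu>: "\<mu> \<in> finite_measures" and r: "0 \<le> r" and h: "0 < h"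
  shows "ennreal (exp (- (\<integral>x. b (r + h) x \<partial>\<mu>))) \<le> (\<integral>\<^sup>+\<omega>. ennreal (exp (- (\<integral>x. b r x \<partial>\<omega> h))) \<partial>P \<mu>)"
proof -
  interpret \<mu>: finite_measure \<mu> using \<mu> by (rule finite_measure_of_finite_measures)
  define s where "s n = C * h * sqrt (h / real n)" for n :: nat
  have "(\<lambda>n. C * h * sqrt (h * inverse (real n))) \<longlonglongrightarrow> C * h * sqrt (h * 0)"
    by (intro tendsto_intros lim_inverse_n)
  then have s0: "s \<longlonglongrightarrow> 0" by (simp add: s_def[abs_def] divide_inverse)
  have int: "integrable \<mu> (\<lambda>x. b (r + h) x)" using supersolution_integrable[OF \<mu>, of "r + h" 0] r h by simp
  have lim: "(\<lambda>n. ennreal (exp (- ((\<integral>x. b (r + h) x \<partial>\<mu>) + s n * measure \<mu> (space \<mu>)))))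
      \<longlonglongrightarrow> ennreal (exp (- ((\<integral>x. b (r + h) x \<partial>\<mu>) + 0 * measure \<mu> (space \<mu>))))"
    by (intro tendsto_intros s0)
  have "\<forall>\<^sub>F n in sequentially. ennreal (exp (- ((\<integral>x. b (r + h) x \<partial>\<mu>) + s n * measure \<mu> (space \<mu>))))
      \<le> (\<integral>\<^sup>+\<omega>. ennreal (exp (- (\<integral>x. b r x \<partial>\<omega> h))) \<partial>P \<mu>)"
  proof -
    have "\<forall>\<^sub>F n in sequentially. s n < 1" by (rule order_tendstoD[OF s0]) simp
    moreover have "\<forall>\<^sub>F n in sequentially. max 1 h \<le> real n"
      using eventually_ge_at_top[of "nat \<lceil>max 1 h\<rceil>"] by eventually_elim linarith
    ultimately show ?thesis
    proof eventually_elim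
      fix n assume n: "s n < 1" "max 1 h \<le> real n"
      define e where "e = h / real n"
      have e: "0 < e" "e \<le> 1" "real n * e = h" using n h by (auto simp: e_def)
      have sn: "real n * (C * (e * sqrt e)) = s n"
        unfolding s_def e_def[symmetric] using e(3) by (metis mult.assoc mult.commute)
      have "ennreal (exp (- (\<integral>x. b (r + h) x + s n \<partial>\<mu>))) \<le> (\<integral>\<^sup>+\<omega>. ennreal (exp (- (\<integral>x. b r x \<partial>\<omega> h))) \<partial>P \<mu>)"
        using supersolution_laplace_steps[OF r e(1,2) \<mu>, of n] n by (simp add: sn e(3))
      also have "(\<integral>x. b (r + h) x + s n \<partial>\<mu>) = (\<integral>x. b (r + h) x \<partial>\<mu>) + s n * measure \<mu> (space \<mu>)"
        using int by simp
      finally show "ennreal (exp (- ((\<integral>x. b (r + h) x \<partial>\<mu>) + s n * measure \<mu> (space \<mu>))))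
        \<le> (\<integral>\<^sup>+\<omega>. ennreal (exp (- (\<integral>x. b r x \<partial>\<omega> h))) \<partial>P \<mu>)" .
    qed
  qed
  from tendsto_upperbound[OF lim this] show ?thesis by simp
qed

end

end

section \<open>Exit from a ball\<close>

text \<open>
  A continuous stand-in for the indicator of the complement of \<open>cball 0 R\<close>: its integrals are measurable and
  right-continuous along cadlag paths, and they vanish exactly when there is no mass outside the ball.
\<close>
definition exit_cutoff :: "real \<Rightarrow> 'a::euclidean_space \<Rightarrow> real" where
  "exit_cutoff R x = max 0 (min 1 (norm x - R))"

lemma exit_cutoff_bounds: "0 \<le> exit_cutoff R x" "exit_cutoff R x \<le> 1"
  by (auto simp: exit_cutoff_def)

lemma exit_cutoff_eq_0_iff: "exit_cutoff R x = 0 \<longleftrightarrow> norm x \<le> R"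
  by (auto simp: exit_cutoff_def max_def min_def)

lemma continuous_on_exit_cutoff: "continuous_on UNIV (exit_cutoff R)"
  unfolding exit_cutoff_def[abs_def] by (intro continuous_intros)

lemma bounded_exit_cutoff: "bounded (range (exit_cutoff R))"
  unfolding bounded_iff by (intro exI[of _ 1]) (auto simp: exit_cutoff_bounds abs_of_nonneg)

lemma integrable_exit_cutoff:
  assumes "\<mu> \<in> finite_measures" shows "integrable \<mu> (exit_cutoff R)"
  by (rule integrable_finite_measures[OF assms borel_measurable_continuous_onI[OF continuous_on_exit_cutoff], of _ 1])
    (simp add: exit_cutoff_bounds abs_of_nonneg)

text \<open>The complement of the support is the union of all open null sets. By Lindelof a
  countable subfamily has the same union, so the complement is null and the measure is carried by
  its support.\<close>

lemma integral_exit_cutoff_eq_0_iff: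
  fixes \<mu> :: "'a::euclidean_space measure"
  assumes \<mu>: "\<mu> \<in> finite_measures"
  shows "(\<integral>x. exit_cutoff R x \<partial>\<mu>) = 0 \<longleftrightarrow> measure_support \<mu> \<subseteq> cball 0 R"
proof -
  have sets: "sets \<mu> = sets borel" using \<mu> by (rule finite_measure_of_finite_measures)
  have space: "space \<mu> = UNIV" using sets_eq_imp_space_eq[OF sets] by simp
  have "(\<integral>x. exit_cutoff R x \<partial>\<mu>) = 0 \<longleftrightarrow> (AE x in \<mu>. exit_cutoff R x = 0)"
    by (rule integral_nonneg_eq_0_iff_AE[OF integrable_exit_cutoff[OF \<mu>]]) (simp add: exit_cutoff_bounds)
  also have "\<dots> \<longleftrightarrow> (AE x in \<mu>. x \<in> cball 0 R)"
    by (simp add: exit_cutoff_eq_0_iff)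
  also have "\<dots> \<longleftrightarrow> measure_support \<mu> \<subseteq> cball 0 R"
  proof
    assume ae: "AE x in \<mu>. x \<in> cball 0 R"
    show "measure_support \<mu> \<subseteq> cball 0 R"
    proof (rule ccontr)
      assume "\<not> measure_support \<mu> \<subseteq> cball 0 R"
      then obtain x where x: "x \<in> measure_support \<mu>" "x \<in> - cball 0 R" by blast
      have "0 < emeasure \<mu> (- cball 0 R)"
        using x unfolding measure_support_def by (auto simp: open_Compl)
      moreover have "emeasure \<mu> {y \<in> space \<mu>. \<not> y \<in> cball 0 R} = 0"
        using ae by (subst (asm) AE_iff_measurable[OF _ refl]) (auto simp: sets space)
      moreover have "{y \<in> space \<mu>. \<not> y \<in> cball 0 R} = - cball 0 R" by (auto simp: space)
      ultimately show False by simp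
    qed
  next
    assume sub: "measure_support \<mu> \<subseteq> cball 0 R"
    define F where "F = {U. open U \<and> emeasure \<mu> U = 0}"
    obtain F' where F': "F' \<subseteq> F" "countable F'" "\<Union>F' = \<Union>F"
      using Lindelof[of F] by (auto simp: F_def)
    have "\<Union>F' \<in> null_sets \<mu>"
    proof -
      have "(\<Union>U\<in>F'. U) \<in> null_sets \<mu>"
        by (rule null_sets_UN'[OF F'(2)]) (use F'(1) in \<open>auto simp: F_def null_sets_def sets\<close>)
      then show ?thesis by simp
    qed
    then have "AE x in \<mu>. x \<notin> \<Union>F'" by (rule AE_not_in)
    then show "AE x in \<mu>. x \<in> cball 0 R"
    proof eventually_elim
      fix x assume "x \<notin> \<Union>F'"
      then have "x \<in> measure_support \<mu>"
        unfolding F'(3) by (auto simp: F_def measure_support_def zero_less_iff_neq_zero)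
      then show "x \<in> cball 0 R" using sub by blast
    qed
  qed
  finally show ?thesis .
qed

definition no_exit_event :: "real \<Rightarrow> real \<Rightarrow> (real \<Rightarrow> 'a::euclidean_space measure) set" where
  "no_exit_event t R = {\<omega> \<in> space skorokhod_space. \<forall>s\<in>{0..t}. (\<integral>x. exit_cutoff R x \<partial>\<omega> s) = 0}"

text \<open>Time 0 is among the \<open>i + 1\<close> grid times, so that prefixing one step turns
  the event for \<open>i\<close> into the event for \<open>Suc i\<close>.\<close>

definition grid_event :: "nat \<Rightarrow> real \<Rightarrow> real \<Rightarrow> (real \<Rightarrow> 'a::euclidean_space measure) set" where
  "grid_event i h R = {\<omega> \<in> space skorokhod_space. \<forall>j\<in>{..i}. (\<integral>x. exit_cutoff R x \<partial>\<omega> (real j * h)) = 0}"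

lemma sets_grid_event:
  assumes "0 \<le> h"
  shows "(grid_event i h R :: (real \<Rightarrow> 'a::euclidean_space measure) set) \<in> sets skorokhod_space"
  unfolding grid_event_def
proof (rule sets.sets_Collect_finite_All)
  fix j
  have "(\<lambda>\<omega>. \<integral>x. exit_cutoff R x \<partial>\<omega> (real j * h)) \<in> borel_measurable (skorokhod_space :: (real \<Rightarrow> 'a measure) measure)"
    using assms by (intro measurable_skorokhod_integral continuous_on_exit_cutoff bounded_exit_cutoff) simp
  then show "{\<omega> \<in> space (skorokhod_space :: (real \<Rightarrow> 'a measure) measure). (\<integral>x. exit_cutoff R x \<partial>\<omega> (real j * h)) = 0} \<in> sets skorokhod_space"
    by measurable
qed simp

text \<open>By right-continuity, mass outside the ball at time s persists on an interval to the
  right of s, and a fine enough dyadic grid has a point there. This makes the event measurable and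
  approximates it by finitely many conditions.\<close>

lemma no_exit_event_eq_INT_grid_event:
  assumes t: "0 < t"
  shows "no_exit_event t R = (\<Inter>m. grid_event (2 ^ m) (t / 2 ^ m) (R :: real) :: (real \<Rightarrow> 'a::euclidean_space measure) set)"
proof (intro equalityI subsetI)
  fix \<omega> :: "real \<Rightarrow> 'a measure" assume \<omega>: "\<omega> \<in> no_exit_event t R"
  show "\<omega> \<in> (\<Inter>m. grid_event (2 ^ m) (t / 2 ^ m) R)"
  proof
    fix m
    have "real j * (t / 2 ^ m) \<in> {0..t}" if "j \<le> 2 ^ m" for j
    proof -
      have "real j \<le> 2 ^ m" using that by (metis of_nat_le_iff of_nat_numeral of_nat_power)
      then have "real j * t \<le> 2 ^ m * t" using t by simp
      then show ?thesis using t by (simp add: field_simps)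
    qed
    then show "\<omega> \<in> grid_event (2 ^ m) (t / 2 ^ m) R"
      using \<omega> by (auto simp: grid_event_def no_exit_event_def)
  qed
next
  fix \<omega> :: "real \<Rightarrow> 'a measure" assume \<omega>: "\<omega> \<in> (\<Inter>m. grid_event (2 ^ m) (t / 2 ^ m) R)"
  define I where "I s = (\<integral>x. exit_cutoff R x \<partial>\<omega> s)" for s
  have sp: "\<omega> \<in> space skorokhod_space" using \<omega> by (auto simp: grid_event_def)
  have grid: "I (real j * (t / 2 ^ m)) = 0" if "j \<le> 2 ^ m" for j m
    using \<omega> that by (auto simp: grid_event_def I_def)
  have "I s = 0" if s: "0 \<le> s" "s \<le> t" for s
  proof (cases "s = t")
    \<comment> \<open>The end point leaves no room in \<open>{0..t}\<close> to its right, but it is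
      itself a grid time.\<close>
    case True
    then show ?thesis using grid[of 1 0] by simp
  next
    case False
    then have st: "s < t" using s by simp
    show ?thesis
    proof (rule ccontr)
      assume "I s \<noteq> 0"
      moreover have "0 \<le> I s" unfolding I_def by (intro Bochner_Integration.integral_nonneg) (simp add: exit_cutoff_bounds)
      ultimately have "0 < I s" by simp
      moreover have "(I \<longlongrightarrow> I s) (at_right s)"
        unfolding I_def by (rule skorokhod_right_continuous[OF sp s(1) continuous_on_exit_cutoff bounded_exit_cutoff])
      ultimately have "\<forall>\<^sub>F u in at_right s. 0 < I u" by (simp add: order_tendstoD)
      then obtain b where b: "s < b" "\<And>u. s < u \<Longrightarrow> u < b \<Longrightarrow> 0 < I u"
        unfolding eventually_at_right_field by blast
      define g where "g = min b t - s"
      have g: "0 < g" using b st by (simp add: g_def)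
      obtain m where m: "t / g < 2 ^ m" using real_arch_pow[of 2 "t / g"] by auto
      then have hm: "t / 2 ^ m < g" using g by (simp add: field_simps)
      \<comment> \<open>Index of the first grid time strictly after \<open>s\<close>, hence within
        one mesh width of \<open>s\<close>.\<close>
      define j where "j = nat (\<lfloor>s * 2 ^ m / t\<rfloor> + 1)"
      have fl: "0 \<le> \<lfloor>s * 2 ^ m / t\<rfloor>" using s t by simp
      have "real j = of_int \<lfloor>s * 2 ^ m / t\<rfloor> + 1" using fl by (simp add: j_def)
      then have j: "s * 2 ^ m / t < real j" "real j \<le> s * 2 ^ m / t + 1" by linarith+
      have u1: "s < real j * (t / 2 ^ m)" using j(1) t by (simp add: field_simps)
      have "real j * (t / 2 ^ m) \<le> (s * 2 ^ m / t + 1) * (t / 2 ^ m)"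
        using j(2) t by (intro mult_right_mono) auto
      also have "\<dots> = s + t / 2 ^ m" using t by (simp add: field_simps)
      finally have u2: "real j * (t / 2 ^ m) < min b t" using hm unfolding g_def by linarith
      then have "real j * t < 2 ^ m * t" by (simp add: field_simps)
      then have "real j < 2 ^ m" using t by simp
      then have "j \<le> 2 ^ m" by (metis less_imp_le of_nat_less_iff of_nat_numeral of_nat_power)
      from grid[OF this] show False using b(2)[OF u1] u2 by simp
    qed
  qed
  then show "\<omega> \<in> no_exit_event t R" using sp by (simp add: no_exit_event_def I_def)
qed

lemma decseq_grid_event: "decseq (\<lambda>m. grid_event (2 ^ m) (t / 2 ^ m) R)"
proof (rule decseq_SucI, rule subsetI)
  fix m \<omega> assume \<omega>: "\<omega> \<in> grid_event (2 ^ Suc m) (t / 2 ^ Suc m) R"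
  show "\<omega> \<in> grid_event (2 ^ m) (t / 2 ^ m) R"
    unfolding grid_event_def
  proof (intro CollectI conjI ballI)
    show "\<omega> \<in> space skorokhod_space" using \<omega> by (simp add: grid_event_def)
    fix j :: nat assume "j \<in> {..2 ^ m}"
    then have "2 * j \<in> {..2 ^ Suc m}" by simp
    then have "(\<integral>x. exit_cutoff R x \<partial>\<omega> (real (2 * j) * (t / 2 ^ Suc m))) = 0"
      using \<omega> unfolding grid_event_def by blast
    then show "(\<integral>x. exit_cutoff R x \<partial>\<omega> (real j * (t / 2 ^ m))) = 0" by simp
  qed
qed

lemma sets_no_exit_event:
  assumes "0 < t" shows "(no_exit_event t R :: (real \<Rightarrow> 'a::euclidean_space measure) set) \<in> sets skorokhod_space"
  unfolding no_exit_event_eq_INT_grid_event[OF assms]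
  using assms by (intro sets.countable_INT') (auto intro!: sets_grid_event)

text \<open>Having compact closure means being contained in a ball of integer radius, so the event
  of the theorem is a countable union of measurable events.\<close>

lemma compact_support_event_eq:
  "{\<omega> \<in> space skorokhod_space. compact (closure (\<Union>s\<in>{0..t}. measure_support (\<omega> s)))}
    = (\<Union>n. no_exit_event t (real n) :: (real \<Rightarrow> 'a::euclidean_space measure) set)"
proof (intro equalityI subsetI)
  fix \<omega> :: "real \<Rightarrow> 'a measure"
  assume \<omega>: "\<omega> \<in> {\<omega> \<in> space skorokhod_space. compact (closure (\<Union>s\<in>{0..t}. measure_support (\<omega> s)))}"
  then have "bounded (\<Union>s\<in>{0..t}. measure_support (\<omega> s))"
    by (auto dest: compact_imp_bounded intro: bounded_subset closure_subset)
  then obtain B where B: "\<And>x. x \<in> (\<Union>s\<in>{0..t}. measure_support (\<omega> s)) \<Longrightarrow> norm x \<le> B"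
    by (auto simp: bounded_iff)
  obtain n :: nat where n: "B \<le> real n" using real_arch_simple by blast
  have "\<omega> \<in> no_exit_event t (real n)"
    unfolding no_exit_event_def
  proof (intro CollectI conjI ballI)
    show sp: "\<omega> \<in> space skorokhod_space" using \<omega> by simp
    fix s assume s: "s \<in> {0..t}"
    have "measure_support (\<omega> s) \<subseteq> cball 0 (real n)" using B s n by force
    then show "(\<integral>x. exit_cutoff (real n) x \<partial>\<omega> s) = 0"
      using integral_exit_cutoff_eq_0_iff[OF skorokhod_paths(2)[OF sp]] s by simp
  qed
  then show "\<omega> \<in> (\<Union>n. no_exit_event t (real n))" by blast
next
  fix \<omega> :: "real \<Rightarrow> 'a measure" assume "\<omega> \<in> (\<Union>n. no_exit_event t (real n))"
  then obtain n where \<omega>: "\<omega> \<in> no_exit_event t (real n)" by blast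
  have sp: "\<omega> \<in> space skorokhod_space" using \<omega> by (simp add: no_exit_event_def)
  have "measure_support (\<omega> s) \<subseteq> cball 0 (real n)" if "s \<in> {0..t}" for s
    using integral_exit_cutoff_eq_0_iff[OF skorokhod_paths(2)[OF sp]] that \<omega> by (auto simp: no_exit_event_def)
  then have "(\<Union>s\<in>{0..t}. measure_support (\<omega> s)) \<subseteq> cball 0 (real n)" by blast
  then have "bounded (\<Union>s\<in>{0..t}. measure_support (\<omega> s))" by (rule bounded_subset[OF bounded_cball])
  then show "\<omega> \<in> {\<omega> \<in> space skorokhod_space. compact (closure (\<Union>s\<in>{0..t}. measure_support (\<omega> s)))}"
    using sp by (simp add: compact_closure)
qed

lemma sets_compact_support_event:
  assumes "0 < t"
  shows "{\<omega> \<in> space skorokhod_space. compact (closure (\<Union>s\<in>{0..t}. measure_support (\<omega> s)))} \<in> sets (skorokhod_space :: (real \<Rightarrow> 'a::euclidean_space measure) measure)"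
  unfolding compact_support_event_eq using sets_no_exit_event[OF assms] by (intro sets.countable_UN) auto

section \<open>From barriers to exit probabilities, and from short times to all times\<close>

context
  fixes P :: "'a::euclidean_space measure \<Rightarrow> (real \<Rightarrow> 'a measure) measure"
  assumes markov: "markov_family P"
begin

context
  fixes w :: "nat \<Rightarrow> real \<Rightarrow> 'a \<Rightarrow> real" and R :: real
  assumes w_cont: "\<And>k r. 0 \<le> r \<Longrightarrow> continuous_on UNIV (w k r)"
    and w_nonneg: "\<And>k r x. 0 \<le> r \<Longrightarrow> 0 \<le> w k r x"
    and w_bound: "\<And>k. \<exists>B. \<forall>r\<ge>0. \<forall>x. w k r x \<le> B"
    and w_mono: "\<And>k r x. 0 \<le> r \<Longrightarrow> w k r x \<le> w (Suc k) r x"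
    and w_exit: "\<And>k r x. 0 \<le> r \<Longrightarrow> real k * exit_cutoff R x \<le> w k r x"
    and w_super: "\<And>k \<mu> r h. \<mu> \<in> finite_measures \<Longrightarrow> 0 \<le> r \<Longrightarrow> 0 < h \<Longrightarrow>
      ennreal (exp (- (\<integral>x. w k (r + h) x \<partial>\<mu>))) \<le> (\<integral>\<^sup>+\<omega>. ennreal (exp (- (\<integral>x. w k r x \<partial>\<omega> h))) \<partial>P \<mu>)"
begin

lemma bounded_w: "0 \<le> r \<Longrightarrow> bounded (range (w k r))"
proof -
  assume r: "0 \<le> r"
  obtain B where "\<And>x. w k r x \<le> B" using w_bound r by blast
  then show ?thesis unfolding bounded_iff using w_nonneg[OF r]
    by (intro exI[of _ B]) (auto simp: abs_of_nonneg)
qed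

lemma integrable_w:
  assumes "\<mu> \<in> finite_measures" "0 \<le> r" shows "integrable \<mu> (w k r)"
proof -
  obtain B where "\<And>x. w k r x \<le> B" using w_bound assms(2) by blast
  then show ?thesis
    by (intro integrable_finite_measures[OF assms(1) borel_measurable_continuous_onI[OF w_cont[OF assms(2)]], of _ B])
      (simp add: abs_of_nonneg w_nonneg[OF assms(2)])
qed

text \<open>Outside the ball \<open>w k\<close> grows at least linearly in \<open>k\<close>, so its
  integral diverges for a measure that charges the outside.\<close>

lemma INF_exp_integral_w_eq_0:
  assumes \<mu>: "\<mu> \<in> finite_measures" and r: "0 \<le> r" and exit: "(\<integral>x. exit_cutoff R x \<partial>\<mu>) \<noteq> 0"
  shows "(INF k. ennreal (exp (- (\<integral>x. w k r x \<partial>\<mu>)))) = 0"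
proof -
  define \<delta> where "\<delta> = (\<integral>x. exit_cutoff R x \<partial>\<mu>)"
  have "0 \<le> \<delta>" unfolding \<delta>_def by (intro Bochner_Integration.integral_nonneg) (simp add: exit_cutoff_bounds)
  with exit have \<delta>: "0 < \<delta>" by (simp add: \<delta>_def)
  have le: "ennreal (exp (- (\<integral>x. w k r x \<partial>\<mu>))) \<le> ennreal (exp (- (real k * \<delta>)))" for k
  proof -
    have "real k * \<delta> = (\<integral>x. real k * exit_cutoff R x \<partial>\<mu>)" by (simp add: \<delta>_def)
    also have "\<dots> \<le> (\<integral>x. w k r x \<partial>\<mu>)"
      using w_exit[OF r] integrable_exit_cutoff[OF \<mu>] by (intro integral_mono integrable_w \<mu> r) auto
    finally show ?thesis by (simp add: ennreal_leI)
  qed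
  have "(\<lambda>k. exp (- (real k * \<delta>))) \<longlonglongrightarrow> 0"
  proof -
    have "(\<lambda>k. exp (- \<delta>) ^ k) \<longlonglongrightarrow> 0" using \<delta> by (intro LIMSEQ_realpow_zero) auto
    then show ?thesis by (simp add: exp_of_nat_mult[symmetric])
  qed
  then have "(\<lambda>k. ennreal (exp (- (real k * \<delta>)))) \<longlonglongrightarrow> 0"
    using tendsto_ennrealI[of _ 0] by simp
  moreover have "(INF k. ennreal (exp (- (\<integral>x. w k r x \<partial>\<mu>)))) \<le> ennreal (exp (- (real k * \<delta>)))" for k
    using le by (rule INF_lower2[rotated]) simp
  ultimately have "(INF k. ennreal (exp (- (\<integral>x. w k r x \<partial>\<mu>)))) \<le> 0"
    by (intro tendsto_lowerbound[of "\<lambda>k. ennreal (exp (- (real k * \<delta>)))"]) auto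
  then show ?thesis by simp
qed

text \<open>
  The infimum over \<open>k\<close> is the Laplace functional of the barrier that is infinite outside the ball. It is
  \<open>0\<close> if \<open>\<mu>\<close> charges the outside, so that the induction may assume that \<open>\<mu>\<close> does not.
\<close>
lemma grid_event_lower_bound:
  assumes h: "0 < h"
  shows "\<mu> \<in> finite_measures \<Longrightarrow>
    (INF k. ennreal (exp (- (\<integral>x. w k (real i * h) x \<partial>\<mu>)))) \<le> emeasure (P \<mu>) (grid_event i h R)"
proof (induction i arbitrary: \<mu>)
  case 0
  interpret prob_space "P \<mu>" by (rule markov_law[OF markov 0])
  show ?case
  proof (cases "(\<integral>x. exit_cutoff R x \<partial>\<mu>) = 0")
    case True
    have "AE \<omega> in P \<mu>. \<omega> \<in> grid_event 0 h R"
      using markov_start[OF markov 0] AE_space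
      by eventually_elim (auto simp: grid_event_def True markov_law(3)[OF markov 0])
    then have "emeasure (P \<mu>) (grid_event 0 h R) = 1"
      using h by (intro emeasure_eq_1_AE) (auto simp: markov_law(2)[OF markov 0] sets_grid_event)
    moreover have "(INF k. ennreal (exp (- (\<integral>x. w k 0 x \<partial>\<mu>)))) \<le> 1"
      by (rule INF_lower2[of 0]) (auto intro!: Bochner_Integration.integral_nonneg w_nonneg)
    ultimately show ?thesis by simp
  qed (use INF_exp_integral_w_eq_0[OF 0, of 0] in simp)
next
  case (Suc i)
  note \<mu> = Suc.prems
  interpret prob_space "P \<mu>" by (rule markov_law[OF markov \<mu>])
  have ih: "0 \<le> real i * h" using h by simp
  show ?case
  proof (cases "(\<integral>x. exit_cutoff R x \<partial>\<mu>) = 0")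
    case False
    then show ?thesis using INF_exp_integral_w_eq_0[OF \<mu>, of "real (Suc i) * h"] h by simp
  next
    case True
    define f where "f = (\<lambda>k \<omega>. ennreal (exp (- (\<integral>x. w k (real i * h) x \<partial>\<omega> h))))"
    have fm: "f k \<in> borel_measurable (P \<mu>)" for k
      unfolding f_def measurable_markov_law[OF markov \<mu>]
      using h by (intro measurable_compose[OF measurable_skorokhod_integral[OF w_cont[OF ih] bounded_w[OF ih], of h],
          of "\<lambda>y. ennreal (exp (- y))"]) auto
    have f1: "f k \<omega> \<le> 1" for k \<omega>
      unfolding f_def by (simp add: Bochner_Integration.integral_nonneg w_nonneg[OF ih])
    have path: "\<omega> h \<in> finite_measures" if "\<omega> \<in> space (P \<mu>)" for \<omega>
      using skorokhod_paths(2)[of \<omega> h] that h markov_law(3)[OF markov \<mu>] by simp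
    have "(INF k. ennreal (exp (- (\<integral>x. w k (real (Suc i) * h) x \<partial>\<mu>)))) \<le> (INF k. \<integral>\<^sup>+\<omega>. f k \<omega> \<partial>P \<mu>)"
    proof (rule INF_mono)
      fix k
      have "real i * h + h = real (Suc i) * h" by (simp add: algebra_simps)
      then show "\<exists>k'\<in>UNIV. ennreal (exp (- (\<integral>x. w k' (real (Suc i) * h) x \<partial>\<mu>))) \<le> (\<integral>\<^sup>+\<omega>. f k \<omega> \<partial>P \<mu>)"
        using w_super[OF \<mu> ih h, of k] unfolding f_def by (intro bexI[of _ k]) auto
    qed
    \<comment> \<open>The functionals decrease in \<open>k\<close> and are at most 1, so monotone
      convergence lets the infimum pass under the expectation.\<close>
    also have "\<dots> = (\<integral>\<^sup>+\<omega>. (INF k. f k \<omega>) \<partial>P \<mu>)"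
    proof (rule nn_integral_monotone_convergence_INF_AE'[symmetric])
      show "AE \<omega> in P \<mu>. f (Suc k) \<omega> \<le> f k \<omega>" for k
      proof (rule AE_I2)
        fix \<omega> assume "\<omega> \<in> space (P \<mu>)"
        then have "(\<integral>x. w k (real i * h) x \<partial>\<omega> h) \<le> (\<integral>x. w (Suc k) (real i * h) x \<partial>\<omega> h)"
          by (intro integral_mono integrable_w w_mono path ih)
        then show "f (Suc k) \<omega> \<le> f k \<omega>" by (simp add: f_def ennreal_leI)
      qed
      have "(\<integral>\<^sup>+\<omega>. f 0 \<omega> \<partial>P \<mu>) \<le> (\<integral>\<^sup>+\<omega>. 1 \<partial>P \<mu>)" by (intro nn_integral_mono f1)
      then show "(\<integral>\<^sup>+\<omega>. f 0 \<omega> \<partial>P \<mu>) < \<infinity>" by (simp add: emeasure_space_1 order.strict_trans1)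
    qed (rule fm)
    also have "\<dots> \<le> (\<integral>\<^sup>+\<omega>. emeasure (P (\<omega> h)) (grid_event i h R) \<partial>P \<mu>)"
      unfolding f_def by (intro nn_integral_mono Suc.IH path)
    also have "\<dots> = emeasure (P \<mu>) {\<omega> \<in> space skorokhod_space. time_shift h \<omega> \<in> grid_event i h R}"
      using h by (intro emeasure_time_shift[OF markov \<mu>, symmetric] sets_grid_event) auto
    \<comment> \<open>The shifted path satisfies the grid condition at 0, h, ..., i h, that is, the
      original path at h, ..., (i + 1) h; at time 0 it holds because \<open>\<mu>\<close> does not
      charge the outside.\<close>
    also have "\<dots> \<le> emeasure (P \<mu>) (grid_event (Suc i) h R)"
    proof (rule emeasure_mono_AE)
      show "grid_event (Suc i) h R \<in> sets (P \<mu>)"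
        using h by (simp add: markov_law(2)[OF markov \<mu>] sets_grid_event)
      show "AE \<omega> in P \<mu>. \<omega> \<in> {\<omega> \<in> space skorokhod_space. time_shift h \<omega> \<in> grid_event i h R} \<longrightarrow> \<omega> \<in> grid_event (Suc i) h R"
        using markov_start[OF markov \<mu>]
      proof eventually_elim
        fix \<omega> :: "real \<Rightarrow> 'a measure" assume 0: "\<omega> 0 = \<mu>"
        show "\<omega> \<in> {\<omega> \<in> space skorokhod_space. time_shift h \<omega> \<in> grid_event i h R} \<longrightarrow> \<omega> \<in> grid_event (Suc i) h R"
        proof
          assume \<omega>: "\<omega> \<in> {\<omega> \<in> space skorokhod_space. time_shift h \<omega> \<in> grid_event i h R}"
          have "(\<integral>x. exit_cutoff R x \<partial>\<omega> (real j * h)) = 0" if "j \<le> Suc i" for j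
          proof (cases j)
            case 0
            then show ?thesis using True \<open>\<omega> 0 = \<mu>\<close> by simp
          next
            case (Suc l)
            then have "(\<integral>x. exit_cutoff R x \<partial>time_shift h \<omega> (real l * h)) = 0"
              using \<omega> that by (auto simp: grid_event_def)
            then show ?thesis using h Suc by (simp add: time_shift_def algebra_simps)
          qed
          then show "\<omega> \<in> grid_event (Suc i) h R" using \<omega> by (simp add: grid_event_def)
        qed
      qed
    qed
    finally show ?thesis .
  qed
qed

text \<open>The grid bound does not depend on the fineness of the grid, so it survives the passage
  to the limit by continuity from above.\<close>

lemma no_exit_event_lower_bound:
  assumes \<mu>: "\<mu> \<in> finite_measures" and t: "0 < t"
  shows "(INF k. ennreal (exp (- (\<integral>x. w k t x \<partial>\<mu>)))) \<le> emeasure (P \<mu>) (no_exit_event t R)"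
proof -
  interpret prob_space "P \<mu>" by (rule markov_law[OF markov \<mu>])
  have "emeasure (P \<mu>) (no_exit_event t R) = (INF m. emeasure (P \<mu>) (grid_event (2 ^ m) (t / 2 ^ m) R))"
    unfolding no_exit_event_eq_INT_grid_event[OF t]
    by (rule INF_emeasure_decseq[symmetric])
      (use t decseq_grid_event in \<open>auto simp: markov_law(2)[OF markov \<mu>] intro!: sets_grid_event\<close>)
  moreover have "(INF k. ennreal (exp (- (\<integral>x. w k t x \<partial>\<mu>)))) \<le> emeasure (P \<mu>) (grid_event (2 ^ m) (t / 2 ^ m) R)" for m
    using grid_event_lower_bound[OF _ \<mu>, of "t / 2 ^ m" "2 ^ m"] t by simp
  ultimately show ?thesis by (simp add: INF_greatest)
qed

end

text \<open>Almost surely the state at time \<open>\<tau>\<close> again has compact support and so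
  is a legitimate starting measure. Since \<open>\<tau>\<close> is the same for all of them, the
  Markov property can be iterated at its multiples.\<close>

lemma finite_time_compact_support_of_small_time:
  assumes \<tau>: "0 < \<tau>"
    and small: "\<And>\<mu>. \<mu> \<in> compactly_supported_measures \<Longrightarrow>
      AE \<omega> in P \<mu>. bounded (\<Union>s\<in>{0..\<tau>}. measure_support (\<omega> s))"
  shows "finite_time_compact_support_property P"
proof -
  \<comment> \<open>A support is always closed, so its compactness reduces to boundedness, which
    subsets inherit.\<close>
  have cs_iff: "compact (measure_support \<nu>) \<longleftrightarrow> bounded (measure_support \<nu>)" for \<nu> :: "'a measure"
  proof -
    have "closed (measure_support \<nu>)"
      unfolding closed_def open_subopen[of "- measure_support \<nu>"]
      by (auto simp: measure_support_def)
    then show ?thesis by (simp add: compact_eq_bounded_closed)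
  qed
  have iter: "\<mu> \<in> compactly_supported_measures \<Longrightarrow>
      AE \<omega> in P \<mu>. bounded (\<Union>s\<in>{0..real (Suc n) * \<tau>}. measure_support (\<omega> s))" for n \<mu>
  proof (induction n arbitrary: \<mu>)
    case 0
    then show ?case using small[OF 0] by simp
  next
    case (Suc n)
    let ?t = "real (Suc n) * \<tau>"
    let ?E = "{\<omega> \<in> space skorokhod_space. compact (closure (\<Union>s\<in>{0..?t}. measure_support (\<omega> s)))} :: (real \<Rightarrow> 'a measure) set"
    have t: "0 < ?t" using \<tau> by simp
    have \<mu>: "\<mu> \<in> finite_measures" using Suc.prems by (simp add: compactly_supported_measures_def)
    interpret prob_space "P \<mu>" by (rule markov_law[OF markov \<mu>])
    have "AE \<omega> in P \<mu>. emeasure (P (\<omega> \<tau>)) ?E = 1"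
      using small[OF Suc.prems] AE_space
    proof eventually_elim
      fix \<omega> assume \<omega>: "bounded (\<Union>s\<in>{0..\<tau>}. measure_support (\<omega> s))" "\<omega> \<in> space (P \<mu>)"
      have fm: "\<omega> \<tau> \<in> finite_measures"
        using skorokhod_paths(2)[of \<omega> \<tau>] \<omega>(2) \<tau> markov_law(3)[OF markov \<mu>] by simp
      have "bounded (measure_support (\<omega> \<tau>))"
        using \<tau> by (intro bounded_subset[OF \<omega>(1)] UN_upper) auto
      then have "\<omega> \<tau> \<in> compactly_supported_measures"
        using fm by (simp add: compactly_supported_measures_def cs_iff)
      from Suc.IH[OF this] AE_space have "AE \<omega>' in P (\<omega> \<tau>). \<omega>' \<in> ?E"
        by eventually_elim (simp add: compact_closure markov_law(3)[OF markov fm])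
      moreover have "?E \<in> sets (P (\<omega> \<tau>))"
        unfolding markov_law(2)[OF markov fm] by (rule sets_compact_support_event[OF t])
      ultimately show "emeasure (P (\<omega> \<tau>)) ?E = 1"
        by (intro prob_space.emeasure_eq_1_AE[OF markov_law(1)[OF markov fm]])
    qed
    then have "(\<integral>\<^sup>+\<omega>. emeasure (P (\<omega> \<tau>)) ?E \<partial>P \<mu>) = (\<integral>\<^sup>+\<omega>. 1 \<partial>P \<mu>)"
      by (rule nn_integral_cong_AE)
    then have one: "emeasure (P \<mu>) {\<omega> \<in> space skorokhod_space. time_shift \<tau> \<omega> \<in> ?E} = 1"
      using emeasure_time_shift[OF markov \<mu> _ sets_compact_support_event[OF t], of \<tau>] \<tau>
      by (simp add: emeasure_space_1)
    have "AE \<omega> in P \<mu>. \<omega> \<in> {\<omega> \<in> space skorokhod_space. time_shift \<tau> \<omega> \<in> ?E}"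
      by (rule AE_prob_1) (use one in \<open>simp only: measure_def enn2real_1\<close>)
    with small[OF Suc.prems] show ?case
    proof eventually_elim
      fix \<omega> assume 1: "bounded (\<Union>s\<in>{0..\<tau>}. measure_support (\<omega> s))"
        and 2: "\<omega> \<in> {\<omega> \<in> space skorokhod_space. time_shift \<tau> \<omega> \<in> ?E}"
      have "bounded (\<Union>s\<in>{0..?t}. measure_support (time_shift \<tau> \<omega> s))"
        using 2 by (simp add: compact_closure)
      moreover have "(\<Union>s\<in>{0..real (Suc (Suc n)) * \<tau>}. measure_support (\<omega> s))
          \<subseteq> (\<Union>s\<in>{0..\<tau>}. measure_support (\<omega> s)) \<union> (\<Union>s\<in>{0..?t}. measure_support (time_shift \<tau> \<omega> s))"
      proof
        fix x assume "x \<in> (\<Union>s\<in>{0..real (Suc (Suc n)) * \<tau>}. measure_support (\<omega> s))"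
        then obtain s where s: "0 \<le> s" "s \<le> real (Suc (Suc n)) * \<tau>" "x \<in> measure_support (\<omega> s)" by auto
        show "x \<in> (\<Union>s\<in>{0..\<tau>}. measure_support (\<omega> s)) \<union> (\<Union>s\<in>{0..?t}. measure_support (time_shift \<tau> \<omega> s))"
        proof (cases "s \<le> \<tau>")
          case False
          then have "s - \<tau> \<in> {0..?t}" "x \<in> measure_support (time_shift \<tau> \<omega> (s - \<tau>))"
            using s by (auto simp: time_shift_def algebra_simps)
          then show ?thesis by blast
        qed (use s in auto)
      qed
      ultimately show "bounded (\<Union>s\<in>{0..real (Suc (Suc n)) * \<tau>}. measure_support (\<omega> s))"
        using 1 by (meson bounded_Un bounded_subset)
    qed
  qed
  show ?thesis
    unfolding finite_time_compact_support_property_def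
  proof (intro allI impI ballI)
    fix t :: real and \<mu> :: "'a measure" assume t: "0 < t" and cs: "\<mu> \<in> compactly_supported_measures"
    have \<mu>: "\<mu> \<in> finite_measures" using cs by (simp add: compactly_supported_measures_def)
    interpret prob_space "P \<mu>" by (rule markov_law[OF markov \<mu>])
    obtain n :: nat where "t / \<tau> \<le> real n" using real_arch_simple by blast
    then have n: "t \<le> real (Suc n) * \<tau>" using \<tau> by (simp add: field_simps)
    have "AE \<omega> in P \<mu>. \<omega> \<in> {\<omega> \<in> space (P \<mu>). compact (closure (\<Union>s\<in>{0..t}. measure_support (\<omega> s)))}"
      using iter[OF cs, of n] AE_space
    proof eventually_elim
      fix \<omega> assume "bounded (\<Union>s\<in>{0..real (Suc n) * \<tau>}. measure_support (\<omega> s))" "\<omega> \<in> space (P \<mu>)"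
      moreover have "(\<Union>s\<in>{0..t}. measure_support (\<omega> s)) \<subseteq> (\<Union>s\<in>{0..real (Suc n) * \<tau>}. measure_support (\<omega> s))"
        using n by (intro UN_mono) auto
      ultimately show "\<omega> \<in> {\<omega> \<in> space (P \<mu>). compact (closure (\<Union>s\<in>{0..t}. measure_support (\<omega> s)))}"
        by (auto simp: compact_closure intro: bounded_subset)
    qed
    then show "measure (P \<mu>) {\<omega> \<in> space (P \<mu>). compact (closure (\<Union>s\<in>{0..t}. measure_support (\<omega> s)))} = 1"
      using sets_compact_support_event[OF t]
      by (intro prob_eq_1[THEN iffD2]) (auto simp: markov_law(2,3)[OF markov \<mu>])
  qed
qed

end

section \<open>Choice of the parameters\<close>

text \<open>If the bound failed at every large radius, the quotient would eventually stay below a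
  number that the upper limit exceeds. A limit superior yields good radii only along a sequence,
  which is why the radius is later chosen subject to all its other lower bounds at once.\<close>

lemma gaussian_decay_of_Limsup:
  fixes \<beta> :: "'a::euclidean_space \<Rightarrow> real"
  assumes pos: "\<And>x. 0 < \<beta> x" and cont: "continuous_on UNIV \<beta>"
    and lim: "Limsup at_top (\<lambda>R::real. ereal (ln (INF x\<in>cball 0 R. \<beta> x) / R\<^sup>2)) > - \<infinity>"
  obtains c where "0 < c" "\<And>R0. \<exists>R\<ge>R0. \<forall>x. norm x \<le> R \<longrightarrow> exp (- (c * R\<^sup>2)) \<le> \<beta> x"
proof -
  obtain a where a: "ereal a < Limsup at_top (\<lambda>R::real. ereal (ln (INF x\<in>cball 0 R. \<beta> x) / R\<^sup>2))"
    using ereal_dense2[OF lim] by blast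
  \<comment> \<open>The maximum with 1 keeps \<open>c\<close> positive whatever the sign of
    \<open>a\<close>.\<close>
  define c where "c = max 1 (- a)"
  have "\<exists>R\<ge>R0. \<forall>x. norm x \<le> R \<longrightarrow> exp (- (c * R\<^sup>2)) \<le> \<beta> x" for R0
  proof (rule ccontr)
    assume neg: "\<not> (\<exists>R\<ge>R0. \<forall>x. norm x \<le> R \<longrightarrow> exp (- (c * R\<^sup>2)) \<le> \<beta> x)"
    have "ln (INF x\<in>cball 0 R. \<beta> x) / R\<^sup>2 \<le> a" if R: "max 1 R0 \<le> R" for R
    proof -
      obtain x where x: "norm x \<le> R" "\<beta> x < exp (- (c * R\<^sup>2))"
        using neg R by (meson max.bounded_iff not_le)
      \<comment> \<open>The infimum over the ball is attained, hence positive; without positivity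
        its logarithm would carry no information.\<close>
      have "cball 0 R \<noteq> ({} :: 'a set)" using R by simp
      then obtain y :: 'a where y: "y \<in> cball 0 R" "\<And>z. z \<in> cball 0 R \<Longrightarrow> \<beta> y \<le> \<beta> z"
        using continuous_attains_inf[OF compact_cball _ continuous_on_subset[OF cont subset_UNIV]] by blast
      have "\<beta> y \<le> (INF x\<in>cball 0 R. \<beta> x)"
        using y \<open>cball 0 R \<noteq> {}\<close> by (intro cINF_greatest)
      then have I: "0 < (INF x\<in>cball 0 R. \<beta> x)" using pos[of y] by linarith
      have "(INF x\<in>cball 0 R. \<beta> x) \<le> \<beta> x"
        by (rule cINF_lower) (use x y in \<open>auto intro!: bdd_belowI2[of _ "\<beta> y"]\<close>)
      then have "(INF x\<in>cball 0 R. \<beta> x) \<le> exp (- (c * R\<^sup>2))" using x by linarith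
      then have "ln (INF x\<in>cball 0 R. \<beta> x) \<le> - (c * R\<^sup>2)"
        using I by (metis ln_exp ln_le_cancel_iff exp_gt_zero)
      also have "- c \<le> a" by (simp add: c_def)
      then have "- (c * R\<^sup>2) \<le> a * R\<^sup>2" using mult_right_mono[of "- c" a "R\<^sup>2"] by simp
      finally show ?thesis using R by (simp add: divide_le_eq)
    qed
    then have "\<forall>\<^sub>F R in at_top. ereal (ln (INF x\<in>cball 0 R. \<beta> x) / R\<^sup>2) \<le> ereal a"
      unfolding eventually_at_top_linorder by (intro exI[of _ "max 1 R0"]) simp
    then have "Limsup at_top (\<lambda>R::real. ereal (ln (INF x\<in>cball 0 R. \<beta> x) / R\<^sup>2)) \<le> ereal a"
      by (rule Limsup_bounded)
    with a show False by simp
  qed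
  then show thesis by (intro that[of c]) (auto simp: c_def)
qed

lemma barrier_antimono:
  assumes "0 < \<eta>" "\<eta> \<le> \<eta>'" "0 < A"
  shows "barrier \<eta>' j A c R t x \<le> barrier \<eta> j A c R t x"
  unfolding barrier_def profile_def using assms
  by (intro divide_left_mono mult_pos_pos add_pos_nonneg) auto

text \<open>\<open>main\<close> lets the reaction absorb diffusion in the outer part, and the bound
  on \<open>t\<close> keeps the time factor from removing more than (3/4)^m of A = 2^m. Only \<eta>
  varies with the cutoff index \<open>k\<close>, so the estimate of the barrier near the origin is
  uniform in \<open>k\<close> and passes to the infimum.\<close>

lemma no_exit_probability:
  fixes W :: "'a::euclidean_space \<Rightarrow> (real \<Rightarrow> 'a) measure" and \<Psi> :: "'a \<Rightarrow> real \<Rightarrow> real" and \<Phi> :: "real \<Rightarrow> real"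
    and m :: nat
  defines "n \<equiv> 2 * real m" and "d \<equiv> real DIM('a)"
  assumes W: "\<And>x. brownian_law x (W x)" and \<Psi>: "branching_mechanism \<Psi>"
    and sbm: "super_brownian_motion W \<Psi> P"
    and \<Phi>: "spatially_constant_branching_mechanism (\<lambda>_::'a. \<Phi>)"
    and R: "0 < R" and b: "0 < b" and lower: "\<And>x u. norm x \<le> R \<Longrightarrow> 0 \<le> u \<Longrightarrow> b * \<Phi> u \<le> \<Psi> x u"
    and \<kappa>: "0 < \<kappa>" and q: "0 < q" "q < 1" and u1: "0 < u1"
    and growth: "\<And>u. u1 \<le> u \<Longrightarrow> \<kappa> * u powr (1 + q) \<le> \<Phi> u"
    and m: "3 \<le> m" "2 * u1 \<le> 2 ^ m" "2 \<le> n * q"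
    and main: "n * (d + 4 * n) * (4 * 2 powr (- (real m * q))) \<le> b * \<kappa> * R\<^sup>2"
    and t: "0 < t" "4 * n * (d + 4 * n) / R\<^sup>2 * t \<le> real m / 4"
    and \<mu>: "\<mu> \<in> finite_measures" "measure_support \<mu> \<subseteq> cball 0 (R / 4)"
  shows "ennreal (exp (- ((4/5) ^ m * measure \<mu> UNIV))) \<le> emeasure (P \<mu>) (no_exit_event t R)"
proof -
  define j where "j = 2 * m - 3"
  have j_eq: "2 \<le> j" "j + 3 = 2 * m" "real j + 3 = n" using m(1) by (auto simp: j_def n_def)
  define A :: real where "A = 2 ^ m"
  have A: "0 < A" by (simp add: A_def)
  define c where "c = 4 * n * (d + 4 * n) / R\<^sup>2"
  have c: "0 \<le> c" by (simp add: c_def n_def d_def)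
  \<comment> \<open>The shift keeps \<eta> below \<open>1 / (2 * u1)\<close> for every
    \<open>k\<close>; the other half of the allowance \<open>1 / u1\<close> is taken by A (1/2)^n =
    2^-m. Outside the ball the barrier is \<open>k + k0\<close>, at least \<open>k\<close>.\<close>
  define k0 where "k0 = nat \<lceil>2 * u1\<rceil>"
  have k0: "2 * u1 \<le> real k0" unfolding k0_def by linarith
  define \<eta> where "\<eta> k = 1 / (real k + real k0)" for k :: nat
  have eta: "0 < \<eta> k" "\<eta> k \<le> 1 / (2 * u1)" "1 / \<eta> k = real k + real k0" for k
    using k0 u1 by (auto simp: \<eta>_def intro!: divide_left_mono mult_pos_pos)
  define w where "w k r x = barrier (\<eta> k) j A c R r x" for k r and x :: 'a
  have par: "barrier_parameters (\<eta> k) A c R j" for k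
    by standard (use eta A c R j_eq in auto)
  have markov: "markov_family P" using sbm by (simp add: super_brownian_motion_def)
  note \<Phi>_facts = spatially_constant_branching_mechanism_mono[OF \<Phi>]
  have super: "defect_barrier (\<eta> k) j A c R r x \<le> b * \<Phi> (barrier (\<eta> k) j A c R r x)"
    if r: "0 \<le> r" and x: "norm x \<le> R" for k r and x :: 'a
  proof (rule barrier_parameters.defect_barrier_le_reaction[OF par r x _ b \<kappa> q \<Phi>_facts(2) growth u1])
    show "c = 4 * (real j + 3) * (real DIM('a) + 4 * (real j + 3)) / R\<^sup>2"
      by (simp add: c_def j_eq(3) d_def)
    have "A * (1/2) ^ (j + 3) = 1 / 2 ^ m"
      unfolding j_eq(2) A_def by (simp add: power_divide mult_2 power_add)
    also have "\<dots> \<le> 1 / (2 * u1)" using m(2) u1 by (intro divide_left_mono) auto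
    finally have "A * (1/2) ^ (j + 3) \<le> 1 / (2 * u1)" .
    moreover have "1 / (2 * u1) + 1 / (2 * u1) = 1 / u1" by simp
    ultimately show "\<eta> k + A * (1/2) ^ (j + 3) \<le> 1 / u1" using eta(2)[of k] by linarith
    show "2 \<le> (real j + 3) * q" using m(3) by (simp add: j_eq(3))
    \<comment> \<open>The weight contributes 2^(m q) and the power of 1/2 contributes 2^(-2 m q):
      what remains is the exponentially small factor that has to beat the lower bound
      \<open>b\<close> on \<beta>.\<close>
    have "A powr q * (1/2) powr (n * q - 2) = 4 * 2 powr (- (real m * q))"
    proof -
      have "A powr q = 2 powr (real m * q)" by (simp add: A_def powr_powr flip: powr_realpow)
      moreover have "(1/2) powr (n * q - 2) = 2 powr (- (n * q - 2))"
        by (simp only: powr_minus_divide powr_divide) simp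
      ultimately have "A powr q * (1/2) powr (n * q - 2) = 2 powr (real m * q + (- (n * q - 2)))"
        by (simp add: powr_add)
      also have "real m * q + (- (n * q - 2)) = 2 + - (real m * q)" by (simp add: n_def)
      also have "2 powr (2 + - (real m * q)) = 2 powr 2 * 2 powr (- (real m * q))" by (rule powr_add)
      finally show ?thesis by simp
    qed
    then show "(real j + 3) * (real DIM('a) + 4 * (real j + 3)) * (A powr q * (1/2) powr ((real j + 3) * q - 2)) \<le> b * \<kappa> * R\<^sup>2"
      using main by (simp add: j_eq(3) d_def)
  qed
  have w_super: "ennreal (exp (- (\<integral>x. w k (r + h) x \<partial>\<nu>))) \<le> (\<integral>\<^sup>+\<omega>. ennreal (exp (- (\<integral>x. w k r x \<partial>\<omega> h))) \<partial>P \<nu>)"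
    if \<nu>: "\<nu> \<in> finite_measures" and r: "0 \<le> r" and h: "0 < h" for k \<nu> r h
  proof -
    interpret barrier_parameters "\<eta> k" A c R j by (rule par)
    obtain C where C: "0 \<le> C"
      "\<And>r a e v x. 0 \<le> r \<Longrightarrow> 0 \<le> a \<Longrightarrow> a \<le> 1 \<Longrightarrow> 0 < e \<Longrightarrow> e \<le> 1 \<Longrightarrow>
        mild_solution W \<Psi> (\<lambda>x. barrier (\<eta> k) j A c R r x + a) v \<Longrightarrow>
        v x e \<le> barrier (\<eta> k) j A c R (r + e) x + a + C * (e * sqrt e)"
      using barrier_one_step[OF W branching_mechanism_bounds[OF \<Psi>] measurable_branching_mechanism[OF \<Psi>]
          \<Phi>_facts(1,3) less_imp_le[OF b] lower super] by blast
    show ?thesis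
      unfolding w_def
    proof (rule supersolution_laplace[where b = "barrier (\<eta> k) j A c R", OF markov sbm _ _ _ C(1) _ \<nu> r h])
      fix s a e :: real and v and x :: 'a
      assume "0 \<le> s" "0 \<le> a" "a \<le> 1" "0 < e" "e \<le> 1"
        "mild_solution W \<Psi> (\<lambda>x. barrier (\<eta> k) j A c R s x + a) v"
      then show "v x e \<le> barrier (\<eta> k) j A c R (s + e) x + a + C * (e * sqrt e)" by (rule C(2))
    qed (fact continuous_on_barrier barrier_bounds)+
  qed
  have "(INF k. ennreal (exp (- (\<integral>x. w k t x \<partial>\<mu>)))) \<le> emeasure (P \<mu>) (no_exit_event t R)"
  proof (rule no_exit_event_lower_bound[OF markov _ _ _ _ _ w_super \<mu>(1) t(1)])
    fix k and r :: real and x :: 'a assume r: "0 \<le> r"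
    interpret barrier_parameters "\<eta> k" A c R j by (rule par)
    show "continuous_on UNIV (w k r)" unfolding w_def[abs_def] by (rule continuous_on_barrier[OF r])
    show "0 \<le> w k r x" unfolding w_def by (rule barrier_bounds[OF r])
    have "\<eta> (Suc k) \<le> \<eta> k" using k0 u1 unfolding \<eta>_def by (intro divide_left_mono mult_pos_pos) auto
    then show "w k r x \<le> w (Suc k) r x" unfolding w_def by (rule barrier_antimono[OF eta(1) _ A])
    show "real k * exit_cutoff R x \<le> w k r x"
    proof (cases "norm x \<le> R")
      case True
      then have "exit_cutoff R x = 0" by (simp add: exit_cutoff_eq_0_iff)
      then show ?thesis using barrier_bounds(1)[OF r, of x] by (simp add: w_def)
    next
      case False
      have "real k * exit_cutoff R x \<le> real k * 1" by (intro mult_left_mono exit_cutoff_bounds) simp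
      also have "\<dots> \<le> w k r x" using barrier_outside(1)[of x r] False eta(3)[of k] by (simp add: w_def)
      finally show ?thesis .
    qed
  next
    fix k
    interpret barrier_parameters "\<eta> k" A c R j by (rule par)
    show "\<exists>B. \<forall>r\<ge>0. \<forall>x. w k r x \<le> B" unfolding w_def using barrier_bounds(2) by blast
  qed
  moreover have "ennreal (exp (- ((4/5) ^ m * measure \<mu> UNIV))) \<le> ennreal (exp (- (\<integral>x. w k t x \<partial>\<mu>)))" for k
  proof -
    interpret barrier_parameters "\<eta> k" A c R j by (rule par)
    interpret \<mu>: finite_measure \<mu> using \<mu>(1) by (rule finite_measure_of_finite_measures)
    have space: "space \<mu> = UNIV" using sets_eq_imp_space_eq[OF finite_measure_of_finite_measures(2)[OF \<mu>(1)]] by simp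
    \<comment> \<open>Per unit of m, the weight gives a factor 2, the time decay at least 3/4, and
      u^2 at least 5/6 in the ball of radius R/4; their product is 5/4.\<close>
    have near: "w k t x \<le> (4/5) ^ m" if x: "norm x \<le> R / 4" for x
    proof -
      define u where "u = 1 - (norm x)\<^sup>2 / R\<^sup>2"
      have "(norm x)\<^sup>2 \<le> (R / 4)\<^sup>2" using x by (intro power_mono) auto
      then have "(norm x)\<^sup>2 / R\<^sup>2 \<le> 1 / 16" using R by (simp add: power_divide divide_simps)
      then have u: "15 / 16 \<le> u" by (simp add: u_def)
      have "(15 / 16)\<^sup>2 \<le> u\<^sup>2" using u by (intro power_mono) auto
      then have u2: "5 / 6 \<le> u\<^sup>2" by (simp add: power2_eq_square)
      \<comment> \<open>Fourth powers are compared: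
        \<open>exp 1 \<le> 3 \<le> 256/81\<close>.\<close>
      have e: "exp (1 / 4) \<le> (4 / 3 :: real)"
      proof (rule power_le_imp_le_base[of _ 3])
        have "exp (1 / 4) ^ Suc 3 = exp (1::real)" by (simp add: exp_of_nat_mult[symmetric])
        also have "\<dots> \<le> 3" by (rule exp_le)
        also have "\<dots> \<le> (4 / 3) ^ Suc 3" by (simp add: eval_nat_numeral)
        finally show "exp (1 / 4) ^ Suc 3 \<le> (4 / 3 :: real) ^ Suc 3" .
      qed simp
      have "exp (c * t) \<le> exp (real m * (1 / 4))" using t(2) by (simp add: c_def)
      also have "\<dots> = exp (1 / 4) ^ m" by (simp only: exp_of_nat_mult)
      also have "\<dots> \<le> (4 / 3) ^ m" using e by (intro power_mono) auto
      finally have ect: "exp (c * t) \<le> (4 / 3) ^ m" .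
      have "(5/4) ^ m = (2 * (3 / 4 :: real) * (5 / 6)) ^ m" by simp
      also have "\<dots> = 2 ^ m * (3 / 4) ^ m * (5 / 6) ^ m" by (simp only: power_mult_distrib)
      also have "\<dots> \<le> 2 ^ m * exp (- (c * t)) * (u\<^sup>2) ^ m"
      proof (intro mult_mono)
        have "(3 / 4) ^ m = 1 / (4 / 3 :: real) ^ m" by (simp add: power_divide)
        also have "\<dots> \<le> 1 / exp (c * t)" using ect by (intro divide_left_mono) auto
        finally show "(3 / 4) ^ m \<le> exp (- (c * t))" by (simp add: exp_minus inverse_eq_divide)
        show "(5 / 6) ^ m \<le> (u\<^sup>2) ^ m" using u2 by (intro power_mono) auto
      qed auto
      also have "\<dots> = A * exp (- (c * t)) * max 0 u ^ (j + 3)"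
        using u by (simp add: A_def j_eq(2) power_mult)
      also have "\<dots> \<le> \<eta> k + A * exp (- (c * t)) * max 0 u ^ (j + 3)" using eta(1)[of k] by simp
      finally have le: "(5/4) ^ m \<le> \<eta> k + A * exp (- (c * t)) * max 0 u ^ (j + 3)" .
      moreover have "0 < \<eta> k + A * exp (- (c * t)) * max 0 u ^ (j + 3)"
        by (rule less_le_trans[OF _ le]) simp
      ultimately have "1 / (\<eta> k + A * exp (- (c * t)) * max 0 u ^ (j + 3)) \<le> 1 / (5/4) ^ m"
        by (intro divide_left_mono mult_pos_pos) auto
      also have "\<dots> = (4/5) ^ m" by (simp add: power_divide)
      finally show ?thesis by (simp add: w_def barrier_def profile_def u_def)
    qed
    have ae: "AE x in \<mu>. norm x \<le> R / 4"
    proof -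
      have "(\<integral>x. exit_cutoff (R / 4) x \<partial>\<mu>) = 0"
        using integral_exit_cutoff_eq_0_iff[OF \<mu>(1)] \<mu>(2) by blast
      then have "AE x in \<mu>. exit_cutoff (R / 4) x = 0"
        by (subst (asm) integral_nonneg_eq_0_iff_AE[OF integrable_exit_cutoff[OF \<mu>(1)]]) (auto simp: exit_cutoff_bounds)
      then show ?thesis by (simp add: exit_cutoff_eq_0_iff)
    qed
    have "(\<integral>x. w k t x \<partial>\<mu>) \<le> (\<integral>x. (4/5) ^ m \<partial>\<mu>)"
    proof (rule integral_mono_AE)
      have "\<bar>w k t x\<bar> \<le> 1 / \<eta> k" for x
        using barrier_bounds[of t x] t(1) by (simp add: w_def)
      then show "integrable \<mu> (w k t)"
        unfolding w_def[abs_def] by (rule integrable_finite_measures[OF \<mu>(1) measurable_barrier])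
      show "AE x in \<mu>. w k t x \<le> (4/5) ^ m" using ae by eventually_elim (rule near)
    qed simp
    then show ?thesis by (simp add: space mult.commute ennreal_leI)
  qed
  ultimately show ?thesis by (meson INF_greatest order_trans)
qed

theorem corollary3p3:
  fixes W :: "'a::euclidean_space \<Rightarrow> (real \<Rightarrow> 'a) measure"
    and \<Psi> :: "'a \<Rightarrow> real \<Rightarrow> real"
    and P :: "'a measure \<Rightarrow> (real \<Rightarrow> 'a measure) measure"
    and \<beta> :: "'a \<Rightarrow> real"
    and \<Phi> :: "real \<Rightarrow> real"
    and p :: real
  assumes "\<And>x. brownian_law x (W x)"
    and "branching_mechanism \<Psi>"
    and "super_brownian_motion W \<Psi> P"
    and "\<And>x. 0 < \<beta> x" and "bounded (range \<beta>)" and "continuous_on UNIV \<beta>"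
    and "spatially_constant_branching_mechanism (\<lambda>_::'a. \<Phi>)"
    and "0 < p" and "p \<le> 1"
    and "regularly_varying (1 + p) \<Phi>"
    and "\<And>x u. 0 \<le> u \<Longrightarrow> \<beta> x * \<Phi> u \<le> \<Psi> x u"
    and "Limsup at_top (\<lambda>R::real. ereal (ln (INF x\<in>cball 0 R. \<beta> x) / R\<^sup>2)) > - \<infinity>"
  shows "finite_time_compact_support_property P"
proof -
  note \<Phi>_facts = spatially_constant_branching_mechanism_mono[OF assms(7)]
  have markov: "markov_family P" using assms(3) by (simp add: super_brownian_motion_def)
  obtain \<kappa> u1 where \<kappa>: "0 < \<kappa>" "1 \<le> u1" "\<And>u. u1 \<le> u \<Longrightarrow> \<kappa> * u powr (1 + p / 2) \<le> \<Phi> u"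
    using regularly_varying_lower_bound[OF assms(10,8) \<Phi>_facts(1)] by blast
  obtain c where c: "0 < c" "\<And>R0. \<exists>R\<ge>R0. \<forall>x. norm x \<le> R \<longrightarrow> exp (- (c * R\<^sup>2)) \<le> \<beta> x"
    using gaussian_decay_of_Limsup[OF assms(4,6,12)] by blast
  \<comment> \<open>The exponent left over by the lower bound on \<open>\<Phi>\<close>. Being half
    of \<open>p\<close>, it is strictly below 1 even when \<open>p = 1\<close>.\<close>
  define q where "q = p / 2"
  have q: "0 < q" "q < 1" using assms(8,9) by (auto simp: q_def)
  define d where "d = real DIM('a)"
  have d: "1 \<le> d" using DIM_positive[where 'a='a] by (simp add: d_def)
  \<comment> \<open>For m at least N R^2 this makes 2^(-m q) at most exp (-(c + 1) R^2): the part
    with c matches the lower bound on \<beta>, and the spare exp (-R^2) absorbs polynomial factors.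
    The summand 3 ensures \<open>3 \<le> m\<close>.\<close>
  define N where "N = 3 + (c + 1) / (q * ln 2)"
  have N: "3 \<le> N" "c + 1 \<le> N * (q * ln 2)"
  proof -
    have pos: "0 < q * ln 2" using q by simp
    show "3 \<le> N" using c(1) pos by (simp add: N_def del: zero_less_mult_iff)
    have "c + 1 = (c + 1) / (q * ln 2) * (q * ln 2)" using q by simp
    also have "\<dots> \<le> N * (q * ln 2)" using pos unfolding N_def by (intro mult_right_mono) auto
    finally show "c + 1 \<le> N * (q * ln 2)" .
  qed
  \<comment> \<open>The rate of the time factor is at most 8 m (d + 16 N), so over this time its
    exponent is at most m/8, whatever the radius.\<close>
  define \<tau> where "\<tau> = 1 / (64 * (d + 16 * N))"
  have \<tau>: "0 < \<tau>" using d N by (simp add: \<tau>_def)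
  have no_exit: "\<exists>n. ennreal (exp (- \<delta>)) \<le> emeasure (P \<mu>) (no_exit_event \<tau> (real n))"
    if cs: "\<mu> \<in> compactly_supported_measures" and \<delta>: "0 < \<delta>" for \<mu> \<delta>
  proof -
    have \<mu>: "\<mu> \<in> finite_measures" using cs by (simp add: compactly_supported_measures_def)
    interpret prob_space "P \<mu>" by (rule markov_law[OF markov \<mu>])
    have "bounded (measure_support \<mu>)"
      using cs by (simp add: compactly_supported_measures_def compact_imp_bounded)
    then obtain r0 where r0: "\<And>x. x \<in> measure_support \<mu> \<Longrightarrow> norm x \<le> r0" by (auto simp: bounded_iff)
    \<comment> \<open>The mass of \<open>\<mu>\<close>, increased by 1 so that the division also
      makes sense for the zero measure.\<close>
    define D where "D = measure \<mu> UNIV + 1"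
    have D: "0 < D" "measure \<mu> UNIV \<le> D" by (auto simp: D_def add_nonneg_pos)
    obtain M0 where M0: "(4/5) ^ M0 < \<delta> / D"
      using real_arch_pow_inv[of "\<delta> / D" "4/5"] \<delta> D by auto
    define K where "K = 32 * N * (d + 16 * N) / \<kappa>"
    \<comment> \<open>Each lower bound has its task: 1 gives R \<le> R^2, \<open>4 * r0\<close> puts
      the support into the ball of radius R/4, \<open>2 * u1\<close> gives 2 u1 \<le> m,
      \<open>K\<close> yields the main inequality, and \<open>M0\<close> makes (4/5)^m times the
      mass at most \<delta>.\<close>
    obtain R where R_ge: "Max {1, 4 * r0, 2 * u1, K, real M0} \<le> R"
      and R_\<beta>: "\<And>x. norm x \<le> R \<Longrightarrow> exp (- (c * R\<^sup>2)) \<le> \<beta> x"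
      using c(2) by blast
    have R: "1 \<le> R" "4 * r0 \<le> R" "2 * u1 \<le> R" "K \<le> R" "real M0 \<le> R" using R_ge by auto
    have R2: "R \<le> R\<^sup>2" "1 \<le> R\<^sup>2" using R(1) mult_mono[of 1 R 1 R] mult_left_mono[of 1 R R] by (auto simp: power2_eq_square)
    define m where "m = nat \<lceil>N * R\<^sup>2\<rceil>"
    have NR: "R\<^sup>2 \<le> N * R\<^sup>2" "3 \<le> N * R\<^sup>2"
      using N(1) R2 mult_mono[of 1 N "R\<^sup>2" "R\<^sup>2"] mult_mono[of 3 N 1 "R\<^sup>2"] by auto
    have m_lower: "N * R\<^sup>2 \<le> real m" unfolding m_def by linarith
    have "real m \<le> N * R\<^sup>2 + 1" unfolding m_def using NR by linarith
    then have m_upper: "real m \<le> 2 * N * R\<^sup>2" using NR by linarith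
    have dm: "d + 8 * real m \<le> (d + 16 * N) * R\<^sup>2"
    proof -
      have "d * 1 \<le> d * R\<^sup>2" using d R2 by (intro mult_left_mono) auto
      then show ?thesis using m_upper by (simp add: algebra_simps)
    qed
    have "ennreal (exp (- ((4/5) ^ m * measure \<mu> UNIV))) \<le> emeasure (P \<mu>) (no_exit_event \<tau> R)"
    proof (rule no_exit_probability[OF assms(1-3,7) _ _ _ \<kappa>(1) q _ _ _ _ _ _ \<tau> _ \<mu>])
      show "0 < R" using R by simp
      show "0 < exp (- (c * R\<^sup>2))" by simp
      show "exp (- (c * R\<^sup>2)) * \<Phi> u \<le> \<Psi> x u" if "norm x \<le> R" "0 \<le> u" for x u
        using mult_right_mono[OF R_\<beta>[OF that(1)] \<Phi>_facts(2)[OF that(2)]] assms(11)[OF that(2), of x] by linarith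
      show "0 < u1" using \<kappa>(2) by simp
      show "\<kappa> * u powr (1 + q) \<le> \<Phi> u" if "u1 \<le> u" for u using \<kappa>(3)[OF that] by (simp add: q_def)
      show "3 \<le> m" using m_lower NR by linarith
      have "2 * u1 \<le> real m" using R(3) R2 NR m_lower by linarith
      also have "real m \<le> 2 ^ m" using of_nat_less_two_power[of m] by (simp add: less_imp_le)
      finally show "2 * u1 \<le> 2 ^ m" .
      show "2 \<le> 2 * real m * q"
      proof -
        have "1 \<le> N * (q * ln 2)" using N(2) c(1) by simp
        also have "\<dots> \<le> N * (q * 1)"
          using N(1) q ln_2_less_1 by (intro mult_left_mono) auto
        also have "\<dots> \<le> real m * q"
        proof -
          have "N * 1 \<le> N * R\<^sup>2" using N(1) R2 by (intro mult_left_mono) auto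
          then have "N \<le> real m" using m_lower by linarith
          then show ?thesis using q by (simp add: mult_right_mono)
        qed
        finally show ?thesis by simp
      qed
      show "2 * real m * (real DIM('a) + 4 * (2 * real m)) * (4 * 2 powr (- (real m * q))) \<le> exp (- (c * R\<^sup>2)) * \<kappa> * R\<^sup>2"
      proof -
        have e1: "2 powr (- (real m * q)) \<le> exp (- (c * R\<^sup>2)) * exp (- R\<^sup>2)"
        proof -
          have "(c + 1) * R\<^sup>2 \<le> N * (q * ln 2) * R\<^sup>2" using N(2) by (rule mult_right_mono) simp
          also have "\<dots> = (N * R\<^sup>2) * (q * ln 2)" by simp
          also have "\<dots> \<le> real m * (q * ln 2)" using m_lower q by (intro mult_right_mono) auto
          finally have "(c + 1) * R\<^sup>2 \<le> real m * (q * ln 2)" .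
          then have "exp (- (real m * (q * ln 2))) \<le> exp (- ((c + 1) * R\<^sup>2))" by simp
          also have "\<dots> = exp (- (c * R\<^sup>2)) * exp (- R\<^sup>2)"
            by (simp add: exp_add[symmetric] algebra_simps)
          finally show ?thesis by (simp add: powr_def mult.assoc)
        qed
        \<comment> \<open>Two factors R^2 have to be absorbed, since \<open>m\<close> enters the
          main inequality quadratically and is of order R^2.\<close>
        have e2: "exp (- R\<^sup>2) \<le> 2 / (R\<^sup>2 * R\<^sup>2)"
        proof -
          have "R\<^sup>2 * R\<^sup>2 / 2 \<le> exp (R\<^sup>2)"
            using exp_lower_Taylor_quadratic[of "R\<^sup>2"] R2 by (simp add: power2_eq_square[of "R\<^sup>2"])
          then have "1 / exp (R\<^sup>2) \<le> 1 / (R\<^sup>2 * R\<^sup>2 / 2)"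
            using R by (intro divide_left_mono mult_pos_pos) auto
          then show ?thesis by (simp add: exp_minus inverse_eq_divide)
        qed
        have K: "32 * N * (d + 16 * N) \<le> \<kappa> * R\<^sup>2"
        proof -
          have "K \<le> R\<^sup>2" using R(4) R2 by linarith
          then show ?thesis using \<kappa>(1) by (simp add: K_def pos_divide_le_eq mult.commute)
        qed
        have "2 * real m * (d + 8 * real m) \<le> 2 * (2 * N * R\<^sup>2) * ((d + 16 * N) * R\<^sup>2)"
          using m_upper dm N(1) d by (intro mult_mono) auto
        then have "2 * real m * (d + 8 * real m) * (4 * 2 powr (- (real m * q)))
            \<le> 2 * (2 * N * R\<^sup>2) * ((d + 16 * N) * R\<^sup>2) * (4 * (exp (- (c * R\<^sup>2)) * (2 / (R\<^sup>2 * R\<^sup>2))))"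
        proof (rule mult_mono)
          show "4 * 2 powr (- (real m * q)) \<le> 4 * (exp (- (c * R\<^sup>2)) * (2 / (R\<^sup>2 * R\<^sup>2)))"
            by (intro mult_left_mono order_trans[OF e1] e2) auto
        qed (use N(1) d in auto)
        also have "\<dots> = exp (- (c * R\<^sup>2)) * (32 * N * (d + 16 * N))"
          using R(1) by (simp add: field_simps)
        also have "\<dots> \<le> exp (- (c * R\<^sup>2)) * (\<kappa> * R\<^sup>2)" using K by (intro mult_left_mono) auto
        finally show ?thesis by (simp add: d_def mult.assoc)
      qed
      show "4 * (2 * real m) * (real DIM('a) + 4 * (2 * real m)) / R\<^sup>2 * \<tau> \<le> real m / 4"
      proof -
        have "4 * (2 * real m) * (d + 4 * (2 * real m)) / R\<^sup>2 * \<tau> \<le> 4 * (2 * real m) * ((d + 16 * N) * R\<^sup>2) / R\<^sup>2 * \<tau>"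
          using dm \<tau> by (intro mult_right_mono divide_right_mono mult_left_mono) auto
        also have "\<dots> = real m / 8"
        proof -
          define s where "s = d + 16 * N"
          have "0 < s" using d N(1) by (simp add: s_def)
          then show ?thesis
            unfolding \<tau>_def s_def[symmetric] using R(1) by (simp add: field_simps)
        qed
        finally show ?thesis by (simp add: d_def)
      qed
      show "measure_support \<mu> \<subseteq> cball 0 (R / 4)" using r0 R(2) by force
    qed
    moreover have "exp (- \<delta>) \<le> exp (- ((4/5) ^ m * measure \<mu> UNIV))"
    proof -
      have "real M0 \<le> real m" using R(5) R2 NR m_lower by linarith
      then have "(4/5) ^ m \<le> (4/5 :: real) ^ M0" by (intro power_decreasing) auto
      then have le: "(4/5) ^ m \<le> \<delta> / D" using M0 by linarith
      then have "(4/5) ^ m * measure \<mu> UNIV \<le> \<delta> / D * D"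
        using D \<delta> by (intro mult_mono[OF le]) auto
      then show ?thesis using D by simp
    qed
    \<comment> \<open>The radius is rounded up to an integer, so that the event is one of the
      countable union that makes up the compact support event.\<close>
    moreover have "emeasure (P \<mu>) (no_exit_event \<tau> R) \<le> emeasure (P \<mu>) (no_exit_event \<tau> (real (nat \<lceil>R\<rceil>)))"
    proof (rule emeasure_mono)
      show "no_exit_event \<tau> R \<subseteq> (no_exit_event \<tau> (real (nat \<lceil>R\<rceil>)) :: (real \<Rightarrow> 'a measure) set)"
      proof
        fix \<omega> :: "real \<Rightarrow> 'a measure" assume \<omega>: "\<omega> \<in> no_exit_event \<tau> R"
        then have sp: "\<omega> \<in> space skorokhod_space" by (simp add: no_exit_event_def)
        have "cball 0 R \<subseteq> cball (0 :: 'a) (real (nat \<lceil>R\<rceil>))" by (rule subset_cball) linarith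
        then show "\<omega> \<in> no_exit_event \<tau> (real (nat \<lceil>R\<rceil>))"
          using \<omega> integral_exit_cutoff_eq_0_iff[OF skorokhod_paths(2)[OF sp]]
          by (fastforce simp: no_exit_event_def)
      qed
    qed (simp add: markov_law(2)[OF markov \<mu>] sets_no_exit_event \<tau>)
    ultimately show ?thesis by (meson ennreal_leI order_trans)
  qed
  show ?thesis
  proof (rule finite_time_compact_support_of_small_time[OF markov \<tau>])
    fix \<mu> :: "'a measure" assume cs: "\<mu> \<in> compactly_supported_measures"
    have \<mu>: "\<mu> \<in> finite_measures" using cs by (simp add: compactly_supported_measures_def)
    interpret prob_space "P \<mu>" by (rule markov_law[OF markov \<mu>])
    define E :: "(real \<Rightarrow> 'a measure) set" where "E = {\<omega> \<in> space skorokhod_space. compact (closure (\<Union>s\<in>{0..\<tau>}. measure_support (\<omega> s)))}"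
    have E: "E \<in> sets (P \<mu>)"
      unfolding E_def using sets_compact_support_event[OF \<tau>] by (simp add: markov_law(2)[OF markov \<mu>])
    \<comment> \<open>\<open>E\<close> contains every no-exit event, so its probability is at least
      exp (-\<delta>), hence at least 1 - \<delta>, for each positive \<delta>.\<close>
    have "1 \<le> prob E + \<delta>" if \<delta>: "0 < \<delta>" for \<delta>
    proof -
      obtain n where "ennreal (exp (- \<delta>)) \<le> emeasure (P \<mu>) (no_exit_event \<tau> (real n))"
        using no_exit[OF cs \<delta>] by blast
      also have "\<dots> \<le> emeasure (P \<mu>) E"
        using E unfolding E_def compact_support_event_eq by (intro emeasure_mono) auto
      finally have "exp (- \<delta>) \<le> prob E" by (simp add: emeasure_eq_measure)
      then show ?thesis using exp_ge_add_one_self[of "- \<delta>"] by linarith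
    qed
    then have "1 \<le> prob E" by (rule field_le_epsilon)
    then have "prob E = 1" using prob_le_1[of E] by linarith
    then have "AE \<omega> in P \<mu>. \<omega> \<in> E" by (rule AE_prob_1)
    then show "AE \<omega> in P \<mu>. bounded (\<Union>s\<in>{0..\<tau>}. measure_support (\<omega> s))"
      by eventually_elim (simp add: E_def compact_closure)
  qed
qed

end
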